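(* Let $\{\mathcal T_h\}_h$ be a sequence of meshes resolving the geometry of $\Gamma$ (in the sense of the context) for which $\|P_h\|_{\mathcal L(H^1_* )}$ and $C_{\mathrm{inv},h}$ are bounded uniformly in $h$. Let $(u_0,f)\in L^2_\Gamma\times L^2(I;H^{-1}_\Gamma)$. If $u_h\in\mathbb U_h$ solves the semidiscrete problem $b_h(u_h,v_h)=\ell(v_h)$ for all $v_h\in\mathbb V_h$, then $$\|\Delta_hu_h\|_{L^2(I;H^{-1}_\Gamma)}+\|\partial_tu_h\|_{L^2(I;H^{-1}_\Gamma)}\le C_{\mathrm{MPR}}\big(\|f\|_{L^2(I;H^{-1}_\Gamma)}+\|u_0\|_{L^2_\Gamma}\big),$$ where $C_{\mathrm{MPR}}$ is an absolute constant multiple of $1/c_*^-$, with $$c_*^-:=\frac{1}{\sqrt8\,(1+2T)\big(\|P_h\|_{\mathcal L(H^1_* )}+C_{\mathrm{inv},h}\big)} .$$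
   Context: Geometry and finite elements. $\Gamma\subset\mathbb R^n$ is a closed (compact, boundaryless) hypersurface of class $C^2$ with principal curvatures $\kappa_1,\dots,\kappa_{n-1}$ and unit normal $\mathbf n$; integration and evaluation on $\Gamma$ are exact. $\mathcal T_h$ is the set of those elements $T$ (of diameter $h_T$) of a mesh of a region of $\mathbb R^n$ surrounding $\Gamma$ that intersect $\Gamma$; $\Omega_h$ is the union of the $T\in\mathcal T_h$, and $h=\max_T h_T$. Resolution of the geometry: $h_T\le C(\max_i\|\kappa_i\|_{L^\infty(\Gamma\cap T)})^{-1}$ for all $T\in\mathcal T_h$, with a generic constant $C$ such that the closest point projection $\mathbf p$ onto $\Gamma$ is well defined on $\Omega_h$. The normal is extended to $\Omega_h$ by $\mathbf n\circ\mathbf p$ (still denoted $\mathbf n$) and $\nabla_{\mathbf n}:=\mathbf n\cdot\nabla$. $V_h$ is a finite element space of continuous functions on $\Omega_h$, piecewise polynomial over $\mathcal T_h$, so that $V_h|_\Gamma\subset H^1(\Gamma)$. No shape-regularity or quasi-uniformity is assumed. Stabilized forms and norms. Write $L^2_\Gamma=L^2(\Gamma)$, $H^1_\Gamma=H^1(\Gamma)$, $\|v\|_{H^1_\Gamma}^2=\|v\|_{L^2_\Gamma}^2+\|\nabla_\Gamma v\|_{L^2_\Gamma}^2$; $H^{-1}_\Gamma$ is the dual of $H^1_\Gamma$ (no mean value constraint), with pairing $\langle\cdot,\cdot\rangle_\Gamma$ extending the inner product $(\cdot,\cdot)_\Gamma$ of $L^2_\Gamma$. For $j\in\{0,1\}$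 and $v_h,w_h\in V_h$ let $$s_{j,T}(v_h,w_h)=h_T^{1-2j}\int_T(\nabla_{\mathbf n}v_h)(\nabla_{\mathbf n}w_h)\,dx,\qquad s_j=\sum_{T\in\mathcal T_h}s_{j,T}.$$ Set $(v_h,w_h)_*=\langle v_h,w_h\rangle_*=(v_h,w_h)_\Gamma+s_0(v_h,w_h)$, $a_*(v_h,w_h)=(\nabla_\Gamma v_h,\nabla_\Gamma w_h)_\Gamma+s_1(v_h,w_h)$, $\|v_h\|_{H^1_*}^2=\|v_h\|_{H^1_\Gamma}^2+s_1(v_h,v_h)$, and $\|v_h\|_{L^2_*(T)}^2=\|v_h\|_{L^2(\Gamma\cap T)}^2+s_{0,T}(v_h,v_h)$. The method is assumed well defined, i.e. $(\cdot,\cdot)_*$ is an inner product on $V_h$. Stabilized $L^2$-projection: $P_h:H^{-1}_\Gamma\to V_h$, $(P_hu,v_h)_*=\langle u,v_h\rangle_\Gamma$ for all $v_h\in V_h$; $\|P_h\|_{\mathcal L(H^1_* )}=\sup_{0\ne v\in H^1_\Gamma}\|P_hv\|_{H^1_*}/\|v\|_{H^1_\Gamma}$. Discrete dual norm and inverse parameter: $$\|v_h\|_{V_h^{-1}}=\sup_{0\ne w_h\in V_h}\frac{(v_h,w_h)_*}{\|w_h\|_{H^1_*}},\qquad C_{\mathrm{inv},h}=\sup_{0\ne v_h\in V_h}\frac{\big(\sum_{T\in\mathcal T_h}h_T^2\|v_h\|_{L^2_*(T)}^2\big)^{1/2}}{\|v_h\|_{V_h^{-1}}}.$$ Discrete Laplace–Beltrami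 operator: for $v_h\in V_h$, $\Delta_hv_h\in V_h$ is defined by $\langle\Delta_hv_h,w_h\rangle_*=a_*(v_h,w_h)$ for all $w_h\in V_h$. Parabolic setting. $I=(0,T)$ with $0<T<\infty$ (the letter $T$ is also used for elements). $\mathbb U_h=H^1(I;V_h)$, $\mathbb V_h=V_h\times L^2(I;V_h)$, and for $u_h\in\mathbb U_h$, $v_h=(v_{h,0},v_{h,1})\in\mathbb V_h$: $$b_h(u_h,v_h)=(u_h(0),v_{h,0})_*+\int_I\big(\langle\partial_tu_h,v_{h,1}\rangle_*+a_*(u_h,v_{h,1})\big)\,dt,\qquad \ell(v_h)=(u_0,v_{h,0})_\Gamma+\int_I\langle f,v_{h,1}\rangle_\Gamma\,dt .$$ *)

theory Defs
  imports "HOL-Analysis.Analysis" "HOL-Probability.Essential_Supremum"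
begin

text \<open>
  Closed hypersurface of class \<open>C\<^sup>2\<close> with unit normal \<open>\<nu>\<close>: locally the zero set of a \<open>C\<^sup>2\<close> function
  \<open>\<phi>\<close> with nonvanishing gradient \<open>g\<close> and Hessian \<open>H\<close>.  The sign of \<open>\<phi>\<close> is chosen to match the
  orientation \<open>\<nu>\<close>, so \<open>\<nu>\<close> is an arbitrary continuous choice of unit normal.
\<close>

definition closed_C2_hypersurface :: "'a::euclidean_space set \<Rightarrow> ('a \<Rightarrow> 'a) \<Rightarrow> bool" where
  "closed_C2_hypersurface \<Gamma> \<nu> \<longleftrightarrow> compact \<Gamma> \<and> \<Gamma> \<noteq> {} \<and>
     (\<forall>x\<in>\<Gamma>. \<exists>U (\<phi> :: 'a \<Rightarrow> real) (g :: 'a \<Rightarrow> 'a) (H :: 'a \<Rightarrow> 'a \<Rightarrow>\<^sub>L 'a).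
        open U \<and> x \<in> U \<and>
        (\<forall>y\<in>U. (\<phi> has_derivative (\<lambda>h. g y \<bullet> h)) (at y) \<and>
               (g has_derivative blinfun_apply (H y)) (at y) \<and> g y \<noteq> 0) \<and>
        continuous_on U H \<and>
        \<Gamma> \<inter> U = {y\<in>U. \<phi> y = 0} \<and>
        (\<forall>y\<in>\<Gamma> \<inter> U. \<nu> y = g y /\<^sub>R norm (g y)))"

text \<open>
  Eigenvalues of the Weingarten map \<open>D\<nu>(x)\<close> on the tangent space.  A derivative of \<open>\<nu>\<close> within \<open>\<Gamma>\<close>
  is determined only on tangent vectors, which is all that is used.
\<close>

definition principal_curvatures :: "'a::euclidean_space set \<Rightarrow> ('a \<Rightarrow> 'a) \<Rightarrow> 'a \<Rightarrow> real set" where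
  "principal_curvatures \<Gamma> \<nu> x =
     {\<kappa>. \<exists>W \<tau>. (\<nu> has_derivative W) (at x within \<Gamma>) \<and> \<tau> \<noteq> 0 \<and> \<tau> \<bullet> \<nu> x = 0 \<and> W \<tau> = \<kappa> *\<^sub>R \<tau>}"

text \<open>
  \<open>d\<close>-dimensional Hausdorff measure on the Borel sets, normalised so that it agrees with \<open>d\<close>-dimensional
  surface measure.  Empty sets get cost \<open>0\<close> separately because \<open>0 ^ 0 = 1\<close>; boundedness is required because
  \<^const>\<open>diameter\<close> is only meaningful for bounded sets.  The set function below is a metric outer measure,
  hence countably additive on Borel sets, so \<^const>\<open>measure_of\<close> does return it.
\<close>

definition hausdorff_content :: "nat \<Rightarrow> real \<Rightarrow> 'a::metric_space set \<Rightarrow> ennreal" where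
  "hausdorff_content d \<delta> A =
     (INF U \<in> {U :: nat \<Rightarrow> 'a set. A \<subseteq> (\<Union>i. U i) \<and> (\<forall>i. bounded (U i) \<and> diameter (U i) \<le> \<delta>)}.
        \<Sum>i. if U i = {} then 0 else ennreal (unit_ball_vol (real d) * (diameter (U i) / 2) ^ d))"

definition hausdorff_measure :: "nat \<Rightarrow> 'a::metric_space measure" where
  "hausdorff_measure d =
     measure_of UNIV (sets borel) (\<lambda>A. SUP \<delta>\<in>{0<..}. hausdorff_content d \<delta> A)"

definition surf :: "'a::euclidean_space set \<Rightarrow> 'a measure" where
  "surf \<Gamma> = restrict_space (hausdorff_measure (DIM('a) - 1)) \<Gamma>"

text \<open>
  \<open>max\<^sub>i \<parallel>\<kappa>\<^sub>i\<parallel>\<close> in \<open>L\<^sup>\<infinity>(\<Gamma> \<inter> K)\<close>, with the maximum over the finitely many \<open>i\<close> taken inside.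
\<close>

definition max_curvature :: "'a::euclidean_space set \<Rightarrow> ('a \<Rightarrow> 'a) \<Rightarrow> 'a set \<Rightarrow> ennreal" where
  "max_curvature \<Gamma> \<nu> K =
     esssup (restrict_space (surf \<Gamma>) K) (\<lambda>x. SUP \<kappa>\<in>principal_curvatures \<Gamma> \<nu> x. ennreal \<bar>\<kappa>\<bar>)"

text \<open>
  Elements of \<open>L\<^sup>2(\<Gamma>)\<close> and \<open>H\<^sup>1(\<Gamma>)\<close> are given by representatives \<^typ>\<open>'a \<Rightarrow> real\<close>, whose values off \<open>\<Gamma>\<close> are
  irrelevant; in particular functions on a neighbourhood of \<open>\<Gamma>\<close> stand for their restrictions.
\<close>

definition L2_surf :: "'a::euclidean_space set \<Rightarrow> ('a \<Rightarrow> real) set" where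
  "L2_surf \<Gamma> = {v. v \<in> borel_measurable (surf \<Gamma>) \<and> integrable (surf \<Gamma>) (\<lambda>x. (v x)\<^sup>2)}"

definition ip_surf :: "'a::euclidean_space set \<Rightarrow> ('a \<Rightarrow> real) \<Rightarrow> ('a \<Rightarrow> real) \<Rightarrow> real" where
  "ip_surf \<Gamma> v w = (LINT x|surf \<Gamma>. v x * w x)"

definition norm_L2_surf :: "'a::euclidean_space set \<Rightarrow> ('a \<Rightarrow> real) \<Rightarrow> real" where
  "norm_L2_surf \<Gamma> v = sqrt (ip_surf \<Gamma> v v)"

definition C1_field :: "('a::euclidean_space \<Rightarrow> 'a) \<Rightarrow> ('a \<Rightarrow> 'a \<Rightarrow>\<^sub>L 'a) \<Rightarrow> bool" where
  "C1_field \<phi> D \<longleftrightarrow>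
     (\<forall>x. (\<phi> has_derivative blinfun_apply (D x)) (at x)) \<and> continuous_on UNIV D"

text \<open>Surface divergence of a field with Jacobian \<open>D\<close>: the trace of \<open>D\<close> over the tangent space.\<close>

definition surf_div :: "('a::euclidean_space \<Rightarrow> 'a) \<Rightarrow> ('a \<Rightarrow> 'a \<Rightarrow>\<^sub>L 'a) \<Rightarrow> 'a \<Rightarrow> real" where
  "surf_div \<nu> D x = (\<Sum>b\<in>Basis. b \<bullet> blinfun_apply (D x) b) - \<nu> x \<bullet> blinfun_apply (D x) (\<nu> x)"

text \<open>
  \<open>g\<close> is the weak tangential gradient of \<open>v\<close>, tested with tangential \<open>C\<^sup>1\<close> fields (for which the curvature
  term in the integration by parts formula vanishes).
\<close>

definition has_weak_tgrad ::
  "'a::euclidean_space set \<Rightarrow> ('a \<Rightarrow> 'a) \<Rightarrow> ('a \<Rightarrow> real) \<Rightarrow> ('a \<Rightarrow> 'a) \<Rightarrow> bool" where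
  "has_weak_tgrad \<Gamma> \<nu> v g \<longleftrightarrow>
     g \<in> borel_measurable (surf \<Gamma>) \<and> (\<forall>x\<in>\<Gamma>. g x \<bullet> \<nu> x = 0) \<and>
     (\<forall>\<phi> D. C1_field \<phi> D \<and> (\<forall>x\<in>\<Gamma>. \<phi> x \<bullet> \<nu> x = 0) \<longrightarrow>
        integrable (surf \<Gamma>) (\<lambda>x. v x * surf_div \<nu> D x) \<and>
        integrable (surf \<Gamma>) (\<lambda>x. g x \<bullet> \<phi> x) \<and>
        (LINT x|surf \<Gamma>. v x * surf_div \<nu> D x) = - (LINT x|surf \<Gamma>. g x \<bullet> \<phi> x))"

definition H1_surf :: "'a::euclidean_space set \<Rightarrow> ('a \<Rightarrow> 'a) \<Rightarrow> ('a \<Rightarrow> real) set" where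
  "H1_surf \<Gamma> \<nu> = {v \<in> L2_surf \<Gamma>. \<exists>g. has_weak_tgrad \<Gamma> \<nu> v g \<and> integrable (surf \<Gamma>) (\<lambda>x. (norm (g x))\<^sup>2)}"

definition tgrad :: "'a::euclidean_space set \<Rightarrow> ('a \<Rightarrow> 'a) \<Rightarrow> ('a \<Rightarrow> real) \<Rightarrow> 'a \<Rightarrow> 'a" where
  "tgrad \<Gamma> \<nu> v = (SOME g. has_weak_tgrad \<Gamma> \<nu> v g)"

definition ip_tgrad ::
  "'a::euclidean_space set \<Rightarrow> ('a \<Rightarrow> 'a) \<Rightarrow> ('a \<Rightarrow> real) \<Rightarrow> ('a \<Rightarrow> real) \<Rightarrow> real" where
  "ip_tgrad \<Gamma> \<nu> v w = (LINT x|surf \<Gamma>. tgrad \<Gamma> \<nu> v x \<bullet> tgrad \<Gamma> \<nu> w x)"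

definition norm_H1_surf :: "'a::euclidean_space set \<Rightarrow> ('a \<Rightarrow> 'a) \<Rightarrow> ('a \<Rightarrow> real) \<Rightarrow> real" where
  "norm_H1_surf \<Gamma> \<nu> v = sqrt ((norm_L2_surf \<Gamma> v)\<^sup>2 + ip_tgrad \<Gamma> \<nu> v v)"

definition Hm1_surf :: "'a::euclidean_space set \<Rightarrow> ('a \<Rightarrow> 'a) \<Rightarrow> (('a \<Rightarrow> real) \<Rightarrow> real) set" where
  "Hm1_surf \<Gamma> \<nu> = {F.
     (\<forall>v\<in>H1_surf \<Gamma> \<nu>. \<forall>w\<in>H1_surf \<Gamma> \<nu>. \<forall>a b. F (\<lambda>x. a * v x + b * w x) = a * F v + b * F w) \<and>
     (\<exists>C. \<forall>v\<in>H1_surf \<Gamma> \<nu>. \<bar>F v\<bar> \<le> C * norm_H1_surf \<Gamma> \<nu> v)}"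

text \<open>
  Suprema of quotients are taken in \<^typ>\<open>ennreal\<close>, so that the supremum over an empty set is \<open>0\<close> and an
  unbounded one is \<open>\<infinity>\<close>.
\<close>

definition norm_Hm1_surf ::
  "'a::euclidean_space set \<Rightarrow> ('a \<Rightarrow> 'a) \<Rightarrow> (('a \<Rightarrow> real) \<Rightarrow> real) \<Rightarrow> real" where
  "norm_Hm1_surf \<Gamma> \<nu> F = enn2real
     (SUP v \<in> {v \<in> H1_surf \<Gamma> \<nu>. norm_H1_surf \<Gamma> \<nu> v \<noteq> 0}. ennreal (\<bar>F v\<bar> / norm_H1_surf \<Gamma> \<nu> v))"

text \<open>The embedding of \<open>L\<^sup>2(\<Gamma>)\<close> into \<open>H\<^sup>-\<^sup>1(\<Gamma>)\<close>: the pairing extends the inner product.\<close>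

definition L2_to_Hm1 :: "'a::euclidean_space set \<Rightarrow> ('a \<Rightarrow> real) \<Rightarrow> ('a \<Rightarrow> real) \<Rightarrow> real" where
  "L2_to_Hm1 \<Gamma> u = (\<lambda>v. ip_surf \<Gamma> u v)"

text \<open>
  Neither shape-regularity nor conformity nor a particular shape of the elements is required.
\<close>

definition mesh_around :: "'a::euclidean_space set \<Rightarrow> 'a set set \<Rightarrow> bool" where
  "mesh_around \<Gamma> M \<longleftrightarrow> finite M \<and>
     (\<forall>K\<in>M. compact K \<and> interior K \<noteq> {} \<and> closure (interior K) = K \<and> negligible (frontier K)) \<and>
     (\<forall>K\<in>M. \<forall>L\<in>M. K \<noteq> L \<longrightarrow> interior K \<inter> interior L = {}) \<and>
     \<Gamma> \<subseteq> interior (\<Union>M)"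

definition cut_mesh :: "'a::euclidean_space set \<Rightarrow> 'a set set \<Rightarrow> 'a set set" where
  "cut_mesh \<Gamma> M = {K\<in>M. K \<inter> \<Gamma> \<noteq> {}}"

definition cut_region :: "'a::euclidean_space set \<Rightarrow> 'a set set \<Rightarrow> 'a set" where
  "cut_region \<Gamma> M = \<Union>(cut_mesh \<Gamma> M)"

text \<open>In \<^typ>\<open>ennreal\<close>, \<open>inverse 0 = \<infinity>\<close>: there is no restriction on \<open>h\<^sub>K\<close> where \<open>\<Gamma>\<close> is flat.\<close>

definition resolves_geometry ::
  "'a::euclidean_space set \<Rightarrow> ('a \<Rightarrow> 'a) \<Rightarrow> real \<Rightarrow> 'a set set \<Rightarrow> bool" where
  "resolves_geometry \<Gamma> \<nu> C M \<longleftrightarrow>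
     (\<forall>K\<in>cut_mesh \<Gamma> M. ennreal (diameter K) \<le> ennreal C * inverse (max_curvature \<Gamma> \<nu> K)) \<and>
     (\<forall>x\<in>cut_region \<Gamma> M. \<exists>!y. y \<in> \<Gamma> \<and> (\<forall>z\<in>\<Gamma>. dist x y \<le> dist x z))"

text \<open>
  The elements of \<open>V\<close> are functions on the cut region, extended by \<open>0\<close> so that equality of
  functions is equality on the cut region.
\<close>

definition fe_space ::
  "'a::euclidean_space set \<Rightarrow> ('a \<Rightarrow> 'a) \<Rightarrow> 'a set set \<Rightarrow> ('a \<Rightarrow> real) set \<Rightarrow> bool" where
  "fe_space \<Gamma> \<nu> M V \<longleftrightarrow>
     (\<lambda>x. 0) \<in> V \<and>
     (\<forall>v\<in>V. \<forall>w\<in>V. \<forall>a b. (\<lambda>x. a * v x + b * w x) \<in> V) \<and>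
     (\<exists>B. finite B \<and> B \<subseteq> V \<and> (\<forall>v\<in>V. \<exists>c. v = (\<lambda>x. \<Sum>b\<in>B. c b * b x))) \<and>
     (\<forall>v\<in>V. continuous_on (cut_region \<Gamma> M) v \<and> (\<forall>x. x \<notin> cut_region \<Gamma> M \<longrightarrow> v x = 0) \<and>
        (\<forall>K\<in>cut_mesh \<Gamma> M. \<exists>p. real_polynomial_function p \<and> (\<forall>x\<in>K. v x = p x))) \<and>
     V \<subseteq> H1_surf \<Gamma> \<nu>"

definition normal_deriv :: "'a::euclidean_space set \<Rightarrow> ('a \<Rightarrow> 'a) \<Rightarrow> ('a \<Rightarrow> real) \<Rightarrow> 'a \<Rightarrow> real" where
  "normal_deriv \<Gamma> \<nu> v x = frechet_derivative v (at x) (\<nu> (closest_point \<Gamma> x))"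

definition s_elem ::
  "'a::euclidean_space set \<Rightarrow> ('a \<Rightarrow> 'a) \<Rightarrow> nat \<Rightarrow> 'a set \<Rightarrow> ('a \<Rightarrow> real) \<Rightarrow> ('a \<Rightarrow> real) \<Rightarrow> real" where
  "s_elem \<Gamma> \<nu> j K v w = diameter K powi (1 - 2 * int j) *
     (LINT x:K|lebesgue. normal_deriv \<Gamma> \<nu> v x * normal_deriv \<Gamma> \<nu> w x)"

definition s_form ::
  "'a::euclidean_space set \<Rightarrow> ('a \<Rightarrow> 'a) \<Rightarrow> 'a set set \<Rightarrow> nat \<Rightarrow> ('a \<Rightarrow> real) \<Rightarrow> ('a \<Rightarrow> real) \<Rightarrow> real" where
  "s_form \<Gamma> \<nu> M j v w = (\<Sum>K\<in>cut_mesh \<Gamma> M. s_elem \<Gamma> \<nu> j K v w)"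

definition ip_star ::
  "'a::euclidean_space set \<Rightarrow> ('a \<Rightarrow> 'a) \<Rightarrow> 'a set set \<Rightarrow> ('a \<Rightarrow> real) \<Rightarrow> ('a \<Rightarrow> real) \<Rightarrow> real" where
  "ip_star \<Gamma> \<nu> M v w = ip_surf \<Gamma> v w + s_form \<Gamma> \<nu> M 0 v w"

definition norm_star ::
  "'a::euclidean_space set \<Rightarrow> ('a \<Rightarrow> 'a) \<Rightarrow> 'a set set \<Rightarrow> ('a \<Rightarrow> real) \<Rightarrow> real" where
  "norm_star \<Gamma> \<nu> M v = sqrt (ip_star \<Gamma> \<nu> M v v)"

definition a_star ::
  "'a::euclidean_space set \<Rightarrow> ('a \<Rightarrow> 'a) \<Rightarrow> 'a set set \<Rightarrow> ('a \<Rightarrow> real) \<Rightarrow> ('a \<Rightarrow> real) \<Rightarrow> real" where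
  "a_star \<Gamma> \<nu> M v w = ip_tgrad \<Gamma> \<nu> v w + s_form \<Gamma> \<nu> M 1 v w"

definition norm_H1_star ::
  "'a::euclidean_space set \<Rightarrow> ('a \<Rightarrow> 'a) \<Rightarrow> 'a set set \<Rightarrow> ('a \<Rightarrow> real) \<Rightarrow> real" where
  "norm_H1_star \<Gamma> \<nu> M v = sqrt ((norm_H1_surf \<Gamma> \<nu> v)\<^sup>2 + s_form \<Gamma> \<nu> M 1 v v)"

definition norm_L2_star_elem ::
  "'a::euclidean_space set \<Rightarrow> ('a \<Rightarrow> 'a) \<Rightarrow> 'a set \<Rightarrow> ('a \<Rightarrow> real) \<Rightarrow> real" where
  "norm_L2_star_elem \<Gamma> \<nu> K v = sqrt ((LINT x:K|surf \<Gamma>. (v x)\<^sup>2) + s_elem \<Gamma> \<nu> 0 K v v)"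

definition inner_product_on ::
  "('a \<Rightarrow> real) set \<Rightarrow> (('a \<Rightarrow> real) \<Rightarrow> ('a \<Rightarrow> real) \<Rightarrow> real) \<Rightarrow> bool" where
  "inner_product_on V ip \<longleftrightarrow>
     (\<forall>v\<in>V. \<forall>w\<in>V. ip v w = ip w v) \<and>
     (\<forall>u\<in>V. \<forall>v\<in>V. \<forall>w\<in>V. \<forall>a b. ip (\<lambda>x. a * u x + b * v x) w = a * ip u w + b * ip v w) \<and>
     (\<forall>v\<in>V. v \<noteq> (\<lambda>x. 0) \<longrightarrow> 0 < ip v v)"

definition P_h ::
  "'a::euclidean_space set \<Rightarrow> ('a \<Rightarrow> 'a) \<Rightarrow> 'a set set \<Rightarrow> ('a \<Rightarrow> real) set \<Rightarrow>
     (('a \<Rightarrow> real) \<Rightarrow> real) \<Rightarrow> 'a \<Rightarrow> real" where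
  "P_h \<Gamma> \<nu> M V F = (THE p. p \<in> V \<and> (\<forall>w\<in>V. ip_star \<Gamma> \<nu> M p w = F w))"

definition norm_P_h ::
  "'a::euclidean_space set \<Rightarrow> ('a \<Rightarrow> 'a) \<Rightarrow> 'a set set \<Rightarrow> ('a \<Rightarrow> real) set \<Rightarrow> ennreal" where
  "norm_P_h \<Gamma> \<nu> M V =
     (SUP v \<in> {v \<in> H1_surf \<Gamma> \<nu>. norm_H1_surf \<Gamma> \<nu> v \<noteq> 0}.
        ennreal (norm_H1_star \<Gamma> \<nu> M (P_h \<Gamma> \<nu> M V (L2_to_Hm1 \<Gamma> v)) / norm_H1_surf \<Gamma> \<nu> v))"

definition norm_Vm1 ::
  "'a::euclidean_space set \<Rightarrow> ('a \<Rightarrow> 'a) \<Rightarrow> 'a set set \<Rightarrow> ('a \<Rightarrow> real) set \<Rightarrow> ('a \<Rightarrow> real) \<Rightarrow> real" where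
  "norm_Vm1 \<Gamma> \<nu> M V v = enn2real
     (SUP w \<in> V - {\<lambda>x. 0}. ennreal (ip_star \<Gamma> \<nu> M v w / norm_H1_star \<Gamma> \<nu> M w))"

definition C_inv ::
  "'a::euclidean_space set \<Rightarrow> ('a \<Rightarrow> 'a) \<Rightarrow> 'a set set \<Rightarrow> ('a \<Rightarrow> real) set \<Rightarrow> ennreal" where
  "C_inv \<Gamma> \<nu> M V =
     (SUP v \<in> V - {\<lambda>x. 0}.
        ennreal (sqrt (\<Sum>K\<in>cut_mesh \<Gamma> M. (diameter K)\<^sup>2 * (norm_L2_star_elem \<Gamma> \<nu> K v)\<^sup>2)
                 / norm_Vm1 \<Gamma> \<nu> M V v))"

definition Laplace_h ::
  "'a::euclidean_space set \<Rightarrow> ('a \<Rightarrow> 'a) \<Rightarrow> 'a set set \<Rightarrow> ('a \<Rightarrow> real) set \<Rightarrow>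
     ('a \<Rightarrow> real) \<Rightarrow> 'a \<Rightarrow> real" where
  "Laplace_h \<Gamma> \<nu> M V v = (THE p. p \<in> V \<and> (\<forall>w\<in>V. ip_star \<Gamma> \<nu> M p w = a_star \<Gamma> \<nu> M v w))"

text \<open>
  Both \<open>V\<^sub>h\<close> and \<open>H\<^sup>-\<^sup>1(\<Gamma>)\<close> consist of real-valued functions on some type \<^typ>\<open>'b\<close>; \<open>X\<close> is the space and \<open>N\<close> its
  norm.  Strong measurability means almost everywhere limit of simple functions.
\<close>

definition time_L2 ::
  "real \<Rightarrow> ('b \<Rightarrow> real) set \<Rightarrow> (('b \<Rightarrow> real) \<Rightarrow> real) \<Rightarrow> (real \<Rightarrow> 'b \<Rightarrow> real) set" where
  "time_L2 T X N = {f.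
     (\<forall>t\<in>{0<..<T}. f t \<in> X) \<and>
     (\<exists>s :: nat \<Rightarrow> real \<Rightarrow> 'b \<Rightarrow> real.
        (\<forall>k. simple_function (lebesgue_on {0<..<T}) (s k) \<and> (\<forall>t\<in>{0<..<T}. s k t \<in> X)) \<and>
        (AE t in lebesgue_on {0<..<T}. (\<lambda>k. N (\<lambda>y. s k t y - f t y)) \<longlonglongrightarrow> 0)) \<and>
     integrable (lebesgue_on {0<..<T}) (\<lambda>t. (N (f t))\<^sup>2)}"

definition norm_time_L2 ::
  "real \<Rightarrow> (('b \<Rightarrow> real) \<Rightarrow> real) \<Rightarrow> (real \<Rightarrow> 'b \<Rightarrow> real) \<Rightarrow> real" where
  "norm_time_L2 T N f = sqrt (LINT t:{0<..<T}|lebesgue. (N (f t))\<^sup>2)"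

definition C1_compact_support :: "real \<Rightarrow> (real \<Rightarrow> real) \<Rightarrow> (real \<Rightarrow> real) \<Rightarrow> bool" where
  "C1_compact_support T \<phi> \<phi>' \<longleftrightarrow>
     (\<forall>t. (\<phi> has_real_derivative \<phi>' t) (at t)) \<and> continuous_on UNIV \<phi>' \<and>
     (\<exists>a b. 0 < a \<and> b < T \<and> (\<forall>t. t \<notin> {a..b} \<longrightarrow> \<phi> t = 0))"

text \<open>
  Weak time derivative in a finite-dimensional space \<open>V\<close> with inner product \<open>ip\<close>: the identity
  between \<open>V\<close>-valued integrals is tested with every element of \<open>V\<close>.
\<close>

definition has_weak_tderiv ::
  "real \<Rightarrow> ('a \<Rightarrow> real) set \<Rightarrow> (('a \<Rightarrow> real) \<Rightarrow> ('a \<Rightarrow> real) \<Rightarrow> real) \<Rightarrow>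
     (real \<Rightarrow> 'a \<Rightarrow> real) \<Rightarrow> (real \<Rightarrow> 'a \<Rightarrow> real) \<Rightarrow> bool" where
  "has_weak_tderiv T V ip u g \<longleftrightarrow>
     g \<in> time_L2 T V (\<lambda>v. sqrt (ip v v)) \<and>
     (\<forall>w\<in>V. \<forall>\<phi> \<phi>'. C1_compact_support T \<phi> \<phi>' \<longrightarrow>
        (LINT t:{0<..<T}|lebesgue. ip (u t) w * \<phi>' t) = - (LINT t:{0<..<T}|lebesgue. ip (g t) w * \<phi> t))"

text \<open>Elements of \<open>H\<^sup>1(I; V)\<close> are represented by their continuous versions on \<open>[0, T]\<close>, so \<open>u 0\<close> makes sense.\<close>

definition time_H1 ::
  "real \<Rightarrow> ('a \<Rightarrow> real) set \<Rightarrow> (('a \<Rightarrow> real) \<Rightarrow> ('a \<Rightarrow> real) \<Rightarrow> real) \<Rightarrow> (real \<Rightarrow> 'a \<Rightarrow> real) set" where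
  "time_H1 T V ip = {u.
     (\<forall>t\<in>{0..T}. u t \<in> V) \<and>
     (\<forall>t\<in>{0..T}. ((\<lambda>r. let d = (\<lambda>x. u r x - u t x) in sqrt (ip d d)) \<longlongrightarrow> 0) (at t within {0..T})) \<and>
     u \<in> time_L2 T V (\<lambda>v. sqrt (ip v v)) \<and>
     (\<exists>g. has_weak_tderiv T V ip u g)}"

definition tderiv ::
  "real \<Rightarrow> ('a \<Rightarrow> real) set \<Rightarrow> (('a \<Rightarrow> real) \<Rightarrow> ('a \<Rightarrow> real) \<Rightarrow> real) \<Rightarrow>
     (real \<Rightarrow> 'a \<Rightarrow> real) \<Rightarrow> real \<Rightarrow> 'a \<Rightarrow> real" where
  "tderiv T V ip u = (SOME g. has_weak_tderiv T V ip u g)"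

definition U_space ::
  "'a::euclidean_space set \<Rightarrow> ('a \<Rightarrow> 'a) \<Rightarrow> 'a set set \<Rightarrow> ('a \<Rightarrow> real) set \<Rightarrow> real \<Rightarrow>
     (real \<Rightarrow> 'a \<Rightarrow> real) set" where
  "U_space \<Gamma> \<nu> M V T = time_H1 T V (ip_star \<Gamma> \<nu> M)"

definition V_space ::
  "'a::euclidean_space set \<Rightarrow> ('a \<Rightarrow> 'a) \<Rightarrow> 'a set set \<Rightarrow> ('a \<Rightarrow> real) set \<Rightarrow> real \<Rightarrow>
     (('a \<Rightarrow> real) \<times> (real \<Rightarrow> 'a \<Rightarrow> real)) set" where
  "V_space \<Gamma> \<nu> M V T = V \<times> time_L2 T V (norm_star \<Gamma> \<nu> M)"

definition dt_h ::
  "'a::euclidean_space set \<Rightarrow> ('a \<Rightarrow> 'a) \<Rightarrow> 'a set set \<Rightarrow> ('a \<Rightarrow> real) set \<Rightarrow> real \<Rightarrow>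
     (real \<Rightarrow> 'a \<Rightarrow> real) \<Rightarrow> real \<Rightarrow> 'a \<Rightarrow> real" where
  "dt_h \<Gamma> \<nu> M V T u = tderiv T V (ip_star \<Gamma> \<nu> M) u"

definition b_h ::
  "'a::euclidean_space set \<Rightarrow> ('a \<Rightarrow> 'a) \<Rightarrow> 'a set set \<Rightarrow> ('a \<Rightarrow> real) set \<Rightarrow> real \<Rightarrow>
     (real \<Rightarrow> 'a \<Rightarrow> real) \<Rightarrow> ('a \<Rightarrow> real) \<times> (real \<Rightarrow> 'a \<Rightarrow> real) \<Rightarrow> real" where
  "b_h \<Gamma> \<nu> M V T u v = ip_star \<Gamma> \<nu> M (u 0) (fst v) +
     (LINT t:{0<..<T}|lebesgue.
        ip_star \<Gamma> \<nu> M (dt_h \<Gamma> \<nu> M V T u t) (snd v t) + a_star \<Gamma> \<nu> M (u t) (snd v t))"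

definition ell ::
  "'a::euclidean_space set \<Rightarrow> real \<Rightarrow> ('a \<Rightarrow> real) \<Rightarrow> (real \<Rightarrow> ('a \<Rightarrow> real) \<Rightarrow> real) \<Rightarrow>
     ('a \<Rightarrow> real) \<times> (real \<Rightarrow> 'a \<Rightarrow> real) \<Rightarrow> real" where
  "ell \<Gamma> T u\<^sub>0 f v = ip_surf \<Gamma> u\<^sub>0 (fst v) + (LINT t:{0<..<T}|lebesgue. f t (snd v t))"

definition c_minus ::
  "'a::euclidean_space set \<Rightarrow> ('a \<Rightarrow> 'a) \<Rightarrow> 'a set set \<Rightarrow> ('a \<Rightarrow> real) set \<Rightarrow> real \<Rightarrow> real" where
  "c_minus \<Gamma> \<nu> M V T =
     1 / (sqrt 8 * (1 + 2 * T) * (enn2real (norm_P_h \<Gamma> \<nu> M V) + enn2real (C_inv \<Gamma> \<nu> M V)))"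

text \<open>
  The absolute constant is the explicit number \<open>2\<close>: an existentially quantified constant in a theorem over
  the type \<^typ>\<open>'a::euclidean_space\<close> would be allowed to depend on \<^typ>\<open>'a\<close>, that is, on the dimension.
\<close>

definition C_MPR ::
  "'a::euclidean_space set \<Rightarrow> ('a \<Rightarrow> 'a) \<Rightarrow> 'a set set \<Rightarrow> ('a \<Rightarrow> real) set \<Rightarrow> real \<Rightarrow> real" where
  "C_MPR \<Gamma> \<nu> M V T = 2 * (1 / c_minus \<Gamma> \<nu> M V T)"

end

theory Submission
  imports Defs
begin

text \<open>
  The estimate is an energy argument, transported to \<open>H\<^sup>-\<^sup>1(\<Gamma>)\<close> by duality.

  For \<open>z \<in> V\<close> and \<open>v \<in> H\<^sup>1(\<Gamma>)\<close> the definition of \<open>P\<^sub>h\<close> gives \<open>(z, v)\<^sub>\<Gamma> = (z, P\<^sub>h v)\<^sub>*\<close>.  With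
  \<open>z = \<Delta>\<^sub>h u\<close> the right-hand side is \<open>a\<^sub>*(u, P\<^sub>h v)\<close>, so the Cauchy--Schwarz inequality for \<open>a\<^sub>*\<close> yields
  \<open>\<parallel>\<Delta>\<^sub>h u\<parallel> \<le> \<parallel>P\<^sub>h\<parallel> a\<^sub>*(u, u)\<^sup>1\<^sup>/\<^sup>2\<close> in \<open>H\<^sup>-\<^sup>1(\<Gamma>)\<close>, at every time.  With \<open>z = \<partial>\<^sub>t u\<close> it is
  \<open>\<langle>f, P\<^sub>h v\<rangle> - a\<^sub>*(u, P\<^sub>h v)\<close>, which yields \<open>\<parallel>\<partial>\<^sub>t u\<parallel> \<le> \<parallel>P\<^sub>h\<parallel> (\<parallel>f\<parallel> + a\<^sub>*(u, u)\<^sup>1\<^sup>/\<^sup>2)\<close> at almost every time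
  (\<open>norm_Hm1_le_by_duality\<close>).  It remains to bound \<open>\<integral> a\<^sub>*(u, u)\<close> by the data, which is the energy
  identity for \<open>\<parallel>u\<parallel>\<^sub>*\<^sup>2\<close> combined with \<open>\<parallel>u\<parallel> \<le> \<parallel>u\<parallel>\<^sub>* + a\<^sub>*(u, u)\<^sup>1\<^sup>/\<^sup>2\<close> in \<open>H\<^sup>1(\<Gamma>)\<close> and Young's inequality
  (\<open>energy_estimate\<close>); since \<open>a\<^sub>*\<close> is not coercive, the maximum of \<open>\<parallel>u\<parallel>\<^sub>*\<^sup>2\<close> over the time interval has to
  be absorbed, and this produces the factor \<open>1 + 2T\<close>.  The resulting constant is \<open>5 (1 + 2T) \<parallel>P\<^sub>h\<parallel>\<close>, and
  \<open>5 \<le> 2 \<surd>8\<close>.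

  Four ingredients have to be supplied.  Bilinearity of \<open>a\<^sub>*\<close> rests on uniqueness of the weak
  tangential gradient (\<open>weak_tgrad_unique\<close>), obtained by testing with cut-off tangential \<open>C\<^sup>1\<close> fields; for
  this only the Borel \<open>\<sigma>\<close>-algebra of the surface measure matters.  Bilinearity of the stabilisation
  rests on continuity of the closest point projection (\<open>psd_form_s_elem\<close>).  The chain rule for
  \<open>\<parallel>u\<parallel>\<^sub>*\<^sup>2\<close> follows from the weak time derivative by testing with \<open>C\<^sup>1\<close> approximations of indicators
  and Fubini's theorem (\<open>weak_derivative_integral\<close>, \<open>square_of_integral\<close>).  Finally the variational
  equation, tested with step functions in time, holds at almost every time for all test functions
  simultaneously (\<open>semidiscrete_equation\<close>).
\<close>

section \<open>Inner products on finite-dimensional function spaces\<close>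

text \<open>Linear subspaces of the pointwise vector space of real functions.\<close>

definition fun_subspace :: "('b \<Rightarrow> real) set \<Rightarrow> bool" where
  "fun_subspace V \<longleftrightarrow>
     (\<lambda>x. 0) \<in> V \<and> (\<forall>v\<in>V. \<forall>w\<in>V. \<forall>a b. (\<lambda>x. a * v x + b * w x) \<in> V)"

text \<open>Symmetric positive semidefinite bilinear forms; linearity in the second argument follows by symmetry.\<close>

definition psd_form_on :: "('b \<Rightarrow> real) set \<Rightarrow> (('b \<Rightarrow> real) \<Rightarrow> ('b \<Rightarrow> real) \<Rightarrow> real) \<Rightarrow> bool" where
  "psd_form_on V a \<longleftrightarrow>
     (\<forall>v\<in>V. \<forall>w\<in>V. a v w = a w v) \<and>
     (\<forall>u\<in>V. \<forall>v\<in>V. \<forall>w\<in>V. \<forall>c d. a (\<lambda>x. c * u x + d * v x) w = c * a u w + d * a v w) \<and>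
     (\<forall>v\<in>V. 0 \<le> a v v)"

text \<open>A finite orthonormal basis, expressed through the expansion of every element.\<close>

definition onb_on ::
  "('b \<Rightarrow> real) set \<Rightarrow> (('b \<Rightarrow> real) \<Rightarrow> ('b \<Rightarrow> real) \<Rightarrow> real) \<Rightarrow> ('b \<Rightarrow> real) set \<Rightarrow> bool" where
  "onb_on V ip E \<longleftrightarrow> finite E \<and> E \<subseteq> V \<and>
     (\<forall>e\<in>E. \<forall>e'\<in>E. ip e e' = (if e = e' then 1 else 0)) \<and>
     (\<forall>v\<in>V. v = (\<lambda>x. \<Sum>e\<in>E. ip v e * e x))"

lemma fun_subspace_zero: "fun_subspace V \<Longrightarrow> (\<lambda>x. 0) \<in> V"
  by (simp add: fun_subspace_def)

lemma fun_subspace_lin: "fun_subspace V \<Longrightarrow> v \<in> V \<Longrightarrow> w \<in> V \<Longrightarrow> (\<lambda>x. a * v x + b * w x) \<in> V"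
  by (simp add: fun_subspace_def)

lemma fun_subspace_diff: "fun_subspace V \<Longrightarrow> v \<in> V \<Longrightarrow> w \<in> V \<Longrightarrow> (\<lambda>x. v x - w x) \<in> V"
  using fun_subspace_lin[of V v w 1 "-1"] by simp

lemma fun_subspace_scale: "fun_subspace V \<Longrightarrow> v \<in> V \<Longrightarrow> (\<lambda>x. a * v x) \<in> V"
  using fun_subspace_lin[of V v v a 0] by simp

lemma fun_subspace_sum:
  assumes "fun_subspace V" "finite E" "E \<subseteq> V"
  shows "(\<lambda>x. \<Sum>e\<in>E. c e * e x) \<in> V"
  using assms(2,3)
proof (induction E rule: finite_induct)
  case empty
  then show ?case using fun_subspace_zero[OF assms(1)] by simp
next
  case (insert e E)
  then have "(\<lambda>x. c e * e x + 1 * (\<Sum>e\<in>E. c e * e x)) \<in> V"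
    by (intro fun_subspace_lin[OF assms(1)]) auto
  then show ?case using insert by simp
qed

lemma psd_form_sym: "psd_form_on V a \<Longrightarrow> v \<in> V \<Longrightarrow> w \<in> V \<Longrightarrow> a v w = a w v"
  by (simp add: psd_form_on_def)

lemma psd_form_nonneg: "psd_form_on V a \<Longrightarrow> v \<in> V \<Longrightarrow> 0 \<le> a v v"
  by (simp add: psd_form_on_def)

lemma psd_form_lin:
  "psd_form_on V a \<Longrightarrow> u \<in> V \<Longrightarrow> v \<in> V \<Longrightarrow> w \<in> V \<Longrightarrow>
     a (\<lambda>x. c * u x + d * v x) w = c * a u w + d * a v w"
  unfolding psd_form_on_def by blast

lemma psd_form_lin_right:
  assumes "fun_subspace V" "psd_form_on V a" "u \<in> V" "v \<in> V" "w \<in> V"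
  shows "a w (\<lambda>x. c * u x + d * v x) = c * a w u + d * a w v"
  using psd_form_lin[OF assms(2,3,4,5), of c d] psd_form_sym[OF assms(2) assms(5) fun_subspace_lin[OF assms(1,3,4)], of c d]
    psd_form_sym[OF assms(2) assms(5,3)] psd_form_sym[OF assms(2) assms(5,4)] by simp

lemma psd_form_diff:
  "psd_form_on V a \<Longrightarrow> u \<in> V \<Longrightarrow> v \<in> V \<Longrightarrow> w \<in> V \<Longrightarrow> a (\<lambda>x. u x - v x) w = a u w - a v w"
  using psd_form_lin[of V a u v w 1 "-1"] by simp

lemma psd_form_zero: "fun_subspace V \<Longrightarrow> psd_form_on V a \<Longrightarrow> w \<in> V \<Longrightarrow> a (\<lambda>x. 0) w = 0"
  using psd_form_lin[of V a w w w 0 0] by simp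

lemma psd_form_sum:
  assumes "fun_subspace V" "psd_form_on V a" "finite E" "E \<subseteq> V" "w \<in> V"
  shows "a (\<lambda>x. \<Sum>e\<in>E. c e * e x) w = (\<Sum>e\<in>E. c e * a e w)"
  using assms(3,4)
proof (induction E rule: finite_induct)
  case empty
  then show ?case using psd_form_zero[OF assms(1,2,5)] by simp
next
  case (insert e E)
  then have "a (\<lambda>x. c e * e x + 1 * (\<Sum>e\<in>E. c e * e x)) w
      = c e * a e w + 1 * a (\<lambda>x. \<Sum>e\<in>E. c e * e x) w"
    by (intro psd_form_lin[OF assms(2)] fun_subspace_sum[OF assms(1)] assms(5)) auto
  then show ?case using insert by simp
qed

lemma psd_form_add: "psd_form_on V a \<Longrightarrow> psd_form_on V b \<Longrightarrow> psd_form_on V (\<lambda>v w. a v w + b v w)"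
  unfolding psd_form_on_def by (auto simp: algebra_simps)

lemma psd_form_cmult: "0 \<le> c \<Longrightarrow> psd_form_on V a \<Longrightarrow> psd_form_on V (\<lambda>v w. c * a v w)"
  unfolding psd_form_on_def by (auto simp: algebra_simps)

lemma psd_form_finite_sum:
  assumes "finite I" "\<And>i. i \<in> I \<Longrightarrow> psd_form_on V (a i)"
  shows "psd_form_on V (\<lambda>v w. \<Sum>i\<in>I. a i v w)"
  using assms
proof (induction I rule: finite_induct)
  case empty
  then show ?case by (simp add: psd_form_on_def)
next
  case (insert i I)
  then show ?case using psd_form_add[of V "a i" "\<lambda>v w. \<Sum>i\<in>I. a i v w"] by simp
qed

lemma psd_form_square_add:
  assumes "fun_subspace V" "psd_form_on V a" "v \<in> V" "w \<in> V"
  shows "a (\<lambda>x. c * v x + d * w x) (\<lambda>x. c * v x + d * w x)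
    = c\<^sup>2 * a v v + 2 * c * d * a v w + d\<^sup>2 * a w w"
  using psd_form_lin[OF assms(2,3,4) fun_subspace_lin[OF assms(1,3,4), of c d], of c d]
    psd_form_lin_right[OF assms(1,2,3,4) assms(3), of c d]
    psd_form_lin_right[OF assms(1,2,3,4) assms(4), of c d] psd_form_sym[OF assms(2,3,4)]
  by (simp add: power2_eq_square algebra_simps)

lemma psd_form_Cauchy_Schwarz:
  assumes "fun_subspace V" "psd_form_on V a" "v \<in> V" "w \<in> V"
  shows "\<bar>a v w\<bar> \<le> sqrt (a v v) * sqrt (a w w)"
proof -
  have q: "0 \<le> c\<^sup>2 * a v v + 2 * c * d * a v w + d\<^sup>2 * a w w" for c d
    using psd_form_square_add[OF assms, of c d]
      psd_form_nonneg[OF assms(2) fun_subspace_lin[OF assms(1,3,4)], of c d] by simp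
  have nn: "0 \<le> a v v" "0 \<le> a w w" using psd_form_nonneg[OF assms(2)] assms by auto
  have "(a v w)\<^sup>2 \<le> a v v * a w w"
  proof (cases "a v v = 0")
    case True
    then have "0 \<le> 2 * c * a v w + a w w" for c using q[of c 1] by simp
    note lin = this
    have "a v w = 0"
    proof (rule ccontr)
      assume "a v w \<noteq> 0"
      then show False using lin[of "- (a w w + 1) / (2 * a v w)"] by (simp add: field_simps)
    qed
    then show ?thesis using True by simp
  next
    case False
    then have p: "0 < a v v" using nn by simp
    have "0 \<le> (- a v w)\<^sup>2 * a v v + 2 * (- a v w) * a v v * a v w + (a v v)\<^sup>2 * a w w" by (rule q)
    then have "0 \<le> a v v * (a v v * a w w - (a v w)\<^sup>2)" by (simp add: power2_eq_square algebra_simps)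
    then show ?thesis using p by (simp add: zero_le_mult_iff)
  qed
  then have "sqrt ((a v w)\<^sup>2) \<le> sqrt (a v v * a w w)" by (rule real_sqrt_le_mono)
  then show ?thesis by (simp add: real_sqrt_mult)
qed

lemma inner_product_on_psd:
  assumes "fun_subspace V" "inner_product_on V ip"
  shows "psd_form_on V ip"
proof -
  have lin: "ip (\<lambda>x. a * u x + b * v x) w = a * ip u w + b * ip v w"
    if "u \<in> V" "v \<in> V" "w \<in> V" for u v w a b
    using assms(2) that unfolding inner_product_on_def by blast
  have "ip (\<lambda>x. 0) (\<lambda>x. 0) = 0"
    using lin[of "\<lambda>x. 0" "\<lambda>x. 0" "\<lambda>x. 0" 0 0] fun_subspace_zero[OF assms(1)] by simp
  then have nn: "0 \<le> ip v v" if "v \<in> V" for v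
  proof (cases "v = (\<lambda>x. 0)")
    case False
    then show ?thesis using assms(2) that unfolding inner_product_on_def by (meson less_imp_le)
  qed simp
  have sym: "ip v w = ip w v" if "v \<in> V" "w \<in> V" for v w
    using assms(2) that unfolding inner_product_on_def by blast
  show ?thesis unfolding psd_form_on_def by (intro conjI ballI allI nn sym lin)
qed

lemma inner_product_on_zeroD:
  assumes "inner_product_on V ip" "v \<in> V" "ip v v = 0"
  shows "v = (\<lambda>x. 0)"
  using assms unfolding inner_product_on_def by (metis less_irrefl)

text \<open>Gram--Schmidt orthonormalisation.\<close>

lemma gram_schmidt:
  assumes V: "fun_subspace V" and ip: "inner_product_on V ip" and B: "finite B" "B \<subseteq> V"
  shows "\<exists>E. finite E \<and> E \<subseteq> V \<and> (\<forall>e\<in>E. \<forall>e'\<in>E. ip e e' = (if e = e' then 1 else 0)) \<and>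
    (\<forall>b\<in>B. b = (\<lambda>x. \<Sum>e\<in>E. ip b e * e x))"
  using B
proof (induction B rule: finite_induct)
  case empty
  then show ?case by (intro exI[of _ "{}"]) auto
next
  case (insert b B)
  note psd = inner_product_on_psd[OF V ip]
  from insert obtain E where E: "finite E" "E \<subseteq> V"
    and on: "\<forall>e\<in>E. \<forall>e'\<in>E. ip e e' = (if e = e' then 1 else 0)"
    and ex: "\<forall>b\<in>B. b = (\<lambda>x. \<Sum>e\<in>E. ip b e * e x)" by auto
  have b: "b \<in> V" using insert by simp
  define p where "p = (\<lambda>x. \<Sum>e\<in>E. ip b e * e x)"
  have p: "p \<in> V" unfolding p_def by (rule fun_subspace_sum[OF V E])
  define r where "r = (\<lambda>x. b x - p x)"
  have r: "r \<in> V" unfolding r_def by (rule fun_subspace_diff[OF V b p])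
  have pe: "ip p e = ip b e" if "e \<in> E" for e
  proof -
    have "ip p e = (\<Sum>e'\<in>E. ip b e' * ip e' e)"
      unfolding p_def using psd_form_sum[OF V psd E] that E by auto
    also have "\<dots> = (\<Sum>e'\<in>E. if e' = e then ip b e' else 0)"
      by (rule sum.cong) (use on that in auto)
    finally show ?thesis using that E by simp
  qed
  have re: "ip r e = 0" if "e \<in> E" for e
    unfolding r_def using psd_form_diff[OF psd b p, of e] pe that E by auto
  show ?case
  proof (cases "r = (\<lambda>x. 0)")
    case True
    then have "b = p" by (auto simp: r_def fun_eq_iff)
    then show ?thesis using E on ex p_def by (intro exI[of _ E]) auto
  next
    case False
    then have pos: "0 < ip r r" using ip r unfolding inner_product_on_def by blast
    \<comment> \<open>\<open>q\<close> is the new basis vector, the normalised component of \<open>b\<close> orthogonal to \<open>E\<close>.\<close>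
    define c where "c = 1 / sqrt (ip r r)"
    define q where "q = (\<lambda>x. c * r x)"
    have q: "q \<in> V" unfolding q_def by (rule fun_subspace_scale[OF V r])
    have qw: "ip q w = c * ip r w" if "w \<in> V" for w
      using psd_form_lin[OF psd r r that, of c 0] by (simp add: q_def)
    have qe: "ip q e = 0" if "e \<in> E" for e using qw[of e] re that E by auto
    have "ip r q = c * ip r r" using qw[OF r] psd_form_sym[OF psd q r] by simp
    moreover have "c * (c * ip r r) = 1" using pos by (simp add: c_def field_simps)
    ultimately have qq: "ip q q = 1" using qw[OF q] by simp
    then have qE: "q \<notin> E" using qe by auto
    have eq: "ip e q = 0" if "e \<in> E" for e
      using qe[OF that] psd_form_sym[OF psd q, of e] that E by auto
    have bq: "ip b q = ip r q"
    proof -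
      have "ip p q = (\<Sum>e\<in>E. ip b e * ip e q)"
        unfolding p_def by (rule psd_form_sum[OF V psd E q])
      also have "\<dots> = 0" by (rule sum.neutral) (simp add: eq)
      finally show ?thesis unfolding r_def using psd_form_diff[OF psd b p q] by simp
    qed
    have b_eq: "b = (\<lambda>x. \<Sum>e\<in>insert q E. ip b e * e x)"
    proof
      fix x
      have "ip b q * q x = r x"
        using \<open>ip r q = c * ip r r\<close> \<open>c * (c * ip r r) = 1\<close> by (simp add: bq fun_cong[OF q_def] mult_ac)
      then show "b x = (\<Sum>e\<in>insert q E. ip b e * e x)"
        using E qE by (simp add: r_def p_def)
    qed
    have B_eq: "b' = (\<lambda>x. \<Sum>e\<in>insert q E. ip b' e * e x)" if "b' \<in> B" for b'
    proof -
      have b': "b' = (\<lambda>x. \<Sum>e\<in>E. ip b' e * e x)" using ex that by blast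
      have "ip b' q = (\<Sum>e\<in>E. ip b' e * ip e q)"
        using arg_cong[OF b', of "\<lambda>z. ip z q"] psd_form_sum[OF V psd E q, of "ip b'"] by (rule trans)
      also have "\<dots> = 0" by (rule sum.neutral) (simp add: eq)
      finally have "(\<Sum>e\<in>insert q E. ip b' e * e x) = (\<Sum>e\<in>E. ip b' e * e x)" for x
        using E qE by simp
      then show ?thesis using b' by presburger
    qed
    show ?thesis
    proof (intro exI[of _ "insert q E"] conjI ballI)
      fix b' assume "b' \<in> insert b B"
      then show "b' = (\<lambda>x. \<Sum>e\<in>insert q E. ip b' e * e x)" using b_eq B_eq by blast
    qed (use E on q qe qq qE eq in auto)
  qed
qed

lemma onb_on_exists:
  assumes V: "fun_subspace V" and ip: "inner_product_on V ip"
    and B: "finite B" "B \<subseteq> V" and span: "\<forall>v\<in>V. \<exists>c. v = (\<lambda>x. \<Sum>b\<in>B. c b * b x)"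
  shows "\<exists>E. onb_on V ip E"
proof -
  note psd = inner_product_on_psd[OF V ip]
  obtain E where E: "finite E" "E \<subseteq> V"
    and on: "\<forall>e\<in>E. \<forall>e'\<in>E. ip e e' = (if e = e' then 1 else 0)"
    and ex: "\<forall>b\<in>B. b = (\<lambda>x. \<Sum>e\<in>E. ip b e * e x)"
    using gram_schmidt[OF V ip B] by auto
  have "v = (\<lambda>x. \<Sum>e\<in>E. ip v e * e x)" if "v \<in> V" for v
  proof -
    obtain c where c: "v = (\<lambda>x. \<Sum>b\<in>B. c b * b x)" using bspec[OF span \<open>v \<in> V\<close>] ..
    have ve: "ip v e = (\<Sum>b\<in>B. c b * ip b e)" if "e \<in> E" for e
      unfolding c by (rule psd_form_sum[OF V psd B]) (use that E in auto)
    show ?thesis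
    proof
      fix x
      have "v x = (\<Sum>b\<in>B. c b * b x)" by (simp add: c)
      also have "\<dots> = (\<Sum>b\<in>B. c b * (\<Sum>e\<in>E. ip b e * e x))"
        by (intro sum.cong refl arg_cong2[where f = "(*)"] fun_cong[OF bspec[OF ex]])
      also have "\<dots> = (\<Sum>b\<in>B. \<Sum>e\<in>E. c b * ip b e * e x)"
        by (simp add: sum_distrib_left mult.assoc)
      also have "\<dots> = (\<Sum>e\<in>E. \<Sum>b\<in>B. c b * ip b e * e x)" by (rule sum.swap)
      also have "\<dots> = (\<Sum>e\<in>E. ip v e * e x)"
        by (rule sum.cong) (auto simp: ve sum_distrib_right)
      finally show "v x = (\<Sum>e\<in>E. ip v e * e x)" .
    qed
  qed
  then show ?thesis using E on unfolding onb_on_def by (intro exI[of _ E] conjI ballI) blast+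
qed

lemma onb_on_expand: "onb_on V ip E \<Longrightarrow> v \<in> V \<Longrightarrow> v = (\<lambda>x. \<Sum>e\<in>E. ip v e * e x)"
  unfolding onb_on_def by blast

lemma onb_on_form_expand:
  assumes V: "fun_subspace V" and a: "psd_form_on V a" and E: "onb_on V ip E"
    and v: "v \<in> V" and w: "w \<in> V"
  shows "a v w = (\<Sum>e\<in>E. ip v e * a e w)"
proof -
  have "v = (\<lambda>x. \<Sum>e\<in>E. ip v e * e x)" using E v by (simp add: onb_on_def)
  then have "a v w = a (\<lambda>x. \<Sum>e\<in>E. ip v e * e x) w" by simp
  also have "\<dots> = (\<Sum>e\<in>E. ip v e * a e w)"
    by (rule psd_form_sum[OF V a _ _ w]) (use E in \<open>auto simp: onb_on_def\<close>)
  finally show ?thesis .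
qed

lemma onb_on_form_expand2:
  assumes V: "fun_subspace V" and a: "psd_form_on V a" and E: "onb_on V ip E"
    and v: "v \<in> V" and w: "w \<in> V"
  shows "a v w = (\<Sum>e\<in>E. \<Sum>e'\<in>E. ip v e * ip w e' * a e e')"
proof -
  have sub: "e \<in> V" if "e \<in> E" for e using E that by (auto simp: onb_on_def)
  have "a v w = (\<Sum>e\<in>E. ip v e * a e w)" by (rule onb_on_form_expand[OF V a E v w])
  also have "\<dots> = (\<Sum>e\<in>E. \<Sum>e'\<in>E. ip v e * ip w e' * a e e')"
  proof (rule sum.cong[OF refl])
    fix e assume e: "e \<in> E"
    have "a e w = a w e" by (rule psd_form_sym[OF a sub[OF e] w])
    also have "\<dots> = (\<Sum>e'\<in>E. ip w e' * a e' e)" by (rule onb_on_form_expand[OF V a E w sub[OF e]])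
    also have "\<dots> = (\<Sum>e'\<in>E. ip w e' * a e e')"
      by (intro sum.cong refl arg_cong2[where f = "(*)"] psd_form_sym[OF a] sub e)
    finally show "ip v e * a e w = (\<Sum>e'\<in>E. ip v e * ip w e' * a e e')"
      by (simp add: sum_distrib_left mult.assoc)
  qed
  finally show ?thesis .
qed

lemma onb_on_parseval:
  assumes V: "fun_subspace V" and ip: "psd_form_on V ip" and E: "onb_on V ip E"
    and v: "v \<in> V" and w: "w \<in> V"
  shows "ip v w = (\<Sum>e\<in>E. ip v e * ip w e)"
proof -
  have "ip v w = (\<Sum>e\<in>E. ip v e * ip e w)" by (rule onb_on_form_expand[OF V ip E v w])
  also have "\<dots> = (\<Sum>e\<in>E. ip v e * ip w e)"
    by (intro sum.cong refl arg_cong2[where f = "(*)"] psd_form_sym[OF ip] w)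
      (use E in \<open>auto simp: onb_on_def\<close>)
  finally show ?thesis .
qed

lemma onb_on_coeff_le:
  assumes V: "fun_subspace V" and ip: "psd_form_on V ip" and E: "onb_on V ip E"
    and v: "v \<in> V" and e: "e \<in> E"
  shows "\<bar>ip v e\<bar> \<le> sqrt (ip v v)"
proof -
  have "e \<in> V" "ip e e = 1" using E e by (auto simp: onb_on_def)
  then show ?thesis using psd_form_Cauchy_Schwarz[OF V ip v, of e] by simp
qed

text \<open>On a finite-dimensional space every form is bounded by the inner product.\<close>

lemma onb_on_form_bounded:
  assumes V: "fun_subspace V" and ip: "psd_form_on V ip" and E: "onb_on V ip E"
    and a: "psd_form_on V a"
  shows "\<exists>K\<ge>0. \<forall>v\<in>V. a v v \<le> K * ip v v"
proof (intro exI conjI ballI)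
  show "0 \<le> (\<Sum>e\<in>E. \<Sum>e'\<in>E. \<bar>a e e'\<bar>)" by (intro sum_nonneg) auto
  fix v assume v: "v \<in> V"
  have nn: "0 \<le> ip v v" using psd_form_nonneg[OF ip v] .
  have "a v v = (\<Sum>e\<in>E. \<Sum>e'\<in>E. ip v e * ip v e' * a e e')"
    by (rule onb_on_form_expand2[OF V a E v v])
  also have "\<dots> \<le> (\<Sum>e\<in>E. \<Sum>e'\<in>E. ip v v * \<bar>a e e'\<bar>)"
  proof (intro sum_mono)
    fix e e' assume "e \<in> E" "e' \<in> E"
    then have "\<bar>ip v e\<bar> * \<bar>ip v e'\<bar> \<le> sqrt (ip v v) * sqrt (ip v v)"
      by (intro mult_mono onb_on_coeff_le[OF V ip E v]) (use nn in auto)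
    then have "\<bar>ip v e * ip v e'\<bar> \<le> ip v v" using nn by (simp add: abs_mult)
    then have "\<bar>ip v e * ip v e' * a e e'\<bar> \<le> ip v v * \<bar>a e e'\<bar>"
      by (simp add: abs_mult mult_right_mono)
    then show "ip v e * ip v e' * a e e' \<le> ip v v * \<bar>a e e'\<bar>" by linarith
  qed
  finally show "a v v \<le> (\<Sum>e\<in>E. \<Sum>e'\<in>E. \<bar>a e e'\<bar>) * ip v v"
    by (simp add: sum_distrib_left sum_distrib_right mult.commute)
qed

lemma functional_sum:
  assumes V: "fun_subspace V"
    and lin: "\<And>v w a b. v \<in> V \<Longrightarrow> w \<in> V \<Longrightarrow> F (\<lambda>x. a * v x + b * w x) = a * F v + b * (F w :: real)"
    and E: "finite E" "E \<subseteq> V"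
  shows "F (\<lambda>x. \<Sum>e\<in>E. c e * e x) = (\<Sum>e\<in>E. c e * F e)"
  using E
proof (induction E rule: finite_induct)
  case empty
  show ?case using lin[of "\<lambda>x. 0" "\<lambda>x. 0" 0 0] fun_subspace_zero[OF V] by simp
next
  case (insert e E)
  then have "F (\<lambda>x. c e * e x + 1 * (\<Sum>e\<in>E. c e * e x))
    = c e * F e + 1 * F (\<lambda>x. \<Sum>e\<in>E. c e * e x)"
    by (intro lin fun_subspace_sum[OF V]) auto
  then show ?case using insert by simp
qed

text \<open>The Riesz representation of a linear functional, in the description used by the
  projection and the discrete Laplacian.\<close>

lemma riesz_the:
  assumes V: "fun_subspace V" and ip: "inner_product_on V ip" and E: "onb_on V ip E"
    and lin: "\<And>v w a b. v \<in> V \<Longrightarrow> w \<in> V \<Longrightarrow> F (\<lambda>x. a * v x + b * w x) = a * F v + b * F w"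
  shows "(THE p. p \<in> V \<and> (\<forall>w\<in>V. ip p w = F w)) \<in> V"
    "\<And>w. w \<in> V \<Longrightarrow> ip (THE p. p \<in> V \<and> (\<forall>w\<in>V. ip p w = F w)) w = F w"
proof -
  note psd = inner_product_on_psd[OF V ip]
  have fin: "finite E" and sub: "E \<subseteq> V" using E by (auto simp: onb_on_def)
  define p where "p = (\<lambda>x. \<Sum>e\<in>E. F e * e x)"
  have p: "p \<in> V" unfolding p_def by (rule fun_subspace_sum[OF V fin sub])
  have pw: "ip p w = F w" if w: "w \<in> V" for w
  proof -
    have "ip p w = (\<Sum>e\<in>E. F e * ip e w)"
      unfolding p_def by (rule psd_form_sum[OF V psd fin sub w])
    also have "\<dots> = (\<Sum>e\<in>E. ip w e * F e)"
      by (rule sum.cong) (use psd_form_sym[OF psd] w sub in auto)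
    also have "\<dots> = F (\<lambda>x. \<Sum>e\<in>E. ip w e * e x)"
      by (rule functional_sum[where F = F and V = V and c = "ip w" and E = E, symmetric]) (fact V lin fin sub)+
    also have "(\<lambda>x. \<Sum>e\<in>E. ip w e * e x) = w" using E w by (simp add: onb_on_def)
    finally show ?thesis .
  qed
  have "\<exists>!p. p \<in> V \<and> (\<forall>w\<in>V. ip p w = F w)"
  proof (intro ex1I[of _ p] conjI ballI p pw)
    fix q assume q: "q \<in> V \<and> (\<forall>w\<in>V. ip q w = F w)"
    define d where "d = (\<lambda>x. q x - p x)"
    have d: "d \<in> V" unfolding d_def using fun_subspace_diff[OF V _ p] q by blast
    have "ip d d = ip q d - ip p d"
      using psd_form_diff[OF psd _ p d, of q] q unfolding d_def by blast
    then have "ip d d = 0" using q d pw[OF d] by simp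
    then have "d = (\<lambda>x. 0)" using inner_product_on_zeroD[OF ip d] by simp
    then show "q = p" by (auto simp: d_def fun_eq_iff)
  qed
  from theI'[OF this]
  show "(THE p. p \<in> V \<and> (\<forall>w\<in>V. ip p w = F w)) \<in> V"
    "\<And>w. w \<in> V \<Longrightarrow> ip (THE p. p \<in> V \<and> (\<forall>w\<in>V. ip p w = F w)) w = F w" by auto
qed

section \<open>Weak derivatives in one real variable\<close>

text \<open>A \<open>C\<^sup>1\<close> step from \<open>0\<close> to \<open>1\<close> on \<open>[0, 1]\<close>, and its derivative, a tent of integral \<open>1\<close>.\<close>

definition step_fun :: "real \<Rightarrow> real" where
  "step_fun x = 2 * ((max 0 x)\<^sup>2 - 2 * (max 0 (x - 1/2))\<^sup>2 + (max 0 (x - 1))\<^sup>2)"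

definition tent_fun :: "real \<Rightarrow> real" where
  "tent_fun x = 4 * (max 0 x - 2 * max 0 (x - 1/2) + max 0 (x - 1))"

lemma has_real_derivative_max0_sq:
  "((\<lambda>x. (max 0 x)\<^sup>2) has_real_derivative 2 * max 0 x) (at (x::real))"
proof (cases x "0::real" rule: linorder_cases)
  case less
  have "((\<lambda>x. 0) has_real_derivative 0) (at x)" by simp
  then have "((\<lambda>x. (max 0 x)\<^sup>2) has_real_derivative 0) (at x)"
    by (rule has_field_derivative_transform_within_open[of _ _ _ "{..<0}"]) (use less in auto)
  then show ?thesis using less by simp
next
  case greater
  have "((\<lambda>x. x\<^sup>2) has_real_derivative 2 * x) (at x)"
    by (auto intro!: derivative_eq_intros)
  then have "((\<lambda>x. (max 0 x)\<^sup>2) has_real_derivative 2 * x) (at x)"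
    by (rule has_field_derivative_transform_within_open[of _ _ _ "{0<..}"]) (use greater in auto)
  then show ?thesis using greater by simp
next
  case equal
  have "((\<lambda>h. ((max 0 (0 + h))\<^sup>2 - (max 0 0)\<^sup>2) / h) \<longlongrightarrow> 0) (at (0::real))"
  proof (rule Lim_null_comparison[where g = abs])
    show "\<forall>\<^sub>F h in at (0::real). norm (((max 0 (0 + h))\<^sup>2 - (max 0 0)\<^sup>2) / h) \<le> \<bar>h\<bar>"
      by (rule always_eventually) (auto simp: max_def power2_eq_square)
    show "(abs \<longlongrightarrow> (0::real)) (at 0)" using tendsto_rabs[OF tendsto_ident_at, of "0::real" UNIV] by simp
  qed
  then show ?thesis using equal by (simp add: DERIV_def)
qed

lemma step_fun_deriv: "(step_fun has_real_derivative tent_fun x) (at x)"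
proof -
  have g: "((\<lambda>x. x - c) has_real_derivative 1) (at x)" for c
    by (auto intro!: derivative_eq_intros)
  have sh: "((\<lambda>x. (max 0 (x - c))\<^sup>2) has_real_derivative 2 * max 0 (x - c)) (at x)" for c
    using DERIV_chain2[where f = "\<lambda>x. (max 0 x)\<^sup>2" and g = "\<lambda>x. x - c", OF has_real_derivative_max0_sq, of 1 x UNIV]
      g[of c]
    by simp
  have "((\<lambda>x. 2 * ((max 0 x)\<^sup>2 - 2 * (max 0 (x - 1/2))\<^sup>2 + (max 0 (x - 1))\<^sup>2)) has_real_derivative
    2 * (2 * max 0 x - 2 * (2 * max 0 (x - 1/2)) + 2 * max 0 (x - 1))) (at x)"
    by (intro DERIV_cmult DERIV_add DERIV_diff sh has_real_derivative_max0_sq)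
  then show ?thesis unfolding step_fun_def[abs_def] tent_fun_def by (simp add: algebra_simps)
qed

lemma step_fun_0: "x \<le> 0 \<Longrightarrow> step_fun x = 0" by (simp add: step_fun_def)

lemma step_fun_1: "1 \<le> x \<Longrightarrow> step_fun x = 1"
  by (simp add: step_fun_def max_def power2_eq_square algebra_simps)

lemma tent_fun_0: "x \<notin> {0..1} \<Longrightarrow> tent_fun x = 0"
  by (auto simp: tent_fun_def max_def algebra_simps)

lemma tent_fun_nonneg: "0 \<le> tent_fun x" by (auto simp: tent_fun_def max_def)

lemma continuous_tent_fun: "continuous_on S tent_fun"
  unfolding tent_fun_def[abs_def] by (intro continuous_intros)

lemma continuous_step_fun: "continuous_on S step_fun"
  unfolding step_fun_def[abs_def] by (intro continuous_intros)

lemma step_fun_range: "\<bar>step_fun x\<bar> \<le> 1"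
proof -
  have mono: "step_fun x \<le> step_fun y" if "x \<le> y" for x y
    by (rule DERIV_nonneg_imp_nondecreasing[OF that]) (use step_fun_deriv tent_fun_nonneg in blast)
  have "step_fun (min 0 x) \<le> step_fun x" "step_fun x \<le> step_fun (max 1 x)" by (auto intro: mono)
  then show ?thesis using step_fun_0[of "min 0 x"] step_fun_1[of "max 1 x"] by simp
qed

lemma set_integrable_continuous_open_interval:
  fixes f :: "real \<Rightarrow> real"
  assumes "continuous_on {0..T} f"
  shows "set_integrable lebesgue {0<..<T} f"
    "(LINT x:{0<..<T}|lebesgue. f x) = integral {0..T} f"
proof -
  have "set_integrable lebesgue {0..T} f" using absolutely_integrable_continuous_real[OF assms] .
  then show i: "set_integrable lebesgue {0<..<T} f" by (rule set_integrable_subset) auto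
  have "(LINT x:{0<..<T}|lebesgue. f x) = integral {0<..<T} f"
    by (rule set_lebesgue_integral_eq_integral(2)[OF i])
  then show "(LINT x:{0<..<T}|lebesgue. f x) = integral {0..T} f"
    using integral_open_interval_real by metis
qed

text \<open>Averages of a continuous function against a rescaled tent.\<close>

lemma tent_average:
  assumes e: "0 < e" "0 \<le> a" "a + e \<le> T" and c: "continuous_on {0..T} c"
    and m: "\<And>x. x \<in> {a..a+e} \<Longrightarrow> \<bar>c x - m\<bar> \<le> \<delta>"
  shows "\<bar>(LINT x:{0<..<T}|lebesgue. c x * (tent_fun ((x - a) / e) / e)) - m\<bar> \<le> \<delta>"
proof -
  let ?k = "\<lambda>x. tent_fun ((x - a) / e) / e"
  have kc: "continuous_on {0..T} ?k"
    by (intro continuous_intros continuous_on_compose2[OF continuous_tent_fun[of UNIV]]) (use e in auto)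
  have g: "((\<lambda>x. (x - a) / e) has_real_derivative 1 / e) (at x)" for x
    by (rule DERIV_cdivide) (auto intro!: derivative_eq_intros)
  have d: "((\<lambda>x. step_fun ((x - a) / e)) has_real_derivative ?k x) (at x)" for x
    using DERIV_chain2[where f = step_fun and g = "\<lambda>x. (x - a) / e", OF step_fun_deriv, of "1 / e" x UNIV] g[of x]
    by simp
  have "(?k has_integral step_fun ((T - a) / e) - step_fun ((0 - a) / e)) {0..T}"
    by (rule fundamental_theorem_of_calculus)
      (use e d in \<open>auto simp: has_real_derivative_iff_has_vector_derivative[symmetric] intro: has_field_derivative_at_within\<close>)
  moreover have "step_fun ((T - a) / e) = 1" using e by (intro step_fun_1) (auto simp: field_simps)
  moreover have "step_fun ((0 - a) / e) = 0" using e by (intro step_fun_0) (auto simp: field_simps)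
  ultimately have k1: "(?k has_integral 1) {0..T}" by simp
  have ck: "continuous_on {0..T} (\<lambda>x. c x * ?k x)" using c kc by (rule continuous_on_mult)
  have "\<bar>integral {0..T} (\<lambda>x. c x * ?k x) - m\<bar> = norm (integral {0..T} (\<lambda>x. c x * ?k x - m * ?k x))"
    using integral_diff[OF integrable_continuous_real[OF ck] integrable_on_mult_right[OF has_integral_integrable[OF k1], of m]]
      integral_unique[OF k1] by simp
  also have "\<dots> \<le> integral {0..T} (\<lambda>x. \<delta> * ?k x)"
  proof (rule integral_norm_bound_integral)
    show "(\<lambda>x. c x * ?k x - m * ?k x) integrable_on {0..T}"
      by (intro integrable_continuous_real continuous_on_diff[OF ck] continuous_on_mult[OF continuous_on_const kc])
    show "(\<lambda>x. \<delta> * ?k x) integrable_on {0..T}" by (intro integrable_continuous_real continuous_on_mult[OF continuous_on_const kc])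
    fix x assume "x \<in> {0..T}"
    show "norm (c x * ?k x - m * ?k x) \<le> \<delta> * ?k x"
    proof (cases "x \<in> {a..a+e}")
      case True
      have "norm (c x * ?k x - m * ?k x) = \<bar>c x - m\<bar> * ?k x"
        using e tent_fun_nonneg[of "(x - a) / e"] by (simp add: abs_mult left_diff_distrib[symmetric] del: times_divide_eq_right)
      also have "\<dots> \<le> \<delta> * ?k x"
        by (rule mult_right_mono[OF m[OF True]]) (use e tent_fun_nonneg in auto)
      finally show ?thesis .
    next
      case False
      then have "(x - a) / e \<notin> {0..1}" using e(1) by (simp add: zero_le_divide_iff divide_le_eq) linarith
      then show ?thesis by (simp add: tent_fun_0)
    qed
  qed
  also have "\<dots> = \<delta>" using integral_unique[OF k1] by simp
  finally show ?thesis unfolding set_integrable_continuous_open_interval(2)[OF ck] .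
qed

text \<open>A continuous function with integrable weak derivative is a primitive of that derivative:
  test with \<open>C\<^sup>1\<close> approximations of the indicator of \<open>(0, t)\<close>.\<close>

lemma weak_derivative_integral:
  fixes c d :: "real \<Rightarrow> real"
  assumes T: "0 < T" and c: "continuous_on {0..T} c"
    and d: "set_integrable lebesgue {0<..<T} d"
    and w: "\<And>\<phi> \<phi>'. C1_compact_support T \<phi> \<phi>' \<Longrightarrow>
      (LINT t:{0<..<T}|lebesgue. c t * \<phi>' t) = - (LINT t:{0<..<T}|lebesgue. d t * \<phi> t)"
    and t: "t \<in> {0..T}"
  shows "c t = c 0 + (LINT s:{0<..<t}|lebesgue. d s)"
proof (cases "t = 0")
  case True
  then show ?thesis by (simp add: set_lebesgue_integral_def)
next
  case False
  then have tp: "0 < t" "t \<le> T" using t by auto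
  define e where "e n = t / (4 + real n)" for n
  have e: "0 < e n" "3 * e n < t" for n using tp by (auto simp: e_def field_simps add_pos_nonneg)
  have e0: "e \<longlonglongrightarrow> 0" unfolding e_def[abs_def] by real_asymp
  \<comment> \<open>\<open>\<phi> n\<close> climbs to \<open>1\<close> on \<open>[e, 2 e]\<close> and descends to \<open>0\<close> on \<open>[t - 2 e, t - e]\<close>, where \<open>e = e n\<close>; both
    ramps stay away from \<open>0\<close> and \<open>t\<close>, so its support is compact in \<open>(0, T)\<close> even when \<open>t = T\<close>.\<close>
  define \<phi> where "\<phi> n x = step_fun ((x - e n) / e n) - step_fun ((x - (t - 2 * e n)) / e n)" for n x
  define k where "k a n x = tent_fun ((x - a) / e n) / e n" for a n x
  have kc: "continuous_on S (k a n)" for S a n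
    unfolding k_def[abs_def] using e(1)[of n]
    by (intro continuous_intros continuous_on_compose2[OF continuous_tent_fun[of UNIV]]) auto
  have g: "((\<lambda>x. (x - a) / e n) has_real_derivative 1 / e n) (at x)" for a n x
    by (rule DERIV_cdivide) (auto intro!: derivative_eq_intros)
  have dk: "((\<lambda>x. step_fun ((x - a) / e n)) has_real_derivative k a n x) (at x)" for a n x
    using DERIV_chain2[where f = step_fun and g = "\<lambda>x. (x - a) / e n", OF step_fun_deriv, of "1 / e n" x UNIV] g[of a n x]
    by (simp add: k_def)
  have C1: "C1_compact_support T (\<phi> n) (\<lambda>x. k (e n) n x - k (t - 2 * e n) n x)" for n
    unfolding C1_compact_support_def
  proof (intro conjI allI exI impI)
    show "(\<phi> n has_real_derivative k (e n) n x - k (t - 2 * e n) n x) (at x)" for x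
      unfolding \<phi>_def[abs_def] by (intro DERIV_diff dk)
    show "continuous_on UNIV (\<lambda>x. k (e n) n x - k (t - 2 * e n) n x)" by (intro continuous_intros kc)
    show "0 < e n" "t - e n < T" using e[of n] tp by auto
    fix x assume x: "x \<notin> {e n..t - e n}"
    show "\<phi> n x = 0"
    proof (cases "x < e n")
      case True
      then have "(x - e n) / e n \<le> 0" "(x - (t - 2 * e n)) / e n \<le> 0"
        using e[of n] by (auto simp: divide_le_0_iff)
      then show ?thesis by (simp add: \<phi>_def step_fun_0)
    next
      case False
      then have "1 \<le> (x - e n) / e n" "1 \<le> (x - (t - 2 * e n)) / e n"
        using e[of n] x by (auto simp: le_divide_eq)
      then show ?thesis by (simp add: \<phi>_def step_fun_1)
    qed
  qed
  have avg: "(\<lambda>n. LINT x:{0<..<T}|lebesgue. c x * k (a n) n x) \<longlonglongrightarrow> c p"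
    if p: "p \<in> {0..T}" and a: "\<And>n. 0 \<le> a n" "\<And>n. a n + e n \<le> T" "a \<longlonglongrightarrow> p" for a p
  proof (rule LIMSEQ_I)
    fix r :: real assume r: "0 < r"
    obtain \<eta> where \<eta>: "0 < \<eta>" "\<And>x. x \<in> {0..T} \<Longrightarrow> dist x p < \<eta> \<Longrightarrow> dist (c x) (c p) < r / 2"
      using c p r unfolding continuous_on_iff by (metis half_gt_zero)
    have "(\<lambda>n. \<bar>a n - p\<bar> + e n) \<longlonglongrightarrow> 0"
      using tendsto_add[OF tendsto_rabs[OF LIM_zero[OF a(3)]] e0] by simp
    then have "\<forall>\<^sub>F n in sequentially. \<bar>a n - p\<bar> + e n < \<eta>"
      using \<eta>(1) order_tendstoD(2) by blast
    then obtain N where N: "\<And>n. N \<le> n \<Longrightarrow> \<bar>a n - p\<bar> + e n < \<eta>"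
      unfolding eventually_sequentially by auto
    have "norm ((LINT x:{0<..<T}|lebesgue. c x * k (a n) n x) - c p) < r" if "N \<le> n" for n
    proof -
      have "\<bar>(LINT x:{0<..<T}|lebesgue. c x * (tent_fun ((x - a n) / e n) / e n)) - c p\<bar> \<le> r / 2"
      proof (rule tent_average[OF e(1) a(1,2) c])
        fix x assume x: "x \<in> {a n..a n + e n}"
        then have "x \<in> {0..T}" using a(1,2)[of n] by auto
        moreover have "dist x p < \<eta>" using N[OF that] x by (auto simp: dist_real_def)
        ultimately show "\<bar>c x - c p\<bar> \<le> r / 2" using \<eta>(2)[of x] by (simp add: dist_real_def)
      qed
      then show ?thesis using r by (simp add: k_def)
    qed
    then show "\<exists>no. \<forall>n\<ge>no. norm ((LINT x:{0<..<T}|lebesgue. c x * k (a n) n x) - c p) < r" by blast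
  qed
  have lim1: "(\<lambda>n. LINT x:{0<..<T}|lebesgue. c x * (k (e n) n x - k (t - 2 * e n) n x)) \<longlonglongrightarrow> c 0 - c t"
  proof -
    have i: "set_integrable lebesgue {0<..<T} (\<lambda>x. c x * k a n x)" for a n
      by (intro set_integrable_continuous_open_interval continuous_intros c kc)
    have "(LINT x:{0<..<T}|lebesgue. c x * (k (e n) n x - k (t - 2 * e n) n x))
      = (LINT x:{0<..<T}|lebesgue. c x * k (e n) n x) - (LINT x:{0<..<T}|lebesgue. c x * k (t - 2 * e n) n x)" for n
      unfolding right_diff_distrib by (rule set_integral_diff(2)[OF i i])
    moreover have "(\<lambda>n. LINT x:{0<..<T}|lebesgue. c x * k (e n) n x) \<longlonglongrightarrow> c 0"
      using e(1) tp e e0 by (intro avg) (auto simp: less_imp_le, smt (verit))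
    moreover have "(\<lambda>n. LINT x:{0<..<T}|lebesgue. c x * k (t - 2 * e n) n x) \<longlonglongrightarrow> c t"
    proof (rule avg[OF t])
      show "0 \<le> t - 2 * e n" "t - 2 * e n + e n \<le> T" for n using e[of n] tp by auto
      show "(\<lambda>n. t - 2 * e n) \<longlonglongrightarrow> t"
        using tendsto_diff[OF tendsto_const tendsto_mult[OF tendsto_const e0], of t 2] by simp
    qed
    ultimately show ?thesis by (simp add: tendsto_diff)
  qed
  have lim\<phi>: "(\<lambda>n. indicator {0<..<T} x *\<^sub>R (d x * \<phi> n x)) \<longlonglongrightarrow> indicator {0<..<t} x *\<^sub>R d x" for x
  proof (cases "x \<in> {0<..<T}")
    case True
    have "(\<lambda>n. \<phi> n x) \<longlonglongrightarrow> (if x < t then 1 else 0)"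
    proof (rule tendsto_eventually)
      define r where "r = (if x < t then min (x / 2) ((t - x) / 2) else x / 2)"
      have "0 < r" using True by (auto simp: r_def)
      then have "\<forall>\<^sub>F n in sequentially. e n < r" using e0 order_tendstoD(2) by blast
      then show "\<forall>\<^sub>F n in sequentially. \<phi> n x = (if x < t then 1 else 0)"
      proof eventually_elim
        case (elim n)
        have "e n \<le> x / 2" using elim by (auto simp: r_def split: if_splits)
        then have "1 \<le> (x - e n) / e n" using e[of n] by (simp add: field_simps)
        then have 1: "step_fun ((x - e n) / e n) = 1" by (rule step_fun_1)
        show ?case
        proof (cases "x < t")
          case lt: True
          then have "e n \<le> (t - x) / 2" using elim by (auto simp: r_def)
          then have "(x - (t - 2 * e n)) / e n \<le> 0" using e[of n] by (simp add: divide_le_0_iff)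
          then show ?thesis using 1 lt by (simp add: \<phi>_def step_fun_0)
        next
          case ge: False
          then have "1 \<le> (x - (t - 2 * e n)) / e n" using e[of n] by (simp add: le_divide_eq)
          then show ?thesis using 1 ge by (simp add: \<phi>_def step_fun_1)
        qed
      qed
    qed
    from tendsto_mult[OF tendsto_const this, of "d x"] show ?thesis
      using True tp by (auto simp: indicator_def split: if_splits)
  qed (use tp in \<open>auto simp: indicator_def\<close>)
  have \<phi>c: "continuous_on UNIV (\<phi> n)" for n
    unfolding \<phi>_def[abs_def]
    by (intro continuous_intros continuous_on_compose2[OF continuous_step_fun[of UNIV]]) (use e(1)[of n] in auto)
  then have \<phi>m: "\<phi> n \<in> borel_measurable lebesgue" for n
    by (intro measurable_completion) (simp add: borel_measurable_continuous_onI)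
  have \<phi>2: "\<bar>\<phi> n x\<bar> \<le> 2" for n x
    using step_fun_range[of "(x - e n) / e n"] step_fun_range[of "(x - (t - 2 * e n)) / e n"]
    unfolding \<phi>_def by linarith
  have dm: "(\<lambda>x. indicator {0<..<T} x *\<^sub>R d x) \<in> borel_measurable lebesgue"
    using d unfolding set_integrable_def by (rule borel_measurable_integrable)
  have lim2: "(\<lambda>n. LINT x:{0<..<T}|lebesgue. d x * \<phi> n x) \<longlonglongrightarrow> (LINT s:{0<..<t}|lebesgue. d s)"
    unfolding set_lebesgue_integral_def
  proof (rule integral_dominated_convergence)
    show "(\<lambda>x. indicator {0<..<t} x *\<^sub>R d x) \<in> borel_measurable lebesgue"
    proof -
      have "set_integrable lebesgue {0<..<t} d" by (rule set_integrable_subset[OF d]) (use tp in auto)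
      then show ?thesis unfolding set_integrable_def by (rule borel_measurable_integrable)
    qed
    show "(\<lambda>x. indicator {0<..<T} x *\<^sub>R (d x * \<phi> n x)) \<in> borel_measurable lebesgue" for n
      using borel_measurable_times[OF dm \<phi>m[of n]] by (simp add: mult.assoc)
    show "integrable lebesgue (\<lambda>x. 2 * norm (indicator {0<..<T} x *\<^sub>R d x))"
      using d unfolding set_integrable_def by (intro integrable_mult_right integrable_norm)
    show "AE x in lebesgue. norm (indicator {0<..<T} x *\<^sub>R (d x * \<phi> n x)) \<le> 2 * norm (indicator {0<..<T} x *\<^sub>R d x)" for n
    proof (rule AE_I2)
      fix x
      have "\<bar>d x\<bar> * \<bar>\<phi> n x\<bar> \<le> \<bar>d x\<bar> * 2" by (rule mult_left_mono[OF \<phi>2]) simp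
      then show "norm (indicator {0<..<T} x *\<^sub>R (d x * \<phi> n x)) \<le> 2 * norm (indicator {0<..<T} x *\<^sub>R d x)"
        by (auto simp: indicator_def abs_mult mult.commute)
    qed
    show "AE x in lebesgue. (\<lambda>n. indicator {0<..<T} x *\<^sub>R (d x * \<phi> n x)) \<longlonglongrightarrow> indicator {0<..<t} x *\<^sub>R d x"
      by (intro AE_I2 lim\<phi>)
  qed
  have "(\<lambda>n. LINT x:{0<..<T}|lebesgue. c x * (k (e n) n x - k (t - 2 * e n) n x))
    \<longlonglongrightarrow> - (LINT s:{0<..<t}|lebesgue. d s)"
    using tendsto_minus[OF lim2] w[OF C1] by simp
  from LIMSEQ_unique[OF lim1 this] show ?thesis by simp
qed

text \<open>The square of an integral as a double integral over the two halves of a square.\<close>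

lemma square_integral_triangle:
  fixes D :: "real \<Rightarrow> real"
  assumes D: "integrable lborel D"
  shows "(\<integral>x. D x \<partial>lborel)\<^sup>2 = 2 * (\<integral>x. D x * (\<integral>y. indicator {..<x} y * D y \<partial>lborel) \<partial>lborel)"
    and "integrable lborel (\<lambda>x. D x * (\<integral>y. indicator {..<x} y * D y \<partial>lborel))"
proof -
  have Dm[measurable]: "D \<in> borel_measurable borel" using D by auto
  let ?L = "lborel :: real measure"
  have prod: "integrable (?L \<Otimes>\<^sub>M ?L) (\<lambda>(x, y). D x * D y)"
  proof (rule lborel_pair.Fubini_integrable)
    show "(\<lambda>(x, y). D x * D y) \<in> borel_measurable (?L \<Otimes>\<^sub>M ?L)" by measurable
    show "integrable ?L (\<lambda>x. \<integral>y. norm (case (x, y) of (x, y) \<Rightarrow> D x * D y) \<partial>?L)"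
      using D by (simp add: abs_mult)
    show "AE x in ?L. integrable ?L (\<lambda>y. case (x, y) of (x, y) \<Rightarrow> D x * D y)"
      using D by simp
  qed
  have [measurable]: "Measurable.pred (?L \<Otimes>\<^sub>M ?L) (\<lambda>(x, y). y < x)" by measurable
  define f where "f x y = indicator {..<x} y * (D x * D y)" for x y
  define g where "g x y = indicator {x..} y * (D x * D y)" for x y
  have fi: "integrable (?L \<Otimes>\<^sub>M ?L) (case_prod f)"
    by (rule Bochner_Integration.integrable_bound[OF prod])
      (auto simp: f_def[abs_def] indicator_def of_bool_def)
  have gi: "integrable (?L \<Otimes>\<^sub>M ?L) (case_prod g)"
    by (rule Bochner_Integration.integrable_bound[OF prod])
      (auto simp: g_def[abs_def] indicator_def of_bool_def)
  have f_inner: "(\<integral>y. f x y \<partial>?L) = D x * (\<integral>y. indicator {..<x} y * D y \<partial>?L)" for x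
    unfolding f_def by (subst integral_mult_right_zero[symmetric]) (simp add: mult_ac)
  have g_inner: "(\<integral>x. g x y \<partial>?L) = D y * (\<integral>x. indicator {..<y} x * D x \<partial>?L)" for y
  proof -
    have "(\<integral>x. g x y \<partial>?L) = (\<integral>x. D y * (indicator {..<y} x * D x) \<partial>?L)"
    proof (rule integral_cong_AE)
      show "AE x in ?L. g x y = D y * (indicator {..<y} x * D x)"
        using AE_lborel_singleton[of y] by eventually_elim (auto simp: g_def indicator_def)
      have "(\<lambda>x. g x y) = (\<lambda>x. indicator {..y} x * (D x * D y))" by (auto simp: g_def indicator_def)
      then show "(\<lambda>x. g x y) \<in> borel_measurable ?L" by simp
    qed auto
    then show ?thesis by simp
  qed
  have "(\<integral>x. D x \<partial>?L)\<^sup>2 = (\<integral>x. (\<integral>y. D x * D y \<partial>?L) \<partial>?L)"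
    by (simp add: power2_eq_square)
  also have "\<dots> = (\<integral>z. (\<lambda>(x, y). D x * D y) z \<partial>(?L \<Otimes>\<^sub>M ?L))"
    using lborel_pair.integral_fst[OF prod] by simp
  also have "\<dots> = (\<integral>z. case_prod f z + case_prod g z \<partial>(?L \<Otimes>\<^sub>M ?L))"
    by (rule Bochner_Integration.integral_cong) (auto simp: f_def g_def indicator_def)
  also have "\<dots> = (\<integral>z. case_prod f z \<partial>(?L \<Otimes>\<^sub>M ?L)) + (\<integral>z. case_prod g z \<partial>(?L \<Otimes>\<^sub>M ?L))"
    by (rule Bochner_Integration.integral_add[OF fi gi])
  also have "(\<integral>z. case_prod f z \<partial>(?L \<Otimes>\<^sub>M ?L)) = (\<integral>x. (\<integral>y. f x y \<partial>?L) \<partial>?L)"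
    using lborel_pair.integral_fst[OF fi] by simp
  also have "(\<integral>z. case_prod g z \<partial>(?L \<Otimes>\<^sub>M ?L)) = (\<integral>y. (\<integral>x. g x y \<partial>?L) \<partial>?L)"
    using lborel_pair.integral_snd[OF gi] by simp
  finally show "(\<integral>x. D x \<partial>lborel)\<^sup>2 = 2 * (\<integral>x. D x * (\<integral>y. indicator {..<x} y * D y \<partial>lborel) \<partial>lborel)"
    by (simp add: f_inner g_inner)
  show "integrable lborel (\<lambda>x. D x * (\<integral>y. indicator {..<x} y * D y \<partial>lborel))"
    using lborel_pair.integrable_fst[OF fi] by (simp add: f_inner)
qed

text \<open>The chain rule for the square of a primitive of an integrable function.\<close>

lemma square_of_integral:
  fixes c d :: "real \<Rightarrow> real"
  assumes t: "0 \<le> t" and d: "set_integrable lebesgue {0<..<t} d"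
    and c: "\<And>s. s \<in> {0..t} \<Longrightarrow> c s = c 0 + (LINT r:{0<..<s}|lebesgue. d r)"
  shows "(c t)\<^sup>2 = (c 0)\<^sup>2 + 2 * (LINT s:{0<..<t}|lebesgue. c s * d s)"
proof -
  \<comment> \<open>Fubini's theorem is applied on the Borel sets, to a Borel representative \<open>D\<close> of \<open>d\<close>.\<close>
  define D0 where "D0 x = indicator {0<..<t} x * d x" for x
  have D0i: "integrable lebesgue D0" using d by (simp add: set_integrable_def D0_def[abs_def])
  obtain D1 where D1[measurable]: "D1 \<in> borel_measurable lborel" and eq1: "AE x in lborel. D0 x = D1 x"
    using completion_ex_borel_measurable_real[OF borel_measurable_integrable[OF D0i]] by auto
  define D where "D x = indicator {0<..<t} x * D1 x" for x
  have Dm[measurable]: "D \<in> borel_measurable lborel" unfolding D_def[abs_def] by measurable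
  have Dm'[measurable]: "D \<in> borel_measurable lebesgue" using Dm by (rule measurable_completion)
  have eq: "AE x in lebesgue. D0 x = D x"
    using AE_completion[OF eq1]
  proof eventually_elim
    case (elim x)
    then have "D x = indicator {0<..<t} x * D0 x" by (simp add: D_def)
    then show ?case by (simp add: D0_def indicator_def)
  qed
  have "integrable lebesgue D" by (rule integrable_cong_AE_imp[OF D0i Dm']) (use eq in auto)
  then have Di: "integrable lborel D" using integrable_completion[of D lborel] by simp
  define G where "G x = (\<integral>y. indicator {..<x} y * D y \<partial>lborel)" for x
  have DG: "integrable lborel (\<lambda>x. D x * G x)" and sq: "(\<integral>x. D x \<partial>lborel)\<^sup>2 = 2 * (\<integral>x. D x * G x \<partial>lborel)"
    using square_integral_triangle[OF Di] unfolding G_def by auto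
  have I: "(LINT r:{0<..<s}|lebesgue. d r) = (\<integral>y. indicator {..<s} y * D y \<partial>lborel)" if "s \<in> {0..t}" for s
  proof -
    have "(LINT r:{0<..<s}|lebesgue. d r) = (\<integral>y. indicator {..<s} y * D0 y \<partial>lebesgue)"
      unfolding set_lebesgue_integral_def
      by (rule Bochner_Integration.integral_cong) (use that in \<open>auto simp: D0_def indicator_def\<close>)
    also have "\<dots> = (\<integral>y. indicator {..<s} y * D y \<partial>lebesgue)"
    proof (rule integral_cong_AE)
      show "AE y in lebesgue. indicator {..<s} y * D0 y = indicator {..<s} y * D y"
        using eq by eventually_elim simp
    qed (use D0i in \<open>auto intro!: borel_measurable_times borel_measurable_indicator Dm'\<close>)
    also have "\<dots> = (\<integral>y. indicator {..<s} y * D y \<partial>lborel)" by (rule integral_completion) simp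
    finally show ?thesis .
  qed
  have "G = (\<lambda>x. \<integral>y. (if y < x then D y else 0) \<partial>lborel)"
    by (auto simp: G_def fun_eq_iff indicator_def intro!: Bochner_Integration.integral_cong)
  then have Gm: "G \<in> borel_measurable lborel" by simp
  have ct: "c t = c 0 + (\<integral>x. D x \<partial>lborel)"
  proof -
    have "(\<integral>y. indicator {..<t} y * D y \<partial>lborel) = (\<integral>x. D x \<partial>lborel)"
      by (rule Bochner_Integration.integral_cong) (auto simp: D_def indicator_def)
    moreover have "t \<in> {0..t}" using t by simp
    ultimately show ?thesis using c[of t] I[of t] by metis
  qed
  have "(LINT s:{0<..<t}|lebesgue. c s * d s) = (\<integral>x. (c 0 + G x) * D0 x \<partial>lebesgue)"
    unfolding set_lebesgue_integral_def
  proof (rule Bochner_Integration.integral_cong[OF refl])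
    fix s
    show "indicator {0<..<t} s *\<^sub>R (c s * d s) = (c 0 + G s) * D0 s"
    proof (cases "s \<in> {0<..<t}")
      case True
      then have "s \<in> {0..t}" by simp
      from c[OF this] I[OF this] have "c s = c 0 + G s" by (simp only: G_def)
      then show ?thesis using True by (simp add: D0_def)
    qed (simp add: D0_def)
  qed
  also have "\<dots> = (\<integral>x. (c 0 + G x) * D x \<partial>lebesgue)"
  proof (rule integral_cong_AE)
    have "G \<in> borel_measurable lebesgue" using Gm by (rule measurable_completion)
    then show "(\<lambda>x. (c 0 + G x) * D0 x) \<in> borel_measurable lebesgue" "(\<lambda>x. (c 0 + G x) * D x) \<in> borel_measurable lebesgue"
      using D0i by auto
    show "AE x in lebesgue. (c 0 + G x) * D0 x = (c 0 + G x) * D x" using eq by eventually_elim simp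
  qed
  also have "\<dots> = (\<integral>x. (c 0 + G x) * D x \<partial>lborel)"
    by (rule integral_completion) (use Gm in simp)
  also have "\<dots> = (\<integral>x. c 0 * D x + D x * G x \<partial>lborel)" by (simp add: algebra_simps)
  also have "\<dots> = c 0 * (\<integral>x. D x \<partial>lborel) + (\<integral>x. D x * G x \<partial>lborel)"
    using Di DG by simp
  finally have "2 * (LINT s:{0<..<t}|lebesgue. c s * d s) = 2 * c 0 * (\<integral>x. D x \<partial>lborel) + (\<integral>x. D x \<partial>lborel)\<^sup>2"
    using sq by simp
  then show ?thesis unfolding ct by (simp add: power2_sum)
qed

text \<open>Completeness of Lebesgue measure: almost everywhere limits are measurable.\<close>

lemma borel_measurable_lebesgue_on_AE_limit:
  fixes f :: "'a::euclidean_space \<Rightarrow> real"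
  assumes S: "S \<in> sets lebesgue" and s: "\<And>k. s k \<in> borel_measurable (lebesgue_on S)"
    and lim: "AE x in lebesgue_on S. (\<lambda>k. s k x) \<longlonglongrightarrow> f x"
  shows "f \<in> borel_measurable (lebesgue_on S)"
proof -
  let ?s = "\<lambda>k x. if x \<in> S then s k x else 0" and ?f = "\<lambda>x. if x \<in> S then f x else 0"
  have sm: "?s k \<in> borel_measurable lebesgue" for k
    using borel_measurable_if[OF S, of "s k"] s[of k] by simp
  have "AE x in lebesgue. x \<in> S \<longrightarrow> (\<lambda>k. s k x) \<longlonglongrightarrow> f x"
    using lim S by (simp add: AE_restrict_space_iff)
  then have ae: "AE x in lebesgue. lim (\<lambda>k. ?s k x) = ?f x"
    by eventually_elim (auto intro: limI)
  have "?f \<in> borel_measurable lebesgue"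
    by (rule borel_measurable_AE[OF _ ae]) (use sm in measurable)
  then show ?thesis using borel_measurable_if[OF S, of f] by simp
qed

section \<open>Uniqueness of the weak tangential gradient\<close>

text \<open>Of the surface measure only the underlying \<open>\<sigma>\<close>-algebra, the traces of the Borel sets, is needed below.\<close>

lemma space_surf [simp]: "space (surf \<Gamma>) = \<Gamma>"
  by (simp add: surf_def hausdorff_measure_def space_restrict_space)

lemma sets_hausdorff_measure [simp]: "sets (hausdorff_measure d) = sets borel"
  by (simp add: hausdorff_measure_def sigma_algebra.sigma_sets_eq[OF sets.sigma_algebra_axioms, of borel, simplified])

lemma borel_measurable_surf: "f \<in> borel_measurable borel \<Longrightarrow> f \<in> borel_measurable (surf \<Gamma>)"
  unfolding surf_def by (intro measurable_restrict_space1) (simp cong: measurable_cong_sets)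

lemma sets_surf: "A \<in> sets (surf \<Gamma>) \<longleftrightarrow> (\<exists>B\<in>sets borel. A = B \<inter> \<Gamma>)"
  by (auto simp: surf_def sets_restrict_space)

lemma has_derivative_at_continuous_on:
  "(\<And>x. x \<in> S \<Longrightarrow> (f has_derivative f' x) (at x)) \<Longrightarrow> continuous_on S f"
  by (rule has_derivative_continuous_on) (rule has_derivative_at_withinI)

lemma real_polynomial_function_has_derivative:
  assumes "real_polynomial_function p"
  shows "\<exists>p'. (\<forall>x. (p has_derivative p' x) (at x)) \<and> (\<forall>i. continuous_on UNIV (\<lambda>x. p' x i))"
  using assms
proof (induction rule: real_polynomial_function.induct)
  case (linear f)
  then show ?case
    by (intro exI[of _ "\<lambda>x. f"]) (auto intro: bounded_linear_imp_has_derivative)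
next
  case (const c)
  then show ?case by (intro exI[of _ "\<lambda>x h. 0"]) auto
next
  case (add f g)
  then obtain f' g' where
    "\<forall>x. (f has_derivative f' x) (at x)" "\<forall>i. continuous_on UNIV (\<lambda>x. f' x i)"
    "\<forall>x. (g has_derivative g' x) (at x)" "\<forall>i. continuous_on UNIV (\<lambda>x. g' x i)" by auto
  then show ?case
    by (intro exI[of _ "\<lambda>x h. f' x h + g' x h"]) (auto intro: has_derivative_add continuous_on_add)
next
  case (mult f g)
  then obtain f' g' where d:
    "\<forall>x. (f has_derivative f' x) (at x)" "\<forall>i. continuous_on UNIV (\<lambda>x. f' x i)"
    "\<forall>x. (g has_derivative g' x) (at x)" "\<forall>i. continuous_on UNIV (\<lambda>x. g' x i)" by auto
  have c: "continuous_on UNIV f" "continuous_on UNIV g"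
    using d by (auto intro: has_derivative_at_continuous_on)
  show ?case
  proof (intro exI[of _ "\<lambda>x h. f x * g' x h + f' x h * g x"] conjI allI)
    show "((\<lambda>x. f x * g x) has_derivative (\<lambda>h. f x * g' x h + f' x h * g x)) (at x)" for x
      using d by (intro has_derivative_mult) auto
    show "continuous_on UNIV (\<lambda>x. f x * g' x i + f' x i * g x)" for i
      using d c by (intro continuous_on_add continuous_on_mult) auto
  qed
qed

lemma C1_fieldI:
  assumes d: "\<And>x. (\<phi> has_derivative D x) (at x)"
    and c: "\<And>i. i \<in> Basis \<Longrightarrow> continuous_on UNIV (\<lambda>x. D x i)"
  shows "C1_field \<phi> (\<lambda>x. Blinfun (D x))"
proof -
  have eq: "blinfun_apply (Blinfun (D x)) = D x" for x
    by (rule bounded_linear_Blinfun_apply) (rule has_derivative_bounded_linear[OF d])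
  show ?thesis
    unfolding C1_field_def
  proof (intro conjI allI)
    show "(\<phi> has_derivative blinfun_apply (Blinfun (D x))) (at x)" for x using d by (simp add: eq)
    show "continuous_on UNIV (\<lambda>x. Blinfun (D x))"
      by (rule continuous_on_blinfun_componentwise) (use c in \<open>simp add: eq\<close>)
  qed
qed

text \<open>A \<open>C\<^sup>1\<close> field on an open set, cut off inside that set and extended by zero.\<close>

lemma C1_field_cutoff:
  fixes m :: "'a::euclidean_space \<Rightarrow> 'a" and s :: "'a \<Rightarrow> real"
  assumes U: "open U" and K: "closed K" "K \<subseteq> U"
    and s: "\<And>x. (s has_derivative s' x) (at x)" "\<And>i. continuous_on UNIV (\<lambda>x. s' x i)"
      "\<And>x. x \<notin> K \<Longrightarrow> s x = 0"
    and m: "\<And>x. x \<in> U \<Longrightarrow> (m has_derivative m' x) (at x)" "\<And>i. continuous_on U (\<lambda>x. m' x i)"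
  shows "\<exists>D. C1_field (\<lambda>x. if x \<in> U then s x *\<^sub>R m x else 0) D"
proof -
  let ?f = "\<lambda>x. if x \<in> U then s x *\<^sub>R m x else 0"
  define D where "D x h = (if x \<in> U then s x *\<^sub>R m' x h + s' x h *\<^sub>R m x else 0)" for x h
  have oK: "open (- K)" using K by (simp add: open_Compl)
  have s'0: "s' x h = 0" if "x \<notin> K" for x h
  proof -
    have "((\<lambda>x. 0) has_derivative s' x) (at x)"
      by (rule has_derivative_transform_within_open[OF s(1) oK]) (use that s(3) in auto)
    then have "s' x = (\<lambda>h. 0)" using has_derivative_unique has_derivative_const by blast
    then show ?thesis by simp
  qed
  have D0: "D x h = 0" if "x \<notin> K" for x h using s'0[OF that] s(3)[OF that] by (simp add: D_def)
  have cont: "continuous_on UNIV s" "continuous_on U m"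
    using has_derivative_at_continuous_on[OF s(1)] has_derivative_at_continuous_on[OF m(1)] by auto
  have "(?f has_derivative D x) (at x)" for x
  proof (cases "x \<in> U")
    case True
    have "((\<lambda>x. s x *\<^sub>R m x) has_derivative (\<lambda>h. s x *\<^sub>R m' x h + s' x h *\<^sub>R m x)) (at x)"
      by (rule has_derivative_scaleR[OF s(1) m(1)[OF True]])
    then have "(?f has_derivative (\<lambda>h. s x *\<^sub>R m' x h + s' x h *\<^sub>R m x)) (at x)"
      by (rule has_derivative_transform_within_open[OF _ U True]) auto
    then show ?thesis using True by (simp add: D_def[abs_def])
  next
    case False
    then have x: "x \<in> - K" using K by auto
    have "(?f has_derivative (\<lambda>h. 0)) (at x)"
      by (rule has_derivative_transform_within_open[OF has_derivative_const oK x]) (use s(3) in auto)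
    moreover have "D x = (\<lambda>h. 0)" using D0 x by auto
    ultimately show ?thesis by simp
  qed
  moreover have "continuous_on UNIV (\<lambda>x. D x i)" for i
  proof -
    have "continuous_on U (\<lambda>x. s x *\<^sub>R m' x i + s' x i *\<^sub>R m x)"
      by (intro continuous_intros m(2) cont continuous_on_subset[OF s(2)] continuous_on_subset[OF cont(1)]) auto
    then have "continuous_on U (\<lambda>x. D x i)" by (rule continuous_on_eq) (simp add: D_def)
    moreover have "continuous_on (- K) (\<lambda>x. D x i)"
      by (rule continuous_on_eq[OF continuous_on_const[of _ 0]]) (simp add: D0)
    ultimately have "continuous_on (U \<union> - K) (\<lambda>x. D x i)"
      by (rule continuous_on_open_Un[OF U oK])
    moreover have "U \<union> - K = UNIV" using K by auto
    ultimately show ?thesis by simp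
  qed
  ultimately show ?thesis using C1_fieldI by blast
qed

lemma AE_zero_if_set_integrals_zero:
  fixes h :: "'b \<Rightarrow> real"
  assumes h: "integrable N h" and z: "\<And>A. A \<in> sets N \<Longrightarrow> (LINT x|N. indicator A x * h x) = 0"
  shows "AE x in N. h x = 0"
proof -
  have hm: "h \<in> borel_measurable N" using h by (rule borel_measurable_integrable)
  have sgn: "AE x in N. x \<notin> A" if A: "A \<in> sets N" and s: "\<And>x. x \<in> A \<Longrightarrow> 0 < s * h x" for A and s :: real
  proof -
    have eq: "(\<lambda>x. indicator A x * (s * h x)) = (\<lambda>x. s * (indicator A x * h x))" by auto
    have "integrable N (\<lambda>x. indicator A x * h x)" using integrable_mult_indicator[OF A h] by simp
    then have "integrable N (\<lambda>x. indicator A x * (s * h x))" unfolding eq by simp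
    moreover have "(LINT x|N. indicator A x * (s * h x)) = 0" unfolding eq using z[OF A] by simp
    moreover have "AE x in N. 0 \<le> indicator A x * (s * h x)"
      using s by (intro AE_I2) (auto simp: indicator_def less_imp_le)
    ultimately have "AE x in N. indicator A x * (s * h x) = 0"
      using integral_nonneg_eq_0_iff_AE by blast
    then show ?thesis
    proof eventually_elim
      case (elim x)
      then show ?case using s[of x] by (cases "x \<in> A") auto
    qed
  qed
  have "{x \<in> space N. 0 < h x} \<in> sets N" "{x \<in> space N. h x < 0} \<in> sets N" using hm by measurable
  then have "AE x in N. x \<notin> {x \<in> space N. 0 < h x}" "AE x in N. x \<notin> {x \<in> space N. h x < 0}"
    using sgn[of "{x \<in> space N. 0 < h x}" 1] sgn[of "{x \<in> space N. h x < 0}" "-1"] by simp_all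
  then show ?thesis
    using AE_space
  proof eventually_elim
    case (elim x)
    then show ?case by (cases "h x" "0 :: real" rule: linorder_cases) auto
  qed
qed

text \<open>An integrable function on a compact set is zero almost everywhere if all its polynomial moments
  vanish: pass from polynomials to continuous functions, closed sets and Borel sets.\<close>

lemma polynomial_moments_zero:
  fixes h :: "'a::euclidean_space \<Rightarrow> real"
  assumes \<Gamma>: "compact \<Gamma>" and h: "integrable (surf \<Gamma>) h"
    and p: "\<And>p. real_polynomial_function p \<Longrightarrow> (LINT x|surf \<Gamma>. p x * h x) = 0"
  shows "AE x in surf \<Gamma>. h x = 0"
proof -
  let ?\<mu> = "surf \<Gamma>"
  have hm: "h \<in> borel_measurable ?\<mu>" using h by (rule borel_measurable_integrable)
  have bounded_mult: "integrable ?\<mu> (\<lambda>x. c x * h x)"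
    if "c \<in> borel_measurable ?\<mu>" "\<And>x. x \<in> \<Gamma> \<Longrightarrow> \<bar>c x\<bar> \<le> B" for c and B :: real
  proof (rule Bochner_Integration.integrable_bound[OF integrable_mult_right[OF integrable_norm[OF h], of B]])
    show "(\<lambda>x. c x * h x) \<in> borel_measurable ?\<mu>" using that hm by simp
    show "AE x in ?\<mu>. norm (c x * h x) \<le> norm (B * norm (h x))"
    proof (rule AE_I2)
      fix x assume "x \<in> space ?\<mu>"
      then have "\<bar>c x\<bar> \<le> \<bar>B\<bar>" using that(2)[of x] by simp
      then show "norm (c x * h x) \<le> norm (B * norm (h x))" by (simp add: abs_mult mult_right_mono)
    qed
  qed
  have cont: "(LINT x|?\<mu>. c x * h x) = 0" if c: "continuous_on UNIV c" for c :: "'a \<Rightarrow> real"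
  proof (rule ccontr)
    assume nz: "(LINT x|?\<mu>. c x * h x) \<noteq> 0"
    define I where "I = (LINT x|?\<mu>. \<bar>h x\<bar>)"
    have I: "0 \<le> I" unfolding I_def by (rule integral_nonneg_AE) simp
    define e where "e = \<bar>LINT x|?\<mu>. c x * h x\<bar> / (2 * (I + 1))"
    have e: "0 < e" using nz I by (simp add: e_def)
    obtain q where q: "real_polynomial_function q" "\<And>x. x \<in> \<Gamma> \<Longrightarrow> \<bar>c x - q x\<bar> < e"
      using Stone_Weierstrass_real_polynomial_function[OF \<Gamma> continuous_on_subset[OF c] e] by auto
    have qc: "continuous_on UNIV q"
      using real_polynomial_function_has_derivative[OF q(1)] by (auto intro: has_derivative_at_continuous_on)
    have bd: "\<exists>B. \<forall>x\<in>\<Gamma>. \<bar>f x\<bar> \<le> B" if "continuous_on UNIV f" for f :: "'a \<Rightarrow> real"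
      using compact_imp_bounded[OF compact_continuous_image[OF continuous_on_subset[OF that] \<Gamma>]]
      by (auto simp: bounded_iff)
    have int: "integrable ?\<mu> (\<lambda>x. f x * h x)" if "continuous_on UNIV f" for f
      using bd[OF that] bounded_mult[of f] borel_measurable_surf[OF borel_measurable_continuous_onI[OF that]]
      by blast
    have "\<bar>LINT x|?\<mu>. c x * h x\<bar> = norm (LINT x|?\<mu>. (c x - q x) * h x)"
      using Bochner_Integration.integral_diff[OF int[OF c] int[OF qc]] p[OF q(1)]
      by (simp add: left_diff_distrib)
    also have "\<dots> \<le> (LINT x|?\<mu>. e * \<bar>h x\<bar>)"
    proof (rule Bochner_Integration.integral_norm_bound_integral)
      show "integrable ?\<mu> (\<lambda>x. (c x - q x) * h x)"
        using int[OF continuous_on_diff[OF c qc]] .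
      show "integrable ?\<mu> (\<lambda>x. e * \<bar>h x\<bar>)" using h by simp
      show "norm ((c x - q x) * h x) \<le> e * \<bar>h x\<bar>" if "x \<in> space ?\<mu>" for x
        using q(2)[of x] that by (auto simp: abs_mult intro!: mult_right_mono)
    qed
    also have "\<dots> = e * I" by (simp add: I_def)
    finally have "\<bar>LINT x|?\<mu>. c x * h x\<bar> \<le> e * I" .
    also have "\<dots> \<le> \<bar>LINT x|?\<mu>. c x * h x\<bar> / 2"
      using I by (simp add: e_def field_simps)
    finally show False using nz by simp
  qed
  have clos: "(LINT x|?\<mu>. indicator F x * h x) = 0" if F: "closed F" for F
  proof (cases "F = {}")
    case False
    define c where "c n x = max 0 (1 - real n * infdist x F)" for n x
    have cc: "continuous_on UNIV (c n)" for n
      unfolding c_def[abs_def] by (intro continuous_intros)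
    have "(\<lambda>n. LINT x|?\<mu>. c n x * h x) \<longlonglongrightarrow> (LINT x|?\<mu>. indicator F x * h x)"
    proof (rule integral_dominated_convergence[where w = "\<lambda>x. \<bar>h x\<bar>"])
      show "(\<lambda>x. indicator F x * h x) \<in> borel_measurable ?\<mu>"
        by (intro borel_measurable_times hm borel_measurable_surf borel_measurable_indicator) (use F in auto)
      show "(\<lambda>x. c n x * h x) \<in> borel_measurable ?\<mu>" for n
        by (intro borel_measurable_times hm borel_measurable_surf borel_measurable_continuous_onI cc)
      show "integrable ?\<mu> (\<lambda>x. \<bar>h x\<bar>)" using h by simp
      show "AE x in ?\<mu>. norm (c n x * h x) \<le> \<bar>h x\<bar>" for n
      proof (rule AE_I2)
        fix x
        have "\<bar>c n x\<bar> \<le> 1" using infdist_nonneg[of x F] by (auto simp: c_def)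
        then show "norm (c n x * h x) \<le> \<bar>h x\<bar>" by (simp add: abs_mult mult_left_le_one_le)
      qed
      show "AE x in ?\<mu>. (\<lambda>n. c n x * h x) \<longlonglongrightarrow> indicator F x * h x"
      proof (rule AE_I2, rule tendsto_mult[OF _ tendsto_const])
        fix x
        show "(\<lambda>n. c n x) \<longlonglongrightarrow> indicator F x"
        proof (cases "x \<in> F")
          case True
          then show ?thesis by (simp add: c_def)
        next
          case x: False
          then have "0 < infdist x F" using in_closed_iff_infdist_zero[OF F False, of x] infdist_nonneg[of x F]
            by auto
          then obtain N where N: "1 < real N * infdist x F" using reals_Archimedean3 by blast
          have "\<forall>\<^sub>F n in sequentially. c n x = indicator F x"
            unfolding eventually_sequentially
          proof (intro exI[of _ N] allI impI)
            fix n assume "N \<le> n"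
            then have "real N * infdist x F \<le> real n * infdist x F"
              by (intro mult_right_mono infdist_nonneg) auto
            then show "c n x = indicator F x" using N x by (simp add: c_def)
          qed
          then show ?thesis by (rule tendsto_eventually)
        qed
      qed
    qed
    moreover have "(LINT x|?\<mu>. c n x * h x) = 0" for n by (rule cont[OF cc])
    ultimately show ?thesis by (simp add: LIMSEQ_const_iff)
  qed simp
  have borel: "(LINT x|?\<mu>. indicator A x * h x) = 0" if A: "A \<in> sets borel" for A
  proof -
    have ind: "(\<lambda>x. indicator B x :: real) \<in> borel_measurable ?\<mu>" if "B \<in> sets borel" for B
      using that by (intro borel_measurable_surf borel_measurable_indicator) auto
    have ii: "integrable ?\<mu> (\<lambda>x. indicator B x * h x)" if "B \<in> sets borel" for B
      by (rule bounded_mult[OF ind[OF that], of 1]) simp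
    have "A \<in> sigma_sets UNIV (Collect closed)" using A by (simp add: borel_eq_closed)
    then show ?thesis
    proof (induction rule: sigma_sets_induct_disjoint[rotated 2, consumes 1, case_names basic empty compl union])
      case (basic F)
      then show ?case using clos by simp
    next
      case empty
      then show ?case by simp
    next
      case (compl B)
      then have B: "B \<in> sets borel" by (simp add: borel_eq_closed)
      have "(LINT x|?\<mu>. indicator (UNIV - B) x * h x) = (LINT x|?\<mu>. indicator UNIV x * h x - indicator B x * h x)"
        by (rule Bochner_Integration.integral_cong) (auto simp: indicator_def)
      also have "\<dots> = (LINT x|?\<mu>. indicator UNIV x * h x) - (LINT x|?\<mu>. indicator B x * h x)"
        by (rule Bochner_Integration.integral_diff[OF ii ii]) (use B in auto)
      finally show ?case using compl clos[of UNIV] by simp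
    next
      case (union B)
      then have B: "B i \<in> sets borel" for i by (auto simp: borel_eq_closed)
      have "(\<lambda>n. LINT x|?\<mu>. (\<Sum>i<n. indicator (B i) x) * h x) \<longlonglongrightarrow> (LINT x|?\<mu>. indicator (\<Union>i. B i) x * h x)"
      proof (rule integral_dominated_convergence[where w = "\<lambda>x. \<bar>h x\<bar>"])
        show "(\<lambda>x. indicator (\<Union>i. B i) x * h x) \<in> borel_measurable ?\<mu>"
          by (intro borel_measurable_times hm ind) (use B in auto)
        show "(\<lambda>x. (\<Sum>i<n. indicator (B i) x) * h x) \<in> borel_measurable ?\<mu>" for n
          by (intro borel_measurable_times hm borel_measurable_sum ind B)
        show "integrable ?\<mu> (\<lambda>x. \<bar>h x\<bar>)" using h by simp
        have sum: "(\<Sum>i<n. indicator (B i) x) = (indicator (\<Union>i<n. B i) x :: real)" for n x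
          by (rule indicator_UN_disjoint[symmetric]) (use union in \<open>auto simp: disjoint_family_on_def\<close>)
        show "AE x in ?\<mu>. norm ((\<Sum>i<n. indicator (B i) x) * h x) \<le> \<bar>h x\<bar>" for n
          unfolding sum by (auto simp: indicator_def)
        show "AE x in ?\<mu>. (\<lambda>n. (\<Sum>i<n. indicator (B i) x) * h x) \<longlonglongrightarrow> indicator (\<Union>i. B i) x * h x"
          unfolding sum by (intro AE_I2 tendsto_mult tendsto_const LIMSEQ_indicator_UN)
      qed
      moreover have "(LINT x|?\<mu>. (\<Sum>i<n. indicator (B i) x) * h x) = 0" for n
      proof -
        have "(LINT x|?\<mu>. (\<Sum>i<n. indicator (B i) x) * h x) = (\<Sum>i<n. LINT x|?\<mu>. indicator (B i) x * h x)"
          unfolding sum_distrib_right by (rule Bochner_Integration.integral_sum) (use ii B in auto)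
        then show ?thesis using union by simp
      qed
      ultimately show ?case by (simp add: LIMSEQ_const_iff)
    qed (auto simp: Int_stable_def)
  qed
  show ?thesis
  proof (rule AE_zero_if_set_integrals_zero[OF h])
    fix A assume "A \<in> sets ?\<mu>"
    then obtain B where B: "B \<in> sets borel" "A = B \<inter> \<Gamma>" by (auto simp: sets_surf)
    have "(LINT x|?\<mu>. indicator A x * h x) = (LINT x|?\<mu>. indicator B x * h x)"
      by (rule Bochner_Integration.integral_cong) (auto simp: B indicator_def)
    then show "(LINT x|?\<mu>. indicator A x * h x) = 0" using borel[OF B(1)] by simp
  qed
qed

lemma closed_C2_hypersurface_chart:
  fixes \<Gamma> :: "'a::euclidean_space set"
  assumes hyp: "closed_C2_hypersurface \<Gamma> \<nu>" and x0: "x0 \<in> \<Gamma>"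
  obtains U and g :: "'a \<Rightarrow> 'a" and H :: "'a \<Rightarrow> 'a \<Rightarrow>\<^sub>L 'a" where "open U" "x0 \<in> U"
    "\<And>y. y \<in> U \<Longrightarrow> (g has_derivative blinfun_apply (H y)) (at y)" "\<And>y. y \<in> U \<Longrightarrow> g y \<noteq> 0"
    "continuous_on U H" "\<And>y. y \<in> \<Gamma> \<Longrightarrow> y \<in> U \<Longrightarrow> \<nu> y = g y /\<^sub>R norm (g y)"
proof -
  have "\<exists>U (\<phi> :: 'a \<Rightarrow> real) (g :: 'a \<Rightarrow> 'a) (H :: 'a \<Rightarrow> 'a \<Rightarrow>\<^sub>L 'a).
      open U \<and> x0 \<in> U \<and>
      (\<forall>y\<in>U. (\<phi> has_derivative (\<lambda>h. g y \<bullet> h)) (at y) \<and>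
             (g has_derivative blinfun_apply (H y)) (at y) \<and> g y \<noteq> 0) \<and>
      continuous_on U H \<and>
      \<Gamma> \<inter> U = {y\<in>U. \<phi> y = 0} \<and>
      (\<forall>y\<in>\<Gamma> \<inter> U. \<nu> y = g y /\<^sub>R norm (g y))"
    using hyp x0 unfolding closed_C2_hypersurface_def by (elim conjE) (drule (1) bspec)
  then obtain U and \<phi> :: "'a \<Rightarrow> real" and g :: "'a \<Rightarrow> 'a" and H :: "'a \<Rightarrow> 'a \<Rightarrow>\<^sub>L 'a"
    where U: "open U" "x0 \<in> U"
    and ch: "\<forall>y\<in>U. (\<phi> has_derivative (\<lambda>h. g y \<bullet> h)) (at y) \<and>
             (g has_derivative blinfun_apply (H y)) (at y) \<and> g y \<noteq> 0"
    and H: "continuous_on U H" and \<nu>': "\<forall>y\<in>\<Gamma> \<inter> U. \<nu> y = g y /\<^sub>R norm (g y)"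
    by (elim exE conjE) (rule that)
  have g: "(g has_derivative blinfun_apply (H y)) (at y)" "g y \<noteq> 0" if "y \<in> U" for y
    using bspec[OF ch that] by simp_all
  have \<nu>: "\<nu> y = g y /\<^sub>R norm (g y)" if "y \<in> \<Gamma>" "y \<in> U" for y
    using \<nu>' that by simp
  show ?thesis by (rule that[OF U g H \<nu>])
qed

text \<open>A tangential function orthogonal to all tangential \<open>C\<^sup>1\<close> fields vanishes.  In a chart with defining
  gradient \<open>g\<close>, the test fields are cut-offs of \<open>(g \<bullet> g) b - (b \<bullet> g) g\<close>, which are \<open>C\<^sup>1\<close>, tangential,
  and have the same inner product with a tangential vector as \<open>(g \<bullet> g) b\<close>.\<close>

lemma tangential_orthogonal_zero:
  fixes d :: "'a::euclidean_space \<Rightarrow> 'a"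
  assumes hyp: "closed_C2_hypersurface \<Gamma> \<nu>" and tan: "\<And>x. x \<in> \<Gamma> \<Longrightarrow> d x \<bullet> \<nu> x = 0"
    and orth: "\<And>\<phi> D. C1_field \<phi> D \<Longrightarrow> (\<And>x. x \<in> \<Gamma> \<Longrightarrow> \<phi> x \<bullet> \<nu> x = 0) \<Longrightarrow>
      integrable (surf \<Gamma>) (\<lambda>x. d x \<bullet> \<phi> x) \<and> (LINT x|surf \<Gamma>. d x \<bullet> \<phi> x) = 0"
  shows "AE x in surf \<Gamma>. d x = 0"
proof -
  have \<Gamma>: "compact \<Gamma>" using hyp by (simp add: closed_C2_hypersurface_def)
  have local: "\<exists>r>0. AE x in surf \<Gamma>. x \<in> ball x0 r \<longrightarrow> d x = 0" if x0: "x0 \<in> \<Gamma>" for x0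
  proof -
    obtain U and g :: "'a \<Rightarrow> 'a" and H :: "'a \<Rightarrow> 'a \<Rightarrow>\<^sub>L 'a" where U: "open U" "x0 \<in> U"
      and g: "\<And>y. y \<in> U \<Longrightarrow> (g has_derivative blinfun_apply (H y)) (at y)" "\<And>y. y \<in> U \<Longrightarrow> g y \<noteq> 0"
      and H: "continuous_on U H"
      and \<nu>: "\<And>y. y \<in> \<Gamma> \<Longrightarrow> y \<in> U \<Longrightarrow> \<nu> y = g y /\<^sub>R norm (g y)"
      by (rule closed_C2_hypersurface_chart[OF hyp x0]) (rule that)
    obtain r where r: "0 < r" "cball x0 r \<subseteq> U" using U open_contains_cball by blast
    have gc: "continuous_on U g"
      by (rule has_derivative_at_continuous_on) (rule g(1))
    \<comment> \<open>A \<open>C\<^sup>1\<close> cut-off function, positive exactly on the open ball of radius \<open>r\<close>.\<close>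
    define \<zeta> where "\<zeta> x = (max 0 (r\<^sup>2 - (x - x0) \<bullet> (x - x0)))\<^sup>2" for x
    define \<zeta>' where "\<zeta>' x k = 2 * max 0 (r\<^sup>2 - (x - x0) \<bullet> (x - x0)) * (- (2 * ((x - x0) \<bullet> k)))" for x k
    have \<zeta>d: "(\<zeta> has_derivative \<zeta>' x) (at x)" for x
    proof -
      have "((\<lambda>x. r\<^sup>2 - (x - x0) \<bullet> (x - x0)) has_derivative (\<lambda>k. - (2 * ((x - x0) \<bullet> k)))) (at x)"
        by (auto intro!: derivative_eq_intros simp: inner_commute)
      from has_derivative_compose[OF this, of "\<lambda>x. (max 0 x)\<^sup>2"
          "(*) (2 * max 0 (r\<^sup>2 - (x - x0) \<bullet> (x - x0)))"]
      show ?thesis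
        using has_real_derivative_max0_sq[of "r\<^sup>2 - (x - x0) \<bullet> (x - x0)"]
        unfolding \<zeta>_def[abs_def] \<zeta>'_def[abs_def] has_field_derivative_def by simp
    qed
    have \<zeta>'c: "continuous_on UNIV (\<lambda>x. \<zeta>' x i)" for i unfolding \<zeta>'_def by (intro continuous_intros)
    have \<zeta>0: "\<zeta> x = 0" if "x \<notin> cball x0 r" for x
    proof -
      have "r < norm (x - x0)" using that by (simp add: dist_norm norm_minus_commute)
      then have "r\<^sup>2 \<le> (norm (x - x0))\<^sup>2" using r(1) by (intro power_mono) auto
      then show ?thesis by (simp add: \<zeta>_def power2_norm_eq_inner)
    qed
    have \<zeta>pos: "\<zeta> x \<noteq> 0" if "x \<in> ball x0 r" for x
    proof -
      have "norm (x - x0) < r" using that by (simp add: dist_norm norm_minus_commute)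
      then have "(norm (x - x0))\<^sup>2 < r\<^sup>2" by (intro power_strict_mono) auto
      then show ?thesis by (simp add: \<zeta>_def power2_norm_eq_inner)
    qed
    have b: "AE x in surf \<Gamma>. x \<in> ball x0 r \<longrightarrow> d x \<bullet> b = 0" for b
    proof -
      define m where "m x = (g x \<bullet> g x) *\<^sub>R b - (b \<bullet> g x) *\<^sub>R g x" for x
      define m' where "m' x k = (2 * (g x \<bullet> H x k)) *\<^sub>R b
        - ((b \<bullet> g x) *\<^sub>R H x k + (b \<bullet> H x k) *\<^sub>R g x)" for x k
      have md: "(m has_derivative m' x) (at x)" if "x \<in> U" for x
        unfolding m_def[abs_def] m'_def[abs_def]
        by (auto intro!: derivative_eq_intros g(1)[OF that] simp: inner_commute algebra_simps)
      have m'c: "continuous_on U (\<lambda>x. m' x i)" for i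
        unfolding m'_def by (intro continuous_intros gc H)
      \<comment> \<open>\<open>d \<bullet> g = 0\<close> turns \<open>d \<bullet> m\<close> into \<open>(g \<bullet> g) (d \<bullet> b)\<close>, so testing with \<open>p \<zeta> m\<close> gives the moment of \<open>h\<close>
        against the polynomial \<open>p\<close>.\<close>
      define h where "h x = (if x \<in> U then \<zeta> x * ((g x \<bullet> g x) * (d x \<bullet> b)) else 0)" for x
      have main: "integrable (surf \<Gamma>) (\<lambda>x. p x * h x) \<and> (LINT x|surf \<Gamma>. p x * h x) = 0"
        if p: "real_polynomial_function p" for p
      proof -
        obtain p' where p': "\<And>x. (p has_derivative p' x) (at x)" "\<And>i. continuous_on UNIV (\<lambda>x. p' x i)"
          using real_polynomial_function_has_derivative[OF p] by blast
        have pc: "continuous_on UNIV p" "continuous_on UNIV \<zeta>"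
          using has_derivative_at_continuous_on[OF p'(1)] has_derivative_at_continuous_on[OF \<zeta>d] by auto
        let ?\<phi> = "\<lambda>x. if x \<in> U then (p x * \<zeta> x) *\<^sub>R m x else 0"
        have "\<exists>D. C1_field ?\<phi> D"
        proof (rule C1_field_cutoff[OF U(1) closed_cball r(2) _ _ _ md m'c])
          show "((\<lambda>x. p x * \<zeta> x) has_derivative (\<lambda>k. p x * \<zeta>' x k + p' x k * \<zeta> x)) (at x)" for x
            by (rule has_derivative_mult[OF p'(1) \<zeta>d])
          show "continuous_on UNIV (\<lambda>x. p x * \<zeta>' x i + p' x i * \<zeta> x)" for i
            by (intro continuous_intros pc p'(2) \<zeta>'c)
        qed (use \<zeta>0 in auto)
        then obtain D where D: "C1_field ?\<phi> D" ..
        have "?\<phi> x \<bullet> \<nu> x = 0" if "x \<in> \<Gamma>" for x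
        proof -
          have "m x \<bullet> g x = 0" by (simp add: m_def inner_diff_left)
          then show ?thesis using \<nu>[OF that] by (cases "x \<in> U") simp_all
        qed
        from orth[OF D this]
        have o: "integrable (surf \<Gamma>) (\<lambda>x. d x \<bullet> ?\<phi> x)" "(LINT x|surf \<Gamma>. d x \<bullet> ?\<phi> x) = 0" by auto
        have eq: "d x \<bullet> ?\<phi> x = p x * h x" if "x \<in> space (surf \<Gamma>)" for x
        proof (cases "x \<in> U")
          case True
          then have "d x \<bullet> g x = 0" using tan[of x] \<nu>[OF _ True] g(2)[OF True] that by simp
          then show ?thesis using True by (simp add: h_def m_def inner_diff_right)
        qed (simp add: h_def)
        have "integrable (surf \<Gamma>) (\<lambda>x. d x \<bullet> ?\<phi> x) = integrable (surf \<Gamma>) (\<lambda>x. p x * h x)"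
          by (rule Bochner_Integration.integrable_cong[OF refl eq])
        moreover have "(LINT x|surf \<Gamma>. d x \<bullet> ?\<phi> x) = (LINT x|surf \<Gamma>. p x * h x)"
          by (rule Bochner_Integration.integral_cong[OF refl eq])
        ultimately show ?thesis using o by simp
      qed
      have "AE x in surf \<Gamma>. h x = 0"
        by (rule polynomial_moments_zero[OF \<Gamma>])
          (use main main[OF real_polynomial_function.intros(2)[of 1]] in auto)
      then show ?thesis
      proof eventually_elim
        case (elim x)
        show ?case
        proof
          assume x: "x \<in> ball x0 r"
          then have "x \<in> U" using r(2) ball_subset_cball by blast
          then show "d x \<bullet> b = 0" using elim \<zeta>pos[OF x] g(2)[of x] by (simp add: h_def)
        qed
      qed
    qed
    have "AE x in surf \<Gamma>. \<forall>b\<in>Basis. x \<in> ball x0 r \<longrightarrow> d x \<bullet> b = 0"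
      by (rule AE_finite_allI) (use b in auto)
    then have "AE x in surf \<Gamma>. x \<in> ball x0 r \<longrightarrow> d x = 0"
    proof eventually_elim
      case (elim x)
      show ?case
      proof
        assume "x \<in> ball x0 r"
        with elim have "d x \<bullet> b = 0" if "b \<in> Basis" for b using that by blast
        then show "d x = 0" using euclidean_all_zero_iff[of "d x"] by blast
      qed
    qed
    then show ?thesis using r(1) by blast
  qed
  then obtain r where r: "\<And>x0. x0 \<in> \<Gamma> \<Longrightarrow> 0 < r x0"
    "\<And>x0. x0 \<in> \<Gamma> \<Longrightarrow> AE x in surf \<Gamma>. x \<in> ball x0 (r x0) \<longrightarrow> d x = 0" by metis
  obtain F where F: "F \<subseteq> \<Gamma>" "finite F" "\<Gamma> \<subseteq> (\<Union>x0\<in>F. ball x0 (r x0))"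
    by (rule compactE_image[OF \<Gamma>, of \<Gamma> "\<lambda>x0. ball x0 (r x0)"]) (use r(1) in auto)
  have "AE x in surf \<Gamma>. \<forall>x0\<in>F. x \<in> ball x0 (r x0) \<longrightarrow> d x = 0"
    by (rule AE_finite_allI) (use F r(2) in auto)
  then show ?thesis
    using AE_space by eventually_elim (use F(3) in auto)
qed

text \<open>No square integrability is required of either gradient: \<^const>\<open>tgrad\<close> is an arbitrary weak gradient,
  so uniqueness is what makes it square integrable for functions in \<open>H\<^sup>1(\<Gamma>)\<close>.\<close>

lemma weak_tgrad_unique:
  assumes hyp: "closed_C2_hypersurface \<Gamma> \<nu>"
    and g1: "has_weak_tgrad \<Gamma> \<nu> v g1" and g2: "has_weak_tgrad \<Gamma> \<nu> v g2"
  shows "AE x in surf \<Gamma>. g1 x = g2 x"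
proof -
  have "AE x in surf \<Gamma>. g1 x - g2 x = 0"
  proof (rule tangential_orthogonal_zero[OF hyp])
    show "(g1 x - g2 x) \<bullet> \<nu> x = 0" if "x \<in> \<Gamma>" for x
      using g1 g2 that by (simp add: has_weak_tgrad_def inner_diff_left)
    fix \<phi> D assume "C1_field \<phi> D" "\<And>x. x \<in> \<Gamma> \<Longrightarrow> \<phi> x \<bullet> \<nu> x = 0"
    then have A: "C1_field \<phi> D \<and> (\<forall>x\<in>\<Gamma>. \<phi> x \<bullet> \<nu> x = 0)" by blast
    have 1: "integrable (surf \<Gamma>) (\<lambda>x. g1 x \<bullet> \<phi> x) \<and> (LINT x|surf \<Gamma>. v x * surf_div \<nu> D x) = - (LINT x|surf \<Gamma>. g1 x \<bullet> \<phi> x)"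
      using g1 A unfolding has_weak_tgrad_def by blast
    have 2: "integrable (surf \<Gamma>) (\<lambda>x. g2 x \<bullet> \<phi> x) \<and> (LINT x|surf \<Gamma>. v x * surf_div \<nu> D x) = - (LINT x|surf \<Gamma>. g2 x \<bullet> \<phi> x)"
      using g2 A unfolding has_weak_tgrad_def by blast
    from 1 2 have i: "integrable (surf \<Gamma>) (\<lambda>x. g1 x \<bullet> \<phi> x)" "integrable (surf \<Gamma>) (\<lambda>x. g2 x \<bullet> \<phi> x)"
      and e: "(LINT x|surf \<Gamma>. g1 x \<bullet> \<phi> x) = (LINT x|surf \<Gamma>. g2 x \<bullet> \<phi> x)"
      by simp_all
    then show "integrable (surf \<Gamma>) (\<lambda>x. (g1 x - g2 x) \<bullet> \<phi> x) \<and> (LINT x|surf \<Gamma>. (g1 x - g2 x) \<bullet> \<phi> x) = 0"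
      by (simp add: inner_diff_left)
  qed
  then show ?thesis by simp
qed

lemma has_weak_tgrad_lin:
  assumes v: "has_weak_tgrad \<Gamma> \<nu> v g" and w: "has_weak_tgrad \<Gamma> \<nu> w g'"
  shows "has_weak_tgrad \<Gamma> \<nu> (\<lambda>x. a * v x + b * w x) (\<lambda>x. a *\<^sub>R g x + b *\<^sub>R g' x)"
  unfolding has_weak_tgrad_def
proof (intro conjI ballI allI impI)
  show "(\<lambda>x. a *\<^sub>R g x + b *\<^sub>R g' x) \<in> borel_measurable (surf \<Gamma>)"
    using v w unfolding has_weak_tgrad_def
    by (intro borel_measurable_add borel_measurable_scaleR borel_measurable_const) auto
  show "(a *\<^sub>R g x + b *\<^sub>R g' x) \<bullet> \<nu> x = 0" if "x \<in> \<Gamma>" for x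
    using v w that by (simp add: has_weak_tgrad_def inner_add_left)
  fix \<phi> D assume A: "C1_field \<phi> D \<and> (\<forall>x\<in>\<Gamma>. \<phi> x \<bullet> \<nu> x = 0)"
  have i: "integrable (surf \<Gamma>) (\<lambda>x. v x * surf_div \<nu> D x)" "integrable (surf \<Gamma>) (\<lambda>x. g x \<bullet> \<phi> x)"
    "integrable (surf \<Gamma>) (\<lambda>x. w x * surf_div \<nu> D x)" "integrable (surf \<Gamma>) (\<lambda>x. g' x \<bullet> \<phi> x)"
    and e: "(LINT x|surf \<Gamma>. v x * surf_div \<nu> D x) = - (LINT x|surf \<Gamma>. g x \<bullet> \<phi> x)"
    "(LINT x|surf \<Gamma>. w x * surf_div \<nu> D x) = - (LINT x|surf \<Gamma>. g' x \<bullet> \<phi> x)"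
    using v w A unfolding has_weak_tgrad_def by blast+
  have e1: "(\<lambda>x. (a * v x + b * w x) * surf_div \<nu> D x)
    = (\<lambda>x. a * (v x * surf_div \<nu> D x) + b * (w x * surf_div \<nu> D x))" by (auto simp: algebra_simps)
  have e2: "(\<lambda>x. (a *\<^sub>R g x + b *\<^sub>R g' x) \<bullet> \<phi> x) = (\<lambda>x. a * (g x \<bullet> \<phi> x) + b * (g' x \<bullet> \<phi> x))"
    by (auto simp: inner_add_left)
  show "integrable (surf \<Gamma>) (\<lambda>x. (a * v x + b * w x) * surf_div \<nu> D x)"
    "integrable (surf \<Gamma>) (\<lambda>x. (a *\<^sub>R g x + b *\<^sub>R g' x) \<bullet> \<phi> x)"
    unfolding e1 e2 using i by simp_all
  show "(LINT x|surf \<Gamma>. (a * v x + b * w x) * surf_div \<nu> D x)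
    = - (LINT x|surf \<Gamma>. (a *\<^sub>R g x + b *\<^sub>R g' x) \<bullet> \<phi> x)"
    unfolding e1 e2 using i e by simp
qed

section \<open>The forms of the discretisation\<close>

lemma psd_form_mono: "psd_form_on W a \<Longrightarrow> V \<subseteq> W \<Longrightarrow> psd_form_on V a"
  unfolding psd_form_on_def subset_iff by blast

lemma integrable_product_of_squares:
  fixes v w :: "'b \<Rightarrow> real"
  assumes "v \<in> borel_measurable N" "w \<in> borel_measurable N"
    "integrable N (\<lambda>x. (v x)\<^sup>2)" "integrable N (\<lambda>x. (w x)\<^sup>2)"
  shows "integrable N (\<lambda>x. v x * w x)"
proof (rule Bochner_Integration.integrable_bound[OF Bochner_Integration.integrable_add[OF assms(3,4)]])
  show "(\<lambda>x. v x * w x) \<in> borel_measurable N" using assms by simp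
  show "AE x in N. norm (v x * w x) \<le> norm ((v x)\<^sup>2 + (w x)\<^sup>2)"
  proof (rule AE_I2)
    fix x
    have "0 \<le> (\<bar>v x\<bar> - \<bar>w x\<bar>)\<^sup>2" by simp
    then have "2 * (\<bar>v x\<bar> * \<bar>w x\<bar>) \<le> (v x)\<^sup>2 + (w x)\<^sup>2" by (simp add: power2_diff)
    moreover have "0 \<le> \<bar>v x\<bar> * \<bar>w x\<bar>" by simp
    ultimately have "\<bar>v x\<bar> * \<bar>w x\<bar> \<le> (v x)\<^sup>2 + (w x)\<^sup>2" by linarith
    then show "norm (v x * w x) \<le> norm ((v x)\<^sup>2 + (w x)\<^sup>2)" by (simp add: abs_mult)
  qed
qed

lemma L2_surf_product_integrable:
  "v \<in> L2_surf \<Gamma> \<Longrightarrow> w \<in> L2_surf \<Gamma> \<Longrightarrow> integrable (surf \<Gamma>) (\<lambda>x. v x * w x)"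
  unfolding L2_surf_def by (auto intro: integrable_product_of_squares)

lemma fun_subspace_L2_surf: "fun_subspace (L2_surf \<Gamma>)"
  unfolding fun_subspace_def
proof (intro conjI ballI allI)
  show "(\<lambda>x. 0) \<in> L2_surf \<Gamma>" by (simp add: L2_surf_def)
  fix v w and a b :: real assume v: "v \<in> L2_surf \<Gamma>" and w: "w \<in> L2_surf \<Gamma>"
  have m: "v \<in> borel_measurable (surf \<Gamma>)" "w \<in> borel_measurable (surf \<Gamma>)"
    using v w by (auto simp: L2_surf_def)
  have eq: "(\<lambda>x. (a * v x + b * w x)\<^sup>2)
    = (\<lambda>x. a\<^sup>2 * (v x)\<^sup>2 + (2 * a * b) * (v x * w x) + b\<^sup>2 * (w x)\<^sup>2)"
    by (auto simp: power2_eq_square algebra_simps)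
  have "integrable (surf \<Gamma>) (\<lambda>x. (a * v x + b * w x)\<^sup>2)"
    unfolding eq using v w L2_surf_product_integrable[OF v w] by (auto simp: L2_surf_def)
  then show "(\<lambda>x. a * v x + b * w x) \<in> L2_surf \<Gamma>" using m by (simp add: L2_surf_def)
qed

lemma psd_form_ip_surf: "psd_form_on (L2_surf \<Gamma>) (ip_surf \<Gamma>)"
  unfolding psd_form_on_def
proof (intro conjI ballI allI)
  show "ip_surf \<Gamma> v w = ip_surf \<Gamma> w v" for v w by (simp add: ip_surf_def mult.commute)
  show "0 \<le> ip_surf \<Gamma> v v" for v unfolding ip_surf_def by (rule integral_nonneg_AE) simp
  fix u v w and c d :: real assume u: "u \<in> L2_surf \<Gamma>" "v \<in> L2_surf \<Gamma>" "w \<in> L2_surf \<Gamma>"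
  have eq: "(\<lambda>x. (c * u x + d * v x) * w x) = (\<lambda>x. c * (u x * w x) + d * (v x * w x))"
    by (auto simp: algebra_simps)
  show "ip_surf \<Gamma> (\<lambda>x. c * u x + d * v x) w = c * ip_surf \<Gamma> u w + d * ip_surf \<Gamma> v w"
    unfolding ip_surf_def eq using u by (simp add: L2_surf_product_integrable)
qed

lemma has_weak_tgrad_zero: "has_weak_tgrad \<Gamma> \<nu> (\<lambda>x. 0) (\<lambda>x. 0)"
  by (simp add: has_weak_tgrad_def)

lemma integrable_norm_sq_lin:
  fixes g h :: "'b \<Rightarrow> 'a::euclidean_space"
  assumes "g \<in> borel_measurable N" "h \<in> borel_measurable N"
    "integrable N (\<lambda>x. (norm (g x))\<^sup>2)" "integrable N (\<lambda>x. (norm (h x))\<^sup>2)"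
  shows "integrable N (\<lambda>x. g x \<bullet> h x)" "integrable N (\<lambda>x. (norm (a *\<^sub>R g x + b *\<^sub>R h x))\<^sup>2)"
proof -
  have "integrable N (\<lambda>x. norm (g x) * norm (h x))"
    using assms by (intro integrable_product_of_squares) auto
  then show i: "integrable N (\<lambda>x. g x \<bullet> h x)"
  proof (rule Bochner_Integration.integrable_bound)
    show "(\<lambda>x. g x \<bullet> h x) \<in> borel_measurable N" using assms by (intro borel_measurable_inner) auto
    show "AE x in N. norm (g x \<bullet> h x) \<le> norm (norm (g x) * norm (h x))"
      by (intro AE_I2) (simp add: Cauchy_Schwarz_ineq2 abs_mult)
  qed
  have eq: "(\<lambda>x. (norm (a *\<^sub>R g x + b *\<^sub>R h x))\<^sup>2)
    = (\<lambda>x. a\<^sup>2 * (norm (g x))\<^sup>2 + (2 * a * b) * (g x \<bullet> h x) + b\<^sup>2 * (norm (h x))\<^sup>2)"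
    unfolding power2_norm_eq_inner
    by (auto simp: inner_add_left inner_add_right inner_commute power2_eq_square algebra_simps)
  show "integrable N (\<lambda>x. (norm (a *\<^sub>R g x + b *\<^sub>R h x))\<^sup>2)"
    unfolding eq using assms i by auto
qed

lemma fun_subspace_H1_surf: "fun_subspace (H1_surf \<Gamma> \<nu>)"
  unfolding fun_subspace_def
proof (intro conjI ballI allI)
  show "(\<lambda>x. 0) \<in> H1_surf \<Gamma> \<nu>"
    using fun_subspace_zero[OF fun_subspace_L2_surf, of \<Gamma>] has_weak_tgrad_zero[of \<Gamma> \<nu>]
    by (auto simp: H1_surf_def intro!: exI[of _ "\<lambda>x. 0"])
  fix v w and a b :: real assume v: "v \<in> H1_surf \<Gamma> \<nu>" and w: "w \<in> H1_surf \<Gamma> \<nu>"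
  obtain g where g: "has_weak_tgrad \<Gamma> \<nu> v g" "integrable (surf \<Gamma>) (\<lambda>x. (norm (g x))\<^sup>2)"
    using v by (auto simp: H1_surf_def)
  obtain h where h: "has_weak_tgrad \<Gamma> \<nu> w h" "integrable (surf \<Gamma>) (\<lambda>x. (norm (h x))\<^sup>2)"
    using w by (auto simp: H1_surf_def)
  have "(\<lambda>x. a * v x + b * w x) \<in> L2_surf \<Gamma>"
    using v w by (intro fun_subspace_lin[OF fun_subspace_L2_surf]) (auto simp: H1_surf_def)
  moreover have "integrable (surf \<Gamma>) (\<lambda>x. (norm (a *\<^sub>R g x + b *\<^sub>R h x))\<^sup>2)"
    using g h by (intro integrable_norm_sq_lin) (auto simp: has_weak_tgrad_def)
  ultimately show "(\<lambda>x. a * v x + b * w x) \<in> H1_surf \<Gamma> \<nu>"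
    using has_weak_tgrad_lin[OF g(1) h(1), of a b] by (auto simp: H1_surf_def)
qed

lemma H1_surf_subset_L2: "H1_surf \<Gamma> \<nu> \<subseteq> L2_surf \<Gamma>" by (auto simp: H1_surf_def)

lemma tgrad_weak:
  assumes hyp: "closed_C2_hypersurface \<Gamma> \<nu>" and v: "v \<in> H1_surf \<Gamma> \<nu>"
  shows "has_weak_tgrad \<Gamma> \<nu> v (tgrad \<Gamma> \<nu> v)" "tgrad \<Gamma> \<nu> v \<in> borel_measurable (surf \<Gamma>)"
    "integrable (surf \<Gamma>) (\<lambda>x. (norm (tgrad \<Gamma> \<nu> v x))\<^sup>2)"
proof -
  obtain g where g: "has_weak_tgrad \<Gamma> \<nu> v g" "integrable (surf \<Gamma>) (\<lambda>x. (norm (g x))\<^sup>2)"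
    using v by (auto simp: H1_surf_def)
  show t: "has_weak_tgrad \<Gamma> \<nu> v (tgrad \<Gamma> \<nu> v)" unfolding tgrad_def using g(1) by (rule someI[where P = "has_weak_tgrad \<Gamma> \<nu> v"])
  then show m: "tgrad \<Gamma> \<nu> v \<in> borel_measurable (surf \<Gamma>)" by (simp add: has_weak_tgrad_def)
  show "integrable (surf \<Gamma>) (\<lambda>x. (norm (tgrad \<Gamma> \<nu> v x))\<^sup>2)"
  proof (rule integrable_cong_AE_imp[OF g(2)])
    show "(\<lambda>x. (norm (tgrad \<Gamma> \<nu> v x))\<^sup>2) \<in> borel_measurable (surf \<Gamma>)"
      by (intro borel_measurable_power measurable_compose[OF m borel_measurable_norm])
    show "AE x in surf \<Gamma>. (norm (g x))\<^sup>2 = (norm (tgrad \<Gamma> \<nu> v x))\<^sup>2"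
      using weak_tgrad_unique[OF hyp g(1) t] by eventually_elim simp
  qed
qed

lemma psd_form_ip_tgrad:
  assumes hyp: "closed_C2_hypersurface \<Gamma> \<nu>"
  shows "psd_form_on (H1_surf \<Gamma> \<nu>) (ip_tgrad \<Gamma> \<nu>)"
  unfolding psd_form_on_def
proof (intro conjI ballI allI)
  show "ip_tgrad \<Gamma> \<nu> v w = ip_tgrad \<Gamma> \<nu> w v" for v w by (simp add: ip_tgrad_def inner_commute)
  show "0 \<le> ip_tgrad \<Gamma> \<nu> v v" for v unfolding ip_tgrad_def by (rule integral_nonneg_AE) simp
  fix u v w and c d :: real assume u: "u \<in> H1_surf \<Gamma> \<nu>" and v: "v \<in> H1_surf \<Gamma> \<nu>" and w: "w \<in> H1_surf \<Gamma> \<nu>"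
  note U = tgrad_weak[OF hyp u] and V = tgrad_weak[OF hyp v] and W = tgrad_weak[OF hyp w]
  let ?z = "\<lambda>x. c * u x + d * v x"
  have z: "?z \<in> H1_surf \<Gamma> \<nu>" by (rule fun_subspace_lin[OF fun_subspace_H1_surf u v])
  note Z = tgrad_weak[OF hyp z]
  have ae: "AE x in surf \<Gamma>. tgrad \<Gamma> \<nu> ?z x = c *\<^sub>R tgrad \<Gamma> \<nu> u x + d *\<^sub>R tgrad \<Gamma> \<nu> v x"
    by (rule weak_tgrad_unique[OF hyp Z(1) has_weak_tgrad_lin[OF U(1) V(1)]])
  have "ip_tgrad \<Gamma> \<nu> ?z w
    = (LINT x|surf \<Gamma>. c * (tgrad \<Gamma> \<nu> u x \<bullet> tgrad \<Gamma> \<nu> w x) + d * (tgrad \<Gamma> \<nu> v x \<bullet> tgrad \<Gamma> \<nu> w x))"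
    unfolding ip_tgrad_def
  proof (rule integral_cong_AE)
    show "AE x in surf \<Gamma>. tgrad \<Gamma> \<nu> ?z x \<bullet> tgrad \<Gamma> \<nu> w x
      = c * (tgrad \<Gamma> \<nu> u x \<bullet> tgrad \<Gamma> \<nu> w x) + d * (tgrad \<Gamma> \<nu> v x \<bullet> tgrad \<Gamma> \<nu> w x)"
      using ae by eventually_elim (simp add: inner_add_left)
    show "(\<lambda>x. tgrad \<Gamma> \<nu> ?z x \<bullet> tgrad \<Gamma> \<nu> w x) \<in> borel_measurable (surf \<Gamma>)"
      by (intro borel_measurable_inner Z W)
    show "(\<lambda>x. c * (tgrad \<Gamma> \<nu> u x \<bullet> tgrad \<Gamma> \<nu> w x) + d * (tgrad \<Gamma> \<nu> v x \<bullet> tgrad \<Gamma> \<nu> w x))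
      \<in> borel_measurable (surf \<Gamma>)"
      by (intro borel_measurable_add borel_measurable_times borel_measurable_const borel_measurable_inner U V W)
  qed
  also have "\<dots> = c * ip_tgrad \<Gamma> \<nu> u w + d * ip_tgrad \<Gamma> \<nu> v w"
    unfolding ip_tgrad_def
    using integrable_norm_sq_lin(1)[OF U(2) W(2) U(3) W(3)] integrable_norm_sq_lin(1)[OF V(2) W(2) V(3) W(3)]
    by simp
  finally show "ip_tgrad \<Gamma> \<nu> ?z w = c * ip_tgrad \<Gamma> \<nu> u w + d * ip_tgrad \<Gamma> \<nu> v w" .
qed

lemma norm_H1_surf_sq: "(norm_H1_surf \<Gamma> \<nu> v)\<^sup>2 = ip_surf \<Gamma> v v + ip_tgrad \<Gamma> \<nu> v v"
proof -
  have "0 \<le> ip_surf \<Gamma> v v" "0 \<le> ip_tgrad \<Gamma> \<nu> v v"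
    unfolding ip_surf_def ip_tgrad_def by (auto intro!: integral_nonneg_AE)
  then show ?thesis by (simp add: norm_H1_surf_def norm_L2_surf_def)
qed

lemma norm_H1_surf_nonneg: "0 \<le> norm_H1_surf \<Gamma> \<nu> v"
proof -
  have "0 \<le> ip_surf \<Gamma> v v" "0 \<le> ip_tgrad \<Gamma> \<nu> v v"
    unfolding ip_surf_def ip_tgrad_def by (auto intro!: integral_nonneg_AE)
  then show ?thesis by (simp add: norm_H1_surf_def)
qed

subsection \<open>The normal stabilisation\<close>

text \<open>Without convexity, continuity of the closest point map onto a compact set follows from uniqueness
  of the closest point: its graph is closed.\<close>

lemma continuous_on_closest_point_unique:
  fixes \<Gamma> :: "'a::euclidean_space set"
  assumes \<Gamma>: "compact \<Gamma>" "\<Gamma> \<noteq> {}"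
    and uniq: "\<And>x. x \<in> S \<Longrightarrow> \<exists>!y. y \<in> \<Gamma> \<and> (\<forall>z\<in>\<Gamma>. dist x y \<le> dist x z)"
  shows "continuous_on S (closest_point \<Gamma>)"
proof -
  have cl: "closed \<Gamma>" using \<Gamma> by (simp add: compact_imp_closed)
  have cp: "closest_point \<Gamma> x \<in> \<Gamma>" "\<forall>z\<in>\<Gamma>. dist x (closest_point \<Gamma> x) \<le> dist x z" for x
    using closest_point_exists[OF cl \<Gamma>(2)] by auto
  have eq: "(\<lambda>x. (x, closest_point \<Gamma> x)) ` S = (S \<times> \<Gamma>) \<inter> {z. dist (fst z) (snd z) \<le> infdist (fst z) \<Gamma>}"
  proof (intro set_eqI iffI)
    fix z assume "z \<in> (\<lambda>x. (x, closest_point \<Gamma> x)) ` S"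
    then obtain x where x: "x \<in> S" "z = (x, closest_point \<Gamma> x)" by auto
    obtain y where "y \<in> \<Gamma>" "infdist x \<Gamma> = dist x y" using infdist_attains_inf[OF cl \<Gamma>(2)] by metis
    then show "z \<in> (S \<times> \<Gamma>) \<inter> {z. dist (fst z) (snd z) \<le> infdist (fst z) \<Gamma>}"
      using x cp[of x] by simp
  next
    fix z assume z: "z \<in> (S \<times> \<Gamma>) \<inter> {z. dist (fst z) (snd z) \<le> infdist (fst z) \<Gamma>}"
    have "\<forall>w\<in>\<Gamma>. dist (fst z) (snd z) \<le> dist (fst z) w"
    proof
      fix w assume "w \<in> \<Gamma>"
      then show "dist (fst z) (snd z) \<le> dist (fst z) w" using z infdist_le[of w \<Gamma> "fst z"] by simp
    qed
    moreover have "fst z \<in> S" "snd z \<in> \<Gamma>" using z by (auto simp: mem_Times_iff)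
    ultimately have "snd z = closest_point \<Gamma> (fst z)" using uniq[of "fst z"] cp[of "fst z"] by blast
    then show "z \<in> (\<lambda>x. (x, closest_point \<Gamma> x)) ` S" using z by (auto simp: image_iff prod_eq_iff mem_Times_iff)
  qed
  have "closed {z :: 'a \<times> 'a. dist (fst z) (snd z) \<le> infdist (fst z) \<Gamma>}"
    by (intro closed_Collect_le continuous_intros)
  then have "closedin (top_of_set (S \<times> \<Gamma>)) ((\<lambda>x. (x, closest_point \<Gamma> x)) ` S)"
    unfolding eq by (rule closedin_closed_Int)
  then show ?thesis
    using continuous_closed_graph_eq[OF \<Gamma>(1), of "closest_point \<Gamma>" S] cp(1) by auto
qed

lemma continuous_on_unit_normal:
  fixes \<Gamma> :: "'a::euclidean_space set"
  assumes hyp: "closed_C2_hypersurface \<Gamma> \<nu>"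
  shows "continuous_on \<Gamma> \<nu>"
  unfolding continuous_on_def
proof
  fix x assume x: "x \<in> \<Gamma>"
  obtain U and g :: "'a \<Rightarrow> 'a" and H :: "'a \<Rightarrow> 'a \<Rightarrow>\<^sub>L 'a" where U: "open U" "x \<in> U"
    and g: "\<And>y. y \<in> U \<Longrightarrow> (g has_derivative blinfun_apply (H y)) (at y)" "\<And>y. y \<in> U \<Longrightarrow> g y \<noteq> 0"
    and H: "continuous_on U H"
    and \<nu>: "\<And>y. y \<in> \<Gamma> \<Longrightarrow> y \<in> U \<Longrightarrow> \<nu> y = g y /\<^sub>R norm (g y)"
    by (rule closed_C2_hypersurface_chart[OF hyp x]) (rule that)
  have "isCont g x" using g(1)[OF U(2)] by (rule has_derivative_continuous)
  then have "isCont (\<lambda>y. g y /\<^sub>R norm (g y)) x"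
    using g(2)[OF U(2)] by (intro continuous_intros) auto
  then have "((\<lambda>y. g y /\<^sub>R norm (g y)) \<longlongrightarrow> \<nu> x) (at x within \<Gamma>)"
    using \<nu>[OF x U(2)] by (simp add: isCont_def tendsto_within_subset[OF _ subset_UNIV])
  moreover have "\<forall>\<^sub>F y in at x within \<Gamma>. g y /\<^sub>R norm (g y) = \<nu> y"
    unfolding eventually_at_topological
    by (intro exI[of _ U]) (use U \<nu> in auto)
  ultimately show "(\<nu> \<longlongrightarrow> \<nu> x) (at x within \<Gamma>)" by (rule Lim_transform_eventually)
qed

lemma set_integrable_continuous_compact:
  fixes f :: "'a::euclidean_space \<Rightarrow> real"
  assumes "compact K" "continuous_on K f"
  shows "set_integrable lebesgue K f"
proof -
  have "integrable lborel (\<lambda>x. indicator K x *\<^sub>R f x)" by (rule borel_integrable_compact[OF assms])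
  then show ?thesis
    unfolding set_integrable_def by (subst integrable_completion) (auto intro: borel_measurable_integrable)
qed

text \<open>On the interior of an element a finite element function is differentiable, and its normal
  derivative is the restriction of a function that is continuous up to the boundary.  The frontier of
  the element is a null set, so products of normal derivatives are integrable over the element.\<close>

lemma psd_form_s_elem:
  fixes \<Gamma> :: "'a::euclidean_space set"
  assumes hyp: "closed_C2_hypersurface \<Gamma> \<nu>" and mesh: "mesh_around \<Gamma> M"
    and res: "resolves_geometry \<Gamma> \<nu> C M" and fe: "fe_space \<Gamma> \<nu> M V" and K: "K \<in> cut_mesh \<Gamma> M"
  shows "psd_form_on V (s_elem \<Gamma> \<nu> j K)"
proof -
  have \<Gamma>: "compact \<Gamma>" "\<Gamma> \<noteq> {}" using hyp by (auto simp: closed_C2_hypersurface_def)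
  have KM: "K \<in> M" using K by (simp add: cut_mesh_def)
  have Kc: "compact K" "negligible (frontier K)" using mesh KM by (auto simp: mesh_around_def)
  have Kint: "x \<in> interior K" if "x \<in> K - frontier K" for x
    using that Kc by (simp add: frontier_def compact_imp_closed)
  let ?nd = "normal_deriv \<Gamma> \<nu>"
  have "K \<subseteq> cut_region \<Gamma> M" using K by (auto simp: cut_region_def)
  moreover have "\<exists>!y. y \<in> \<Gamma> \<and> (\<forall>z\<in>\<Gamma>. dist x y \<le> dist x z)" if "x \<in> cut_region \<Gamma> M" for x
    using res that unfolding resolves_geometry_def by (elim conjE) (rule bspec)
  ultimately have "continuous_on K (closest_point \<Gamma>)"
    by (intro continuous_on_closest_point_unique[OF \<Gamma>]) blast
  moreover have "closest_point \<Gamma> ` K \<subseteq> \<Gamma>"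
    using closest_point_in_set[OF compact_imp_closed[OF \<Gamma>(1)] \<Gamma>(2)] by auto
  ultimately have \<nu>c: "continuous_on K (\<lambda>x. \<nu> (closest_point \<Gamma> x))"
    using continuous_on_compose2[OF continuous_on_unit_normal[OF hyp]] by blast
  have poly: "\<exists>p. real_polynomial_function p \<and> (\<forall>x\<in>K. v x = p x)" if v: "v \<in> V" for v
    using fe v K unfolding fe_space_def by blast
  have ext: "(v has_derivative p') (at x)"
    if p: "\<forall>x\<in>K. v x = p x" "(p has_derivative p') (at x)" and x: "x \<in> interior K" for v p p' x
    by (rule has_derivative_transform_within_open[OF p(2) open_interior x])
      (use p(1) interior_subset[of K] in \<open>metis subsetD\<close>)
  have diff: "(v has_derivative frechet_derivative v (at x)) (at x)" if v: "v \<in> V" and x: "x \<in> interior K" for v x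
  proof -
    obtain p where p: "real_polynomial_function p" "\<forall>x\<in>K. v x = p x"
      using poly[OF v] by (elim exE conjE) (rule that)
    obtain p' where p': "\<forall>x. (p has_derivative p' x) (at x)"
      using real_polynomial_function_has_derivative[OF p(1)] by (elim exE conjE) (rule that)
    have "v differentiable (at x)" using ext[OF p(2) spec[OF p'] x] by (rule differentiableI)
    then show ?thesis by (simp add: frechet_derivative_works)
  qed
  have nd: "\<exists>n. continuous_on K n \<and> (\<forall>x\<in>interior K. ?nd v x = n x)" if v: "v \<in> V" for v
  proof -
    obtain p where p: "real_polynomial_function p" "\<forall>x\<in>K. v x = p x"
      using poly[OF v] by (elim exE conjE) (rule that)
    obtain p' where p': "\<forall>x. (p has_derivative p' x) (at x)" "\<forall>i. continuous_on UNIV (\<lambda>x. p' x i)"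
      using real_polynomial_function_has_derivative[OF p(1)] by (elim exE conjE) (rule that)
    define n where "n x = (\<Sum>i\<in>Basis. (\<nu> (closest_point \<Gamma> x) \<bullet> i) * p' x i)" for x
    have p'_sum: "p' x w = (\<Sum>i\<in>Basis. (w \<bullet> i) * p' x i)" for x w
    proof -
      have "linear (p' x)" using has_derivative_linear[OF spec[OF p'(1)]] .
      then have "p' x (\<Sum>i\<in>Basis. (w \<bullet> i) *\<^sub>R i) = (\<Sum>i\<in>Basis. (w \<bullet> i) * p' x i)"
        by (simp add: linear_sum linear_scale)
      then show ?thesis by (simp add: euclidean_representation)
    qed
    have "?nd v x = n x" if "x \<in> interior K" for x
    proof -
      have "p' x = frechet_derivative v (at x)"
        by (rule frechet_derivative_at[OF ext[OF p(2) spec[OF p'(1)] that]])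
      then show ?thesis unfolding normal_deriv_def n_def using p'_sum by metis
    qed
    moreover have "continuous_on K n"
      unfolding n_def
      by (intro continuous_on_sum continuous_on_mult continuous_on_inner continuous_on_const \<nu>c
          continuous_on_subset[OF spec[OF p'(2)] subset_UNIV])
    ultimately show ?thesis by blast
  qed
  have nd_lin: "?nd (\<lambda>x. c * u x + d * v x) x = c * ?nd u x + d * ?nd v x"
    if u: "u \<in> V" and v: "v \<in> V" and x: "x \<in> interior K" for u v c d x
  proof -
    have "((\<lambda>x. c * u x + d * v x) has_derivative
        (\<lambda>h. c * frechet_derivative u (at x) h + d * frechet_derivative v (at x) h)) (at x)"
      by (intro has_derivative_add has_derivative_mult_right diff u v x)
    from frechet_derivative_at[OF this] show ?thesis
      unfolding normal_deriv_def by (rule fun_cong[OF sym])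
  qed
  have int: "set_integrable lebesgue K (\<lambda>x. ?nd v x * ?nd w x)" if v: "v \<in> V" and w: "w \<in> V" for v w
  proof -
    obtain n m where n: "continuous_on K n" "\<forall>x\<in>interior K. ?nd v x = n x"
      and m: "continuous_on K m" "\<forall>x\<in>interior K. ?nd w x = m x"
      using nd[OF v] nd[OF w] by blast
    have "set_integrable lebesgue K (\<lambda>x. n x * m x)"
      by (rule set_integrable_continuous_compact[OF Kc(1) continuous_on_mult[OF n(1) m(1)]])
    then show ?thesis
      by (rule absolutely_integrable_spike[OF _ Kc(2)]) (use Kint n(2) m(2) in auto)
  qed
  have Vlin: "fun_subspace V" using fe by (simp add: fe_space_def fun_subspace_def)
  have "psd_form_on V (\<lambda>v w. LINT x:K|lebesgue. ?nd v x * ?nd w x)"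
    unfolding psd_form_on_def
  proof (intro conjI ballI allI)
    show "(LINT x:K|lebesgue. ?nd v x * ?nd w x) = (LINT x:K|lebesgue. ?nd w x * ?nd v x)" for v w
      by (simp add: mult.commute)
    show "0 \<le> (LINT x:K|lebesgue. ?nd v x * ?nd v x)" for v
      unfolding set_lebesgue_integral_def by (rule integral_nonneg_AE) simp
    fix u v w and c d :: real assume u: "u \<in> V" and v: "v \<in> V" and w: "w \<in> V"
    have z: "(\<lambda>x. c * u x + d * v x) \<in> V" by (rule fun_subspace_lin[OF Vlin u v])
    have i: "set_integrable lebesgue K (\<lambda>x. c * (?nd u x * ?nd w x))"
      "set_integrable lebesgue K (\<lambda>x. d * (?nd v x * ?nd w x))"
      using int[OF u w] int[OF v w] by auto
    have "(LINT x:K|lebesgue. ?nd (\<lambda>x. c * u x + d * v x) x * ?nd w x)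
      = integral K (\<lambda>x. ?nd (\<lambda>x. c * u x + d * v x) x * ?nd w x)"
      by (rule set_lebesgue_integral_eq_integral(2)[OF int[OF z w]])
    also have "\<dots> = integral K (\<lambda>x. c * (?nd u x * ?nd w x) + d * (?nd v x * ?nd w x))"
      by (rule integral_spike[OF Kc(2)]) (use Kint nd_lin[OF u v] in \<open>auto simp: algebra_simps\<close>)
    also have "\<dots> = (LINT x:K|lebesgue. c * (?nd u x * ?nd w x) + d * (?nd v x * ?nd w x))"
      by (rule set_lebesgue_integral_eq_integral(2)[symmetric]) (rule set_integral_add(1)[OF i])
    also have "\<dots> = c * (LINT x:K|lebesgue. ?nd u x * ?nd w x) + d * (LINT x:K|lebesgue. ?nd v x * ?nd w x)"
      using set_integral_add(2)[OF i] by simp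
    finally show "(LINT x:K|lebesgue. ?nd (\<lambda>x. c * u x + d * v x) x * ?nd w x)
      = c * (LINT x:K|lebesgue. ?nd u x * ?nd w x) + d * (LINT x:K|lebesgue. ?nd v x * ?nd w x)" .
  qed
  then have "psd_form_on V (\<lambda>v w. diameter K powi (1 - 2 * int j) *
      (LINT x:K|lebesgue. ?nd v x * ?nd w x))"
    by (rule psd_form_cmult[rotated]) (simp add: zero_le_power_int diameter_ge_0 compact_imp_bounded Kc)
  then show ?thesis unfolding s_elem_def[abs_def] .
qed

lemma psd_form_s_form:
  assumes "closed_C2_hypersurface \<Gamma> \<nu>" "mesh_around \<Gamma> M" "resolves_geometry \<Gamma> \<nu> C M" "fe_space \<Gamma> \<nu> M V"
  shows "psd_form_on V (s_form \<Gamma> \<nu> M j)"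
proof -
  have "finite (cut_mesh \<Gamma> M)" using assms(2) by (simp add: mesh_around_def cut_mesh_def)
  then show ?thesis
    unfolding s_form_def[abs_def] by (rule psd_form_finite_sum) (rule psd_form_s_elem[OF assms])
qed

lemma psd_form_a_star:
  assumes "closed_C2_hypersurface \<Gamma> \<nu>" "mesh_around \<Gamma> M" "resolves_geometry \<Gamma> \<nu> C M" "fe_space \<Gamma> \<nu> M V"
  shows "psd_form_on V (a_star \<Gamma> \<nu> M)"
  unfolding a_star_def[abs_def]
  by (rule psd_form_add[OF psd_form_mono[OF psd_form_ip_tgrad[OF assms(1)]] psd_form_s_form[OF assms]])
    (use assms(4) in \<open>simp add: fe_space_def\<close>)

section \<open>The dual norm\<close>

lemma Hm1_bound:
  assumes F: "F \<in> Hm1_surf \<Gamma> \<nu>" and v: "v \<in> H1_surf \<Gamma> \<nu>"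
  shows "\<bar>F v\<bar> \<le> norm_Hm1_surf \<Gamma> \<nu> F * norm_H1_surf \<Gamma> \<nu> v"
proof -
  obtain C where C: "\<And>v. v \<in> H1_surf \<Gamma> \<nu> \<Longrightarrow> \<bar>F v\<bar> \<le> C * norm_H1_surf \<Gamma> \<nu> v"
    using F unfolding Hm1_surf_def by blast
  show ?thesis
  proof (cases "norm_H1_surf \<Gamma> \<nu> v = 0")
    case True
    then show ?thesis using C[OF v] by simp
  next
    case False
    then have p: "0 < norm_H1_surf \<Gamma> \<nu> v" using norm_H1_surf_nonneg[of \<Gamma> \<nu> v] by simp
    let ?S = "SUP v \<in> {v \<in> H1_surf \<Gamma> \<nu>. norm_H1_surf \<Gamma> \<nu> v \<noteq> 0}. ennreal (\<bar>F v\<bar> / norm_H1_surf \<Gamma> \<nu> v)"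
    have "?S \<le> ennreal C"
    proof (rule SUP_least)
      fix w assume w: "w \<in> {v \<in> H1_surf \<Gamma> \<nu>. norm_H1_surf \<Gamma> \<nu> v \<noteq> 0}"
      then have "0 < norm_H1_surf \<Gamma> \<nu> w" using norm_H1_surf_nonneg[of \<Gamma> \<nu> w] by simp
      then show "ennreal (\<bar>F w\<bar> / norm_H1_surf \<Gamma> \<nu> w) \<le> ennreal C"
        using C[of w] w by (intro ennreal_leI) (simp add: divide_le_eq)
    qed
    then have fin: "?S < top" using le_less_trans ennreal_less_top by blast
    have "ennreal (\<bar>F v\<bar> / norm_H1_surf \<Gamma> \<nu> v) \<le> ?S" by (rule SUP_upper) (use v False in simp)
    then have "enn2real (ennreal (\<bar>F v\<bar> / norm_H1_surf \<Gamma> \<nu> v)) \<le> enn2real ?S"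
      by (rule enn2real_mono) (rule fin)
    then have "\<bar>F v\<bar> / norm_H1_surf \<Gamma> \<nu> v \<le> norm_Hm1_surf \<Gamma> \<nu> F"
      using p by (simp add: norm_Hm1_surf_def)
    then show ?thesis using p by (simp add: divide_le_eq)
  qed
qed

text \<open>Functions of vanishing norm do not enter the supremum and need not be tested.\<close>

lemma norm_Hm1_le:
  assumes "0 \<le> C"
    and b: "\<And>v. v \<in> H1_surf \<Gamma> \<nu> \<Longrightarrow> norm_H1_surf \<Gamma> \<nu> v \<noteq> 0 \<Longrightarrow> \<bar>F v\<bar> \<le> C * norm_H1_surf \<Gamma> \<nu> v"
  shows "norm_Hm1_surf \<Gamma> \<nu> F \<le> C"
  unfolding norm_Hm1_surf_def
proof (rule enn2real_leI)
  show "(SUP v \<in> {v \<in> H1_surf \<Gamma> \<nu>. norm_H1_surf \<Gamma> \<nu> v \<noteq> 0}. ennreal (\<bar>F v\<bar> / norm_H1_surf \<Gamma> \<nu> v)) \<le> ennreal C"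
  proof (rule SUP_least)
    fix w assume w: "w \<in> {v \<in> H1_surf \<Gamma> \<nu>. norm_H1_surf \<Gamma> \<nu> v \<noteq> 0}"
    then have "0 < norm_H1_surf \<Gamma> \<nu> w" using norm_H1_surf_nonneg[of \<Gamma> \<nu> w] by simp
    then show "ennreal (\<bar>F w\<bar> / norm_H1_surf \<Gamma> \<nu> w) \<le> ennreal C"
      using b[of w] w by (intro ennreal_leI) (simp add: divide_le_eq)
  qed
qed (rule assms(1))

lemma norm_Hm1_nonneg: "0 \<le> norm_Hm1_surf \<Gamma> \<nu> F" by (simp add: norm_Hm1_surf_def)

lemma fun_subspace_Hm1: "fun_subspace (Hm1_surf \<Gamma> \<nu>)"
  unfolding fun_subspace_def
proof (intro conjI ballI allI)
  show "(\<lambda>v. 0) \<in> Hm1_surf \<Gamma> \<nu>" unfolding Hm1_surf_def by (auto intro!: exI[of _ 0])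
  fix F G and c d :: real assume F: "F \<in> Hm1_surf \<Gamma> \<nu>" and G: "G \<in> Hm1_surf \<Gamma> \<nu>"
  let ?N = "norm_H1_surf \<Gamma> \<nu>"
  have lin: "F (\<lambda>x. a * v x + b * w x) = a * F v + b * F w" "G (\<lambda>x. a * v x + b * w x) = a * G v + b * G w"
    if "v \<in> H1_surf \<Gamma> \<nu>" "w \<in> H1_surf \<Gamma> \<nu>" for v w a b
    using F G that unfolding Hm1_surf_def by auto
  have bd: "\<bar>c * F v + d * G v\<bar> \<le> (\<bar>c\<bar> * norm_Hm1_surf \<Gamma> \<nu> F + \<bar>d\<bar> * norm_Hm1_surf \<Gamma> \<nu> G) * ?N v"
    if v: "v \<in> H1_surf \<Gamma> \<nu>" for v
  proof -
    have "\<bar>c * F v + d * G v\<bar> \<le> \<bar>c\<bar> * \<bar>F v\<bar> + \<bar>d\<bar> * \<bar>G v\<bar>"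
      using abs_triangle_ineq[of "c * F v" "d * G v"] by (simp add: abs_mult)
    also have "\<dots> \<le> \<bar>c\<bar> * (norm_Hm1_surf \<Gamma> \<nu> F * ?N v) + \<bar>d\<bar> * (norm_Hm1_surf \<Gamma> \<nu> G * ?N v)"
      by (intro add_mono mult_left_mono Hm1_bound F G v) auto
    finally show ?thesis by (simp add: algebra_simps)
  qed
  show "(\<lambda>v. c * F v + d * G v) \<in> Hm1_surf \<Gamma> \<nu>"
    unfolding Hm1_surf_def mem_Collect_eq
  proof (intro conjI ballI allI exI)
    show "c * F (\<lambda>x. a * v x + b * w x) + d * G (\<lambda>x. a * v x + b * w x)
      = a * (c * F v + d * G v) + b * (c * F w + d * G w)"
      if "v \<in> H1_surf \<Gamma> \<nu>" "w \<in> H1_surf \<Gamma> \<nu>" for v w a b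
      using lin[OF that] by (simp add: algebra_simps)
  qed (rule bd)
qed

lemma norm_Hm1_triangle:
  assumes F: "F \<in> Hm1_surf \<Gamma> \<nu>" and G: "G \<in> Hm1_surf \<Gamma> \<nu>"
  shows "\<bar>norm_Hm1_surf \<Gamma> \<nu> F - norm_Hm1_surf \<Gamma> \<nu> G\<bar> \<le> norm_Hm1_surf \<Gamma> \<nu> (\<lambda>v. F v - G v)"
proof -
  let ?N = "norm_H1_surf \<Gamma> \<nu>"
  let ?D = "norm_Hm1_surf \<Gamma> \<nu> (\<lambda>v. F v - G v)"
  have D: "\<bar>F v - G v\<bar> \<le> ?D * ?N v" if "v \<in> H1_surf \<Gamma> \<nu>" for v
    by (rule Hm1_bound[OF fun_subspace_diff[OF fun_subspace_Hm1 F G] that])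
  have "norm_Hm1_surf \<Gamma> \<nu> F \<le> norm_Hm1_surf \<Gamma> \<nu> G + ?D"
  proof (rule norm_Hm1_le)
    fix v assume v: "v \<in> H1_surf \<Gamma> \<nu>"
    show "\<bar>F v\<bar> \<le> (norm_Hm1_surf \<Gamma> \<nu> G + ?D) * ?N v"
      using D[OF v] Hm1_bound[OF G v] by (simp add: algebra_simps abs_le_iff)
  qed (simp add: norm_Hm1_nonneg)
  moreover have "norm_Hm1_surf \<Gamma> \<nu> G \<le> norm_Hm1_surf \<Gamma> \<nu> F + ?D"
  proof (rule norm_Hm1_le)
    fix v assume v: "v \<in> H1_surf \<Gamma> \<nu>"
    show "\<bar>G v\<bar> \<le> (norm_Hm1_surf \<Gamma> \<nu> F + ?D) * ?N v"
      using D[OF v] Hm1_bound[OF F v] by (simp add: algebra_simps abs_le_iff)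
  qed (simp add: norm_Hm1_nonneg)
  ultimately show ?thesis by simp
qed

lemma L2_to_Hm1_bound:
  assumes z: "z \<in> L2_surf \<Gamma>" and v: "v \<in> H1_surf \<Gamma> \<nu>"
  shows "\<bar>L2_to_Hm1 \<Gamma> z v\<bar> \<le> norm_L2_surf \<Gamma> z * norm_H1_surf \<Gamma> \<nu> v"
proof -
  have v2: "v \<in> L2_surf \<Gamma>" using v H1_surf_subset_L2 by blast
  have "0 \<le> ip_tgrad \<Gamma> \<nu> v v" unfolding ip_tgrad_def by (auto intro!: integral_nonneg_AE)
  then have "ip_surf \<Gamma> v v \<le> (norm_H1_surf \<Gamma> \<nu> v)\<^sup>2" by (simp add: norm_H1_surf_sq)
  then have le: "sqrt (ip_surf \<Gamma> v v) \<le> norm_H1_surf \<Gamma> \<nu> v"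
    using norm_H1_surf_nonneg by (rule real_le_lsqrt[rotated])
  have "\<bar>ip_surf \<Gamma> z v\<bar> \<le> sqrt (ip_surf \<Gamma> z z) * sqrt (ip_surf \<Gamma> v v)"
    by (rule psd_form_Cauchy_Schwarz[OF fun_subspace_L2_surf psd_form_ip_surf z v2])
  also have "\<dots> \<le> sqrt (ip_surf \<Gamma> z z) * norm_H1_surf \<Gamma> \<nu> v"
    by (rule mult_left_mono[OF le]) (simp add: psd_form_nonneg[OF psd_form_ip_surf z])
  finally show ?thesis by (simp add: L2_to_Hm1_def norm_L2_surf_def)
qed

lemma L2_to_Hm1_mem:
  assumes z: "z \<in> L2_surf \<Gamma>"
  shows "L2_to_Hm1 \<Gamma> z \<in> Hm1_surf \<Gamma> \<nu>"
  unfolding Hm1_surf_def mem_Collect_eq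
proof (intro conjI ballI allI exI)
  show "L2_to_Hm1 \<Gamma> z (\<lambda>x. a * v x + b * w x) = a * L2_to_Hm1 \<Gamma> z v + b * L2_to_Hm1 \<Gamma> z w"
    if "v \<in> H1_surf \<Gamma> \<nu>" "w \<in> H1_surf \<Gamma> \<nu>" for v w a b
    unfolding L2_to_Hm1_def using that H1_surf_subset_L2
    by (intro psd_form_lin_right[OF fun_subspace_L2_surf psd_form_ip_surf] z) auto
qed (rule L2_to_Hm1_bound[OF z])

section \<open>Functions of time with values in a function space\<close>

lemma set_integral_lebesgue_on:
  fixes f :: "real \<Rightarrow> real"
  assumes "S \<in> sets lebesgue"
  shows "(LINT t:S|lebesgue. f t) = integral\<^sup>L (lebesgue_on S) f"
    "set_integrable lebesgue S f \<longleftrightarrow> integrable (lebesgue_on S) f"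
  using integral_restrict_space[of S lebesgue f] integrable_restrict_space[of S lebesgue f] assms
  by (simp_all add: set_lebesgue_integral_def set_integrable_def)

lemma integrable_const_open_interval: "integrable (lebesgue_on {0<..<T}) (\<lambda>t::real. c :: real)"
proof -
  have "set_integrable lebesgue {0<..<T} (\<lambda>t. c)"
    by (rule set_integrable_continuous_open_interval(1)) simp
  then show ?thesis by (subst set_integral_lebesgue_on(2)[symmetric]) simp_all
qed

lemma integrable_if_square_integrable:
  fixes f :: "real \<Rightarrow> real"
  assumes "f \<in> borel_measurable (lebesgue_on {0<..<T})" "integrable (lebesgue_on {0<..<T}) (\<lambda>t. (f t)\<^sup>2)"
  shows "integrable (lebesgue_on {0<..<T}) f"
proof -
  have "integrable (lebesgue_on {0<..<T}) (\<lambda>t. 1 :: real)"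
    by (rule integrable_const_open_interval)
  then have "integrable (lebesgue_on {0<..<T}) (\<lambda>t. (1 :: real)\<^sup>2)" by simp
  from integrable_product_of_squares[OF assms(1) borel_measurable_const assms(2) this]
  show ?thesis by simp
qed

lemma time_L2_mem: "f \<in> time_L2 T X N \<Longrightarrow> t \<in> {0<..<T} \<Longrightarrow> f t \<in> X"
  unfolding time_L2_def by blast

lemma time_L2_integrable: "f \<in> time_L2 T X N \<Longrightarrow> integrable (lebesgue_on {0<..<T}) (\<lambda>t. (N (f t))\<^sup>2)"
  unfolding time_L2_def by blast

text \<open>A Lipschitz functional of a strongly measurable function is measurable, as an almost everywhere
  limit of simple functions.\<close>

lemma time_L2_measurable:
  assumes f: "f \<in> time_L2 T X N"
    and g: "\<And>x y. x \<in> X \<Longrightarrow> y \<in> X \<Longrightarrow> \<bar>g x - g y\<bar> \<le> C * N (\<lambda>z. x z - y z)"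
  shows "(\<lambda>t. g (f t) :: real) \<in> borel_measurable (lebesgue_on {0<..<T})"
proof -
  obtain s where s: "\<And>k. simple_function (lebesgue_on {0<..<T}) (s k)" "\<And>k t. t \<in> {0<..<T} \<Longrightarrow> s k t \<in> X"
    and lim: "AE t in lebesgue_on {0<..<T}. (\<lambda>k. N (\<lambda>y. s k t y - f t y)) \<longlonglongrightarrow> 0"
    and X: "\<And>t. t \<in> {0<..<T} \<Longrightarrow> f t \<in> X"
    using f unfolding time_L2_def by blast
  show ?thesis
  proof (rule borel_measurable_lebesgue_on_AE_limit)
    show "(\<lambda>t. g (s k t)) \<in> borel_measurable (lebesgue_on {0<..<T})" for k
      by (rule borel_measurable_simple_function[OF simple_function_compose1[OF s(1)]])
    show "AE t in lebesgue_on {0<..<T}. (\<lambda>k. g (s k t)) \<longlonglongrightarrow> g (f t)"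
      using lim AE_space
    proof eventually_elim
      case (elim t)
      then have t: "t \<in> {0<..<T}" by simp
      show ?case
      proof (rule LIM_zero_cancel, rule Lim_null_comparison)
        show "\<forall>\<^sub>F k in sequentially. norm (g (s k t) - g (f t)) \<le> C * N (\<lambda>y. s k t y - f t y)"
          using g[OF s(2)[OF t] X[OF t]] by simp
        show "(\<lambda>k. C * N (\<lambda>y. s k t y - f t y)) \<longlonglongrightarrow> 0"
          using tendsto_mult[OF tendsto_const elim(1), of C] by simp
      qed
    qed
  qed simp
qed

text \<open>Image of \<open>L\<^sup>2(I; X)\<close> under a Lipschitz map of linear growth between seminormed function spaces.\<close>

lemma time_L2_map:
  assumes f: "f \<in> time_L2 T X N" and \<Phi>: "\<And>x. x \<in> X \<Longrightarrow> \<Phi> x \<in> Y"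
    and lip: "\<And>x y. x \<in> X \<Longrightarrow> y \<in> X \<Longrightarrow> N' (\<lambda>z. \<Phi> x z - \<Phi> y z) \<le> C * N (\<lambda>z. x z - y z)"
    and tri: "\<And>x y. x \<in> Y \<Longrightarrow> y \<in> Y \<Longrightarrow> \<bar>N' x - N' y\<bar> \<le> N' (\<lambda>z. x z - y z)"
    and grow: "\<And>x. x \<in> X \<Longrightarrow> N' (\<Phi> x) \<le> C * N x" and nn: "\<And>y. 0 \<le> N' y"
  shows "(\<lambda>t. \<Phi> (f t)) \<in> time_L2 T Y N'"
proof -
  obtain s where s: "\<And>k. simple_function (lebesgue_on {0<..<T}) (s k)" "\<And>k t. t \<in> {0<..<T} \<Longrightarrow> s k t \<in> X"
    and lim: "AE t in lebesgue_on {0<..<T}. (\<lambda>k. N (\<lambda>y. s k t y - f t y)) \<longlonglongrightarrow> 0"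
    and X: "\<And>t. t \<in> {0<..<T} \<Longrightarrow> f t \<in> X"
    and int: "integrable (lebesgue_on {0<..<T}) (\<lambda>t. (N (f t))\<^sup>2)"
    using f unfolding time_L2_def by blast
  have m: "(\<lambda>t. N' (\<Phi> (f t))) \<in> borel_measurable (lebesgue_on {0<..<T})"
    by (rule time_L2_measurable[OF f, where g = "\<lambda>x. N' (\<Phi> x)"]) (rule order_trans[OF tri[OF \<Phi> \<Phi>] lip])
  have "AE t in lebesgue_on {0<..<T}. (\<lambda>k. N' (\<lambda>y. \<Phi> (s k t) y - \<Phi> (f t) y)) \<longlonglongrightarrow> 0"
    using lim AE_space
  proof eventually_elim
    case (elim t)
    then have t: "t \<in> {0<..<T}" by simp
    show ?case
    proof (rule Lim_null_comparison)
      show "\<forall>\<^sub>F k in sequentially. norm (N' (\<lambda>y. \<Phi> (s k t) y - \<Phi> (f t) y)) \<le> C * N (\<lambda>y. s k t y - f t y)"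
        using lip[OF s(2)[OF t] X[OF t]] nn by simp
      show "(\<lambda>k. C * N (\<lambda>y. s k t y - f t y)) \<longlonglongrightarrow> 0"
        using tendsto_mult[OF tendsto_const elim(1), of C] by simp
    qed
  qed
  moreover have "integrable (lebesgue_on {0<..<T}) (\<lambda>t. (N' (\<Phi> (f t)))\<^sup>2)"
  proof (rule Bochner_Integration.integrable_bound[OF integrable_mult_right[OF int, of "C\<^sup>2"]])
    show "(\<lambda>t. (N' (\<Phi> (f t)))\<^sup>2) \<in> borel_measurable (lebesgue_on {0<..<T})" using m by simp
    show "AE t in lebesgue_on {0<..<T}. norm ((N' (\<Phi> (f t)))\<^sup>2) \<le> norm (C\<^sup>2 * (N (f t))\<^sup>2)"
      using AE_space
    proof eventually_elim
      case (elim t)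
      then have "(N' (\<Phi> (f t)))\<^sup>2 \<le> (C * N (f t))\<^sup>2" by (intro power_mono grow X nn) simp
      then show ?case by (simp add: power_mult_distrib)
    qed
  qed
  moreover have "simple_function (lebesgue_on {0<..<T}) (\<lambda>t. \<Phi> (s k t))" for k
    by (rule simple_function_compose1[OF s(1)])
  ultimately show ?thesis
    unfolding time_L2_def using \<Phi> X s(2) by (intro CollectI conjI ballI exI[of _ "\<lambda>k t. \<Phi> (s k t)"] allI) auto
qed

lemma time_L2_form_measurable:
  assumes V: "fun_subspace V" and ip: "psd_form_on V ip"
    and u: "u \<in> time_L2 T V (\<lambda>v. sqrt (ip v v))" and w: "w \<in> V"
  shows "(\<lambda>t. ip (u t) w) \<in> borel_measurable (lebesgue_on {0<..<T})"
proof (rule time_L2_measurable[OF u, where C = "sqrt (ip w w)"])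
  fix x y assume x: "x \<in> V" "y \<in> V"
  have "\<bar>ip (\<lambda>z. x z - y z) w\<bar> \<le> sqrt (ip (\<lambda>z. x z - y z) (\<lambda>z. x z - y z)) * sqrt (ip w w)"
    by (rule psd_form_Cauchy_Schwarz[OF V ip fun_subspace_diff[OF V x] w])
  then show "\<bar>ip x w - ip y w\<bar> \<le> sqrt (ip w w) * sqrt (ip (\<lambda>z. x z - y z) (\<lambda>z. x z - y z))"
    using psd_form_diff[OF ip x w] by (simp add: mult.commute)
qed

lemma time_L2_form_square_integrable:
  assumes V: "fun_subspace V" and ip: "psd_form_on V ip"
    and u: "u \<in> time_L2 T V (\<lambda>v. sqrt (ip v v))" and w: "w \<in> V"
  shows "integrable (lebesgue_on {0<..<T}) (\<lambda>t. (ip (u t) w)\<^sup>2)"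
proof (rule Bochner_Integration.integrable_bound)
  show "integrable (lebesgue_on {0<..<T}) (\<lambda>t. ip w w * (sqrt (ip (u t) (u t)))\<^sup>2)"
    using u unfolding time_L2_def by simp
  show "(\<lambda>t. (ip (u t) w)\<^sup>2) \<in> borel_measurable (lebesgue_on {0<..<T})"
    using time_L2_form_measurable[OF assms] by simp
  show "AE t in lebesgue_on {0<..<T}. norm ((ip (u t) w)\<^sup>2) \<le> norm (ip w w * (sqrt (ip (u t) (u t)))\<^sup>2)"
    using AE_space
  proof eventually_elim
    case (elim t)
    then have ut: "u t \<in> V" using u by (simp add: time_L2_def)
    have "\<bar>ip (u t) w\<bar>\<^sup>2 \<le> (sqrt (ip (u t) (u t)) * sqrt (ip w w))\<^sup>2"
      by (intro power_mono psd_form_Cauchy_Schwarz[OF V ip ut w]) simp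
    then show ?case
      using psd_form_nonneg[OF ip w] by (simp add: power_mult_distrib mult.commute)
  qed
qed

lemma time_L2_form_integrable:
  assumes V: "fun_subspace V" and ip: "psd_form_on V ip" and E: "onb_on V ip E" and a: "psd_form_on V a"
    and u: "u \<in> time_L2 T V (\<lambda>v. sqrt (ip v v))" and g: "g \<in> time_L2 T V (\<lambda>v. sqrt (ip v v))"
  shows "integrable (lebesgue_on {0<..<T}) (\<lambda>t. a (u t) (g t))"
proof -
  have sub: "\<And>e. e \<in> E \<Longrightarrow> e \<in> V" using E by (auto simp: onb_on_def)
  have "integrable (lebesgue_on {0<..<T}) (\<lambda>t. \<Sum>e\<in>E. \<Sum>e'\<in>E. ip (u t) e * ip (g t) e' * a e e')"
    by (intro Bochner_Integration.integrable_sum integrable_mult_left integrable_product_of_squares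
        time_L2_form_measurable[OF V ip] time_L2_form_square_integrable[OF V ip] u g sub)
  moreover have "a (u t) (g t) = (\<Sum>e\<in>E. \<Sum>e'\<in>E. ip (u t) e * ip (g t) e' * a e e')"
    if "t \<in> space (lebesgue_on {0<..<T})" for t
    using that u g by (intro onb_on_form_expand2[OF V a E]) (simp_all add: time_L2_def)
  ultimately show ?thesis
    using Bochner_Integration.integrable_cong[OF refl, of "lebesgue_on {0<..<T}"] by (metis (no_types, lifting))
qed

text \<open>The test functions that localise a variational equation in time.\<close>

lemma time_L2_const_on:
  assumes V: "fun_subspace V" and ip: "psd_form_on V ip" and w: "w \<in> V" and A: "A \<in> sets (lebesgue_on {0<..<T})"
  shows "(\<lambda>t. if t \<in> A then w else (\<lambda>x. 0)) \<in> time_L2 T V (\<lambda>v. sqrt (ip v v))"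
proof -
  let ?v = "\<lambda>t. if t \<in> A then w else (\<lambda>x. 0)"
  have z: "ip (\<lambda>x. 0) (\<lambda>x. 0) = 0" by (rule psd_form_zero[OF V ip fun_subspace_zero[OF V]])
  have simple: "simple_function (lebesgue_on {0<..<T}) ?v"
    using A by (intro simple_function_If_set) auto
  have eq: "(\<lambda>t. (sqrt (ip (?v t) (?v t)))\<^sup>2) = (\<lambda>t. indicator A t * ip w w)"
    using z psd_form_nonneg[OF ip w] by (auto simp: indicator_def)
  have one: "integrable (lebesgue_on {0<..<T}) (\<lambda>t. 1 :: real)"
    by (rule integrable_const_open_interval)
  have "integrable (lebesgue_on {0<..<T}) (indicator A :: real \<Rightarrow> real)"
    using integrable_mult_indicator[OF A one] by simp
  then have "integrable (lebesgue_on {0<..<T}) (\<lambda>t. (sqrt (ip (?v t) (?v t)))\<^sup>2)"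
    unfolding eq by simp
  moreover have "\<forall>t\<in>{0<..<T}. ?v t \<in> V" using w fun_subspace_zero[OF V] by simp
  moreover have "AE t in lebesgue_on {0<..<T}.
      (\<lambda>k::nat. sqrt (ip (\<lambda>y. ?v t y - ?v t y) (\<lambda>y. ?v t y - ?v t y))) \<longlonglongrightarrow> 0"
    using z by simp
  ultimately show ?thesis
    unfolding time_L2_def using simple by (intro CollectI conjI exI[of _ "\<lambda>k. ?v"] allI) auto
qed

section \<open>The energy estimate\<close>

text \<open>The chain rule for the squared norm, coordinatewise in an orthonormal basis.\<close>

lemma time_H1_norm_square:
  assumes V: "fun_subspace V" and ip: "inner_product_on V ip" and E: "onb_on V ip E" and T: "0 < T"
    and u: "u \<in> time_H1 T V ip" and g: "has_weak_tderiv T V ip u g"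
  shows "continuous_on {0..T} (\<lambda>t. ip (u t) (u t))"
    and "t \<in> {0..T} \<Longrightarrow> ip (u t) (u t) = ip (u 0) (u 0) + 2 * (LINT s:{0<..<t}|lebesgue. ip (g s) (u s))"
proof -
  note psd = inner_product_on_psd[OF V ip]
  have sub: "\<And>e. e \<in> E \<Longrightarrow> e \<in> V" and fin: "finite E" using E by (auto simp: onb_on_def)
  have uV: "u t \<in> V" if "t \<in> {0..T}" for t using u that by (simp add: time_H1_def)
  have gL: "g \<in> time_L2 T V (\<lambda>v. sqrt (ip v v))" using g by (simp add: has_weak_tderiv_def)
  have gV: "g t \<in> V" if "t \<in> {0<..<T}" for t using gL that by (simp add: time_L2_def)
  have c: "continuous_on {0..T} (\<lambda>t. ip (u t) e)" if e: "e \<in> E" for e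
    unfolding continuous_on_def
  proof
    fix t assume t: "t \<in> {0..T}"
    have lim: "((\<lambda>r. sqrt (ip (\<lambda>x. u r x - u t x) (\<lambda>x. u r x - u t x))) \<longlongrightarrow> 0) (at t within {0..T})"
      using u t by (simp add: time_H1_def Let_def)
    have ev: "\<forall>\<^sub>F r in at t within {0..T}. r \<in> {0..T}" by (simp add: eventually_at_filter)
    show "((\<lambda>t. ip (u t) e) \<longlongrightarrow> ip (u t) e) (at t within {0..T})"
    proof (rule LIM_zero_cancel, rule Lim_null_comparison[OF _ lim])
      show "\<forall>\<^sub>F r in at t within {0..T}. norm (ip (u r) e - ip (u t) e)
        \<le> sqrt (ip (\<lambda>x. u r x - u t x) (\<lambda>x. u r x - u t x))"
        using ev
      proof eventually_elim
        case (elim r)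
        have "ip (u r) e - ip (u t) e = ip (\<lambda>x. u r x - u t x) e"
          using psd_form_diff[OF psd uV[OF elim] uV[OF t] sub[OF e]] by simp
        then show ?case
          using onb_on_coeff_le[OF V psd E fun_subspace_diff[OF V uV[OF elim] uV[OF t]] e] by simp
      qed
    qed
  qed
  have y: "ip (u t) (u t) = (\<Sum>e\<in>E. (ip (u t) e)\<^sup>2)" if "t \<in> {0..T}" for t
    using onb_on_parseval[OF V psd E uV[OF that] uV[OF that]] by (simp add: power2_eq_square)
  show "continuous_on {0..T} (\<lambda>t. ip (u t) (u t))"
    by (rule continuous_on_eq[of _ "\<lambda>t. \<Sum>e\<in>E. (ip (u t) e)\<^sup>2"])
      (use y c in \<open>auto intro!: continuous_on_sum continuous_on_power\<close>)
  have di: "set_integrable lebesgue {0<..<T} (\<lambda>t. ip (g t) e)" if "e \<in> E" for e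
    unfolding set_integral_lebesgue_on(2)[OF lmeasurable_interval(2)[THEN fmeasurableD], simplified]
    using that
    by (simp add: set_integral_lebesgue_on integrable_if_square_integrable
        time_L2_form_measurable[OF V psd gL sub] time_L2_form_square_integrable[OF V psd gL sub])
  have ci: "ip (u t) e = ip (u 0) e + (LINT s:{0<..<t}|lebesgue. ip (g s) e)" if "t \<in> {0..T}" "e \<in> E" for t e
  proof (rule weak_derivative_integral[OF T c[OF that(2)] di[OF that(2)] _ that(1)])
    fix \<phi> \<phi>' assume "C1_compact_support T \<phi> \<phi>'"
    then show "(LINT t:{0<..<T}|lebesgue. ip (u t) e * \<phi>' t) = - (LINT t:{0<..<T}|lebesgue. ip (g t) e * \<phi> t)"
      using g sub[OF that(2)] unfolding has_weak_tderiv_def by blast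
  qed
  assume t: "t \<in> {0..T}"
  have sub_t: "set_integrable lebesgue {0<..<t} f" if "set_integrable lebesgue {0<..<T} f" for f :: "real \<Rightarrow> real"
    by (rule set_integrable_subset[OF that]) (use t in auto)
  have sq: "(ip (u t) e)\<^sup>2 = (ip (u 0) e)\<^sup>2 + 2 * (LINT s:{0<..<t}|lebesgue. ip (u s) e * ip (g s) e)" if "e \<in> E" for e
    by (rule square_of_integral[OF _ sub_t[OF di[OF that]] ci[OF _ that]]) (use t in auto)
  have uL: "u \<in> time_L2 T V (\<lambda>v. sqrt (ip v v))" using u by (simp add: time_H1_def)
  have pi: "set_integrable lebesgue {0<..<t} (\<lambda>s. ip (u s) e * ip (g s) e)" if "e \<in> E" for e
    by (rule sub_t)
      (simp add: set_integral_lebesgue_on integrable_product_of_squares that sub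
        time_L2_form_measurable[OF V psd gL] time_L2_form_square_integrable[OF V psd gL]
        time_L2_form_measurable[OF V psd uL] time_L2_form_square_integrable[OF V psd uL])
  have "ip (u t) (u t) = (\<Sum>e\<in>E. (ip (u 0) e)\<^sup>2 + 2 * (LINT s:{0<..<t}|lebesgue. ip (u s) e * ip (g s) e))"
    unfolding y[OF t] by (rule sum.cong[OF refl sq])
  also have "\<dots> = ip (u 0) (u 0) + 2 * (\<Sum>e\<in>E. LINT s:{0<..<t}|lebesgue. ip (u s) e * ip (g s) e)"
    using y[of 0] T by (simp add: sum.distrib sum_distrib_left)
  also have "(\<Sum>e\<in>E. LINT s:{0<..<t}|lebesgue. ip (u s) e * ip (g s) e)
    = (LINT s:{0<..<t}|lebesgue. \<Sum>e\<in>E. ip (u s) e * ip (g s) e)"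
    unfolding set_lebesgue_integral_def scaleR_sum_right
    by (rule Bochner_Integration.integral_sum[symmetric]) (use pi in \<open>simp add: set_integrable_def\<close>)
  also have "\<dots> = (LINT s:{0<..<t}|lebesgue. ip (g s) (u s))"
  proof (rule set_lebesgue_integral_cong)
    show "{0<..<t} \<in> sets lebesgue" by simp
    show "\<forall>s. s \<in> {0<..<t} \<longrightarrow> (\<Sum>e\<in>E. ip (u s) e * ip (g s) e) = ip (g s) (u s)"
      using t onb_on_parseval[OF V psd E gV uV] by (auto simp: mult.commute)
  qed
  finally show "ip (u t) (u t) = ip (u 0) (u 0) + 2 * (LINT s:{0<..<t}|lebesgue. ip (g s) (u s))" .
qed

text \<open>The form \<open>a\<close> need not be coercive.  The missing part of the norm is absorbed through the maximum
  \<open>Y\<close> of \<open>\<parallel>u(t)\<parallel>\<^sup>2\<close>: on an interval of length \<open>T\<close> the term \<open>Y / (2 T)\<close> integrates to at most \<open>Y / 2\<close>.\<close>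

lemma energy_estimate:
  assumes V: "fun_subspace V" and ip: "inner_product_on V ip" and E: "onb_on V ip E" and T: "0 < T"
    and a: "psd_form_on V a"
    and u: "u \<in> time_H1 T V ip" and g: "has_weak_tderiv T V ip u g"
    and n: "set_integrable lebesgue {0<..<T} (\<lambda>t. (n t)\<^sup>2)" "\<And>t. 0 \<le> n t"
    and eq: "AE t in lebesgue_on {0<..<T}.
      ip (g t) (u t) + a (u t) (u t) \<le> n t * (sqrt (ip (u t) (u t)) + sqrt (a (u t) (u t)))"
  shows "(LINT t:{0<..<T}|lebesgue. a (u t) (u t))
    \<le> 2 * (ip (u 0) (u 0) + (1 + 2 * T) * (LINT t:{0<..<T}|lebesgue. (n t)\<^sup>2))"
proof -
  note psd = inner_product_on_psd[OF V ip]
  have uL: "u \<in> time_L2 T V (\<lambda>v. sqrt (ip v v))" using u by (simp add: time_H1_def)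
  have gL: "g \<in> time_L2 T V (\<lambda>v. sqrt (ip v v))" using g by (simp add: has_weak_tderiv_def)
  have uV: "u t \<in> V" if "t \<in> {0..T}" for t using u that by (simp add: time_H1_def)
  let ?y = "\<lambda>t. ip (u t) (u t)"
  let ?a = "\<lambda>t. a (u t) (u t)"
  note yc = time_H1_norm_square(1)[OF V ip E T u g] and yt = time_H1_norm_square(2)[OF V ip E T u g]
  obtain t1 where t1: "t1 \<in> {0..T}" "\<And>t. t \<in> {0..T} \<Longrightarrow> ?y t \<le> ?y t1"
    using continuous_attains_sup[OF compact_Icc _ yc] T by auto
  define Y where "Y = ?y t1"
  have Y: "0 \<le> Y" unfolding Y_def by (rule psd_form_nonneg[OF psd uV[OF t1(1)]])
  define \<Phi> where "\<Phi> = (LINT t:{0<..<T}|lebesgue. (n t)\<^sup>2)"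
  have ai: "set_integrable lebesgue {0<..<T} ?a"
    by (simp add: set_integral_lebesgue_on time_L2_form_integrable[OF V psd E a uL uL])
  have gi: "set_integrable lebesgue {0<..<T} (\<lambda>t. ip (g t) (u t))"
    by (simp add: set_integral_lebesgue_on time_L2_form_integrable[OF V psd E psd gL uL])
  have "AE t in lebesgue. t \<in> {0<..<T} \<longrightarrow>
      ip (g t) (u t) + a (u t) (u t) \<le> n t * (sqrt (ip (u t) (u t)) + sqrt (a (u t) (u t)))"
    using eq by (simp add: AE_restrict_space_iff)
  then have pt: "AE t in lebesgue. t \<in> {0<..<T} \<longrightarrow>
      2 * ip (g t) (u t) \<le> - ?a t + ((1 + 2 * T) * (n t)\<^sup>2 + Y / (2 * T))"
  proof eventually_elim
    case (elim t)
    show ?case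
    proof
      assume t: "t \<in> {0<..<T}"
      then have ut: "u t \<in> V" "?y t \<le> Y" using uV t1(2) by (auto simp: Y_def)
      have nn: "0 \<le> ?y t" "0 \<le> ?a t" using psd_form_nonneg[OF psd ut(1)] psd_form_nonneg[OF a ut(1)] by auto
      \<comment> \<open>Young's inequality for the two parts of \<open>n (\<surd>y + \<surd>a)\<close>; the weight \<open>2 T\<close> in the second one
        makes \<open>y\<close> appear with the factor \<open>1 / (2 T)\<close>.\<close>
      have "0 \<le> (n t - sqrt (?a t))\<^sup>2" by simp
      then have 1: "2 * (n t * sqrt (?a t)) \<le> (n t)\<^sup>2 + ?a t"
        using nn by (simp add: power2_diff)
      have "0 \<le> (2 * T * n t - sqrt (?y t))\<^sup>2" by simp
      then have "2 * (2 * T * n t) * sqrt (?y t) \<le> (2 * T * n t)\<^sup>2 + Y"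
        using nn ut(2) by (simp add: power2_diff)
      then have "(2 * T) * (2 * (n t * sqrt (?y t))) \<le> (2 * T) * (2 * T * (n t)\<^sup>2 + Y / (2 * T))"
        using T by (simp add: power2_eq_square algebra_simps)
      then have 2: "2 * (n t * sqrt (?y t)) \<le> 2 * T * (n t)\<^sup>2 + Y / (2 * T)"
        using T by (simp add: mult_le_cancel_left_pos)
      have "2 * ip (g t) (u t) \<le> 2 * (n t * sqrt (?y t)) + 2 * (n t * sqrt (?a t)) - 2 * ?a t"
        using elim t by (simp add: algebra_simps)
      then show "2 * ip (g t) (u t) \<le> - ?a t + ((1 + 2 * T) * (n t)\<^sup>2 + Y / (2 * T))"
        using 1 2 by (simp add: algebra_simps)
    qed
  qed
  have main: "?y t + (LINT s:{0<..<t}|lebesgue. ?a s) \<le> ?y 0 + (1 + 2 * T) * \<Phi> + Y / 2"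
    if t: "t \<in> {0..T}" for t
  proof -
    have sub_t: "set_integrable lebesgue {0<..<t} f" if "set_integrable lebesgue {0<..<T} f" for f :: "real \<Rightarrow> real"
      by (rule set_integrable_subset[OF that]) (use t in auto)
    have ci: "set_integrable lebesgue {0<..<t} (\<lambda>s. Y / (2 * T))"
      by (rule set_integrable_continuous_open_interval(1)) simp
    have cI: "(LINT s:{0<..<t}|lebesgue. Y / (2 * T)) = t * (Y / (2 * T))"
      using set_integrable_continuous_open_interval(2)[OF continuous_on_const, of t "Y / (2 * T)"] t by simp
    have ni: "set_integrable lebesgue {0<..<t} (\<lambda>s. (1 + 2 * T) * (n s)\<^sup>2)"
      using sub_t[OF n(1)] by simp
    have am: "set_integrable lebesgue {0<..<t} (\<lambda>s. - ?a s)"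
      using sub_t[OF ai] by (simp add: set_integrable_def)
    have am_eq: "(LINT s:{0<..<t}|lebesgue. - ?a s) = - (LINT s:{0<..<t}|lebesgue. ?a s)"
      by (simp add: set_lebesgue_integral_def)
    note i2 = set_integral_add[OF ni ci]
    note i3 = set_integral_add[OF am i2(1)]
    have "2 * (LINT s:{0<..<t}|lebesgue. ip (g s) (u s)) = (LINT s:{0<..<t}|lebesgue. 2 * ip (g s) (u s))"
      by simp
    also have "\<dots> \<le> (LINT s:{0<..<t}|lebesgue. - ?a s + ((1 + 2 * T) * (n s)\<^sup>2 + Y / (2 * T)))"
    proof (rule set_integral_mono_AE)
      show "set_integrable lebesgue {0<..<t} (\<lambda>s. 2 * ip (g s) (u s))" using sub_t[OF gi] by simp
      show "set_integrable lebesgue {0<..<t} (\<lambda>s. - ?a s + ((1 + 2 * T) * (n s)\<^sup>2 + Y / (2 * T)))"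
        by (rule i3(1))
      show "AE s \<in> {0<..<t} in lebesgue. 2 * ip (g s) (u s) \<le> - ?a s + ((1 + 2 * T) * (n s)\<^sup>2 + Y / (2 * T))"
        using pt by eventually_elim (use t in auto)
    qed
    also have "\<dots> = - (LINT s:{0<..<t}|lebesgue. ?a s)
      + ((1 + 2 * T) * (LINT s:{0<..<t}|lebesgue. (n s)\<^sup>2) + t * (Y / (2 * T)))"
      using i3(2) i2(2) am_eq cI by simp
    also have "(LINT s:{0<..<t}|lebesgue. (n s)\<^sup>2) \<le> \<Phi>"
      unfolding \<Phi>_def set_lebesgue_integral_def
    proof (rule Bochner_Integration.integral_mono)
      show "integrable lebesgue (\<lambda>s. indicator {0<..<t} s *\<^sub>R (n s)\<^sup>2)"
        using sub_t[OF n(1)] by (simp add: set_integrable_def)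
      show "integrable lebesgue (\<lambda>s. indicator {0<..<T} s *\<^sub>R (n s)\<^sup>2)"
        using n(1) by (simp add: set_integrable_def)
    qed (use t in \<open>auto simp: indicator_def\<close>)
    also have "t * (Y / (2 * T)) \<le> T * (Y / (2 * T))"
      using t Y T by (intro mult_right_mono) auto
    finally show ?thesis using yt[OF t] T by simp
  qed
  have "0 \<le> (LINT s:{0<..<t1}|lebesgue. ?a s)"
    unfolding set_lebesgue_integral_def
  proof (rule integral_nonneg_AE, rule AE_I2)
    fix s
    show "0 \<le> indicator {0<..<t1} s *\<^sub>R ?a s"
      using psd_form_nonneg[OF a uV[of s]] t1(1) by (auto simp: indicator_def)
  qed
  then have "Y \<le> 2 * (?y 0 + (1 + 2 * T) * \<Phi>)" using main[OF t1(1)] by (simp add: Y_def)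
  moreover have "0 \<le> ?y T" using psd_form_nonneg[OF psd uV[of T]] T by simp
  ultimately show ?thesis using main[of T] T unfolding \<Phi>_def by simp
qed

section \<open>The stability estimate\<close>

text \<open>A single member of the sequence of discretisations: the surface, its mesh and its finite element
  space.  The number \<open>C\<close> is the resolution constant of the mesh; \<open>Ph v\<close> is the projection of \<open>v \<in> L\<^sup>2(\<Gamma>)\<close>.\<close>

locale cut_discretisation =
  fixes \<Gamma> :: "'a::euclidean_space set" and \<nu> :: "'a \<Rightarrow> 'a" and M :: "'a set set"
    and V :: "('a \<Rightarrow> real) set" and C :: real
  assumes hyp: "closed_C2_hypersurface \<Gamma> \<nu>" and mesh: "mesh_around \<Gamma> M"
    and res: "resolves_geometry \<Gamma> \<nu> C M" and fe: "fe_space \<Gamma> \<nu> M V"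
    and ip: "inner_product_on V (ip_star \<Gamma> \<nu> M)"
begin

abbreviation "ipV \<equiv> ip_star \<Gamma> \<nu> M"
abbreviation "aV \<equiv> a_star \<Gamma> \<nu> M"
abbreviation "normH1 \<equiv> norm_H1_surf \<Gamma> \<nu>"
abbreviation "normH1V \<equiv> norm_H1_star \<Gamma> \<nu> M"
abbreviation "dual_norm \<equiv> norm_Hm1_surf \<Gamma> \<nu>"
abbreviation "Ph v \<equiv> P_h \<Gamma> \<nu> M V (L2_to_Hm1 \<Gamma> v)"

lemma V_subspace: "fun_subspace V" using fe by (simp add: fe_space_def fun_subspace_def)

lemma V_H1: "v \<in> V \<Longrightarrow> v \<in> H1_surf \<Gamma> \<nu>" using fe by (auto simp: fe_space_def)

lemma V_L2: "v \<in> V \<Longrightarrow> v \<in> L2_surf \<Gamma>" using V_H1 H1_surf_subset_L2 by blast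

lemma ip_star_psd: "psd_form_on V ipV" by (rule inner_product_on_psd[OF V_subspace ip])

lemma onb_exists: "\<exists>E. onb_on V ipV E"
proof -
  have "\<exists>B. finite B \<and> B \<subseteq> V \<and> (\<forall>v\<in>V. \<exists>c. v = (\<lambda>x. \<Sum>b\<in>B. c b * b x))"
    using fe unfolding fe_space_def by (elim conjE)
  then obtain B where "finite B" "B \<subseteq> V" "\<forall>v\<in>V. \<exists>c. v = (\<lambda>x. \<Sum>b\<in>B. c b * b x)"
    by (elim exE conjE) (rule that)
  then show ?thesis by (rule onb_on_exists[OF V_subspace ip])
qed

lemma a_star_psd: "psd_form_on V aV" by (rule psd_form_a_star[OF hyp mesh res fe])

lemma s_form_psd: "psd_form_on V (s_form \<Gamma> \<nu> M j)" by (rule psd_form_s_form[OF hyp mesh res fe])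

lemma norm_L2_le_star: "v \<in> V \<Longrightarrow> norm_L2_surf \<Gamma> v \<le> norm_star \<Gamma> \<nu> M v"
  using psd_form_nonneg[OF s_form_psd[of 0]] by (simp add: norm_L2_surf_def norm_star_def ip_star_def)

lemma norm_H1_le:
  assumes v: "v \<in> V"
  shows "normH1 v \<le> sqrt (ipV v v) + sqrt (aV v v)"
proof -
  have s: "0 \<le> s_form \<Gamma> \<nu> M j v v" for j by (rule psd_form_nonneg[OF s_form_psd v])
  have nn: "0 \<le> ipV v v" "0 \<le> aV v v"
    using psd_form_nonneg[OF ip_star_psd v] psd_form_nonneg[OF a_star_psd v] by auto
  have "(normH1 v)\<^sup>2 \<le> ipV v v + aV v v"
    using s[of 0] s[of 1] by (simp add: norm_H1_surf_sq ip_star_def a_star_def)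
  then have "normH1 v \<le> sqrt (ipV v v + aV v v)"
    by (rule real_le_rsqrt)
  also have "\<dots> \<le> sqrt (ipV v v) + sqrt (aV v v)"
    by (rule sqrt_add_le_add_sqrt[OF nn])
  finally show ?thesis .
qed

lemma norm_H1_le_H1_star: "v \<in> V \<Longrightarrow> normH1 v \<le> normH1V v"
  unfolding norm_H1_star_def by (rule real_le_rsqrt) (simp add: psd_form_nonneg[OF s_form_psd])

lemma a_star_le_H1_star:
  assumes v: "v \<in> V"
  shows "sqrt (aV v v) \<le> normH1V v"
  using psd_form_nonneg[OF psd_form_ip_surf V_L2[OF v]]
  by (simp add: norm_H1_star_def norm_H1_surf_sq a_star_def)

text \<open>The defining properties of \<open>P\<^sub>h\<close> on \<open>L\<^sup>2(\<Gamma>)\<close> and of \<open>\<Delta>\<^sub>h\<close> on \<open>V\<close>.\<close>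

lemma P_h_L2:
  assumes v: "v \<in> L2_surf \<Gamma>"
  shows "Ph v \<in> V"
    "\<And>w. w \<in> V \<Longrightarrow> ipV (Ph v) w = ip_surf \<Gamma> v w"
proof -
  obtain E where E: "onb_on V ipV E" using onb_exists by blast
  have lin: "ip_surf \<Gamma> v (\<lambda>x. a * z x + b * w x) = a * ip_surf \<Gamma> v z + b * ip_surf \<Gamma> v w"
    if "z \<in> V" "w \<in> V" for z w a b
    by (rule psd_form_lin_right[OF fun_subspace_L2_surf psd_form_ip_surf V_L2[OF that(1)] V_L2[OF that(2)] v])
  note r = riesz_the[where F = "ip_surf \<Gamma> v", OF V_subspace ip E lin]
  show "Ph v \<in> V"
    unfolding P_h_def L2_to_Hm1_def by (rule r(1))
  show "ipV (Ph v) w = ip_surf \<Gamma> v w" if "w \<in> V" for w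
    unfolding P_h_def L2_to_Hm1_def by (rule r(2)[OF _ _ that])
qed

lemma Laplace_h_Riesz:
  assumes v: "v \<in> V"
  shows "Laplace_h \<Gamma> \<nu> M V v \<in> V"
    "\<And>w. w \<in> V \<Longrightarrow> ipV (Laplace_h \<Gamma> \<nu> M V v) w = aV v w"
proof -
  obtain E where E: "onb_on V ipV E" using onb_exists by blast
  have lin: "aV v (\<lambda>x. a * z x + b * w x) = a * aV v z + b * aV v w"
    if "z \<in> V" "w \<in> V" for z w a b
    by (rule psd_form_lin_right[OF V_subspace a_star_psd that v])
  note r = riesz_the[where F = "aV v", OF V_subspace ip E lin]
  show "Laplace_h \<Gamma> \<nu> M V v \<in> V"
    unfolding Laplace_h_def by (rule r(1))
  show "ipV (Laplace_h \<Gamma> \<nu> M V v) w = aV v w" if "w \<in> V" for w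
    unfolding Laplace_h_def by (rule r(2)[OF _ _ that])
qed

lemma P_h_bound:
  assumes fin: "norm_P_h \<Gamma> \<nu> M V < top" and v: "v \<in> H1_surf \<Gamma> \<nu>" "normH1 v \<noteq> 0"
  shows "normH1V (Ph v) \<le> enn2real (norm_P_h \<Gamma> \<nu> M V) * normH1 v"
proof -
  have p: "0 < normH1 v" using v(2) norm_H1_surf_nonneg[of \<Gamma> \<nu> v] by simp
  have q: "0 \<le> normH1V (Ph v)"
    using order_trans[OF norm_H1_surf_nonneg norm_H1_le_H1_star] P_h_L2(1) v(1) H1_surf_subset_L2 by blast
  have "ennreal (normH1V (Ph v) / normH1 v) \<le> norm_P_h \<Gamma> \<nu> M V"
    unfolding norm_P_h_def by (rule SUP_upper) (use v in simp)
  from enn2real_mono[OF this fin] show ?thesis using p q by (simp add: divide_le_eq)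
qed

text \<open>Duality: by the identity \<open>pairing_P_h\<close> below, an element of \<open>V\<close> is tested with \<open>v \<in> H\<^sup>1(\<Gamma>)\<close> through \<open>P\<^sub>h v\<close>, since
  \<open>(z, v)\<^sub>\<Gamma> = (z, P\<^sub>h v)\<^sub>*\<close>.\<close>

lemma norm_Hm1_le_by_duality:
  assumes fin: "norm_P_h \<Gamma> \<nu> M V < top" and c: "0 \<le> c"
    and F: "\<And>v. v \<in> H1_surf \<Gamma> \<nu> \<Longrightarrow> F v = G (Ph v)"
    and G: "\<And>q. q \<in> V \<Longrightarrow> \<bar>G q\<bar> \<le> c * normH1V q"
  shows "dual_norm F \<le> enn2real (norm_P_h \<Gamma> \<nu> M V) * c"
proof (rule norm_Hm1_le)
  show "0 \<le> enn2real (norm_P_h \<Gamma> \<nu> M V) * c" using c by simp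
  fix v assume v: "v \<in> H1_surf \<Gamma> \<nu>" "normH1 v \<noteq> 0"
  let ?q = "Ph v"
  have q: "?q \<in> V" using P_h_L2(1) v(1) H1_surf_subset_L2 by blast
  have "\<bar>F v\<bar> \<le> c * normH1V ?q" unfolding F[OF v(1)] by (rule G[OF q])
  also have "\<dots> \<le> c * (enn2real (norm_P_h \<Gamma> \<nu> M V) * normH1 v)"
    by (rule mult_left_mono[OF P_h_bound[OF fin v] c])
  finally show "\<bar>F v\<bar> \<le> enn2real (norm_P_h \<Gamma> \<nu> M V) * c * normH1 v" by (simp add: mult_ac)
qed

lemma pairing_P_h:
  assumes z: "z \<in> V" and v: "v \<in> H1_surf \<Gamma> \<nu>"
  shows "L2_to_Hm1 \<Gamma> z v = ipV z (Ph v)"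
proof -
  have v2: "v \<in> L2_surf \<Gamma>" using v H1_surf_subset_L2 by blast
  have "L2_to_Hm1 \<Gamma> z v = ip_surf \<Gamma> v z"
    unfolding L2_to_Hm1_def by (rule psd_form_sym[OF psd_form_ip_surf V_L2[OF z] v2])
  also have "\<dots> = ipV (Ph v) z" by (rule P_h_L2(2)[OF v2 z, symmetric])
  finally show ?thesis using psd_form_sym[OF ip_star_psd P_h_L2(1)[OF v2] z] by simp
qed

lemma a_star_dual_bound:
  assumes x: "x \<in> V" and q: "q \<in> V"
  shows "\<bar>aV x q\<bar> \<le> sqrt (aV x x) * normH1V q"
proof -
  have "\<bar>aV x q\<bar> \<le> sqrt (aV x x) * sqrt (aV q q)"
    by (rule psd_form_Cauchy_Schwarz[OF V_subspace a_star_psd x q])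
  also have "\<dots> \<le> sqrt (aV x x) * normH1V q"
    by (rule mult_left_mono[OF a_star_le_H1_star[OF q]]) (simp add: psd_form_nonneg[OF a_star_psd x])
  finally show ?thesis .
qed

lemma Laplace_h_dual_norm:
  assumes fin: "norm_P_h \<Gamma> \<nu> M V < top" and x: "x \<in> V"
  shows "dual_norm (L2_to_Hm1 \<Gamma> (Laplace_h \<Gamma> \<nu> M V x))
    \<le> enn2real (norm_P_h \<Gamma> \<nu> M V) * sqrt (aV x x)"
proof (rule norm_Hm1_le_by_duality[OF fin, where G = "aV x"])
  show "0 \<le> sqrt (aV x x)" by (simp add: psd_form_nonneg[OF a_star_psd x])
  show "L2_to_Hm1 \<Gamma> (Laplace_h \<Gamma> \<nu> M V x) v = aV x (Ph v)"
    if "v \<in> H1_surf \<Gamma> \<nu>" for v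
    using pairing_P_h[OF Laplace_h_Riesz(1)[OF x] that] Laplace_h_Riesz(2)[OF x P_h_L2(1)] that H1_surf_subset_L2 by auto
qed (rule a_star_dual_bound[OF x])

lemma Laplace_h_dual_lipschitz:
  assumes fin: "norm_P_h \<Gamma> \<nu> M V < top" and x: "x \<in> V" and y: "y \<in> V"
  shows "dual_norm (\<lambda>v. L2_to_Hm1 \<Gamma> (Laplace_h \<Gamma> \<nu> M V x) v - L2_to_Hm1 \<Gamma> (Laplace_h \<Gamma> \<nu> M V y) v)
    \<le> enn2real (norm_P_h \<Gamma> \<nu> M V) * sqrt (aV (\<lambda>z. x z - y z) (\<lambda>z. x z - y z))"
proof (rule norm_Hm1_le_by_duality[OF fin, where G = "aV (\<lambda>z. x z - y z)"])
  have d: "(\<lambda>z. x z - y z) \<in> V" by (rule fun_subspace_diff[OF V_subspace x y])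
  show "0 \<le> sqrt (aV (\<lambda>z. x z - y z) (\<lambda>z. x z - y z))" by (simp add: psd_form_nonneg[OF a_star_psd d])
  show "L2_to_Hm1 \<Gamma> (Laplace_h \<Gamma> \<nu> M V x) v - L2_to_Hm1 \<Gamma> (Laplace_h \<Gamma> \<nu> M V y) v
      = aV (\<lambda>z. x z - y z) (Ph v)"
    if v: "v \<in> H1_surf \<Gamma> \<nu>" for v
  proof -
    have q: "Ph v \<in> V" using P_h_L2(1) v H1_surf_subset_L2 by blast
    show ?thesis
      using pairing_P_h[OF Laplace_h_Riesz(1)[OF x] v] pairing_P_h[OF Laplace_h_Riesz(1)[OF y] v]
        Laplace_h_Riesz(2)[OF x q] Laplace_h_Riesz(2)[OF y q] psd_form_diff[OF a_star_psd x y q] by simp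
  qed
  show "\<bar>aV (\<lambda>z. x z - y z) q\<bar>
    \<le> sqrt (aV (\<lambda>z. x z - y z) (\<lambda>z. x z - y z)) * normH1V q" if "q \<in> V" for q
    by (rule a_star_dual_bound[OF d that])
qed

lemma Laplace_h_time_L2:
  assumes fin: "norm_P_h \<Gamma> \<nu> M V < top"
    and u: "u \<in> time_L2 T V (\<lambda>v. sqrt (ipV v v))"
  shows "(\<lambda>t. L2_to_Hm1 \<Gamma> (Laplace_h \<Gamma> \<nu> M V (u t))) \<in> time_L2 T (Hm1_surf \<Gamma> \<nu>) dual_norm"
proof -
  obtain E where E: "onb_on V ipV E" using onb_exists by blast
  obtain K where K: "0 \<le> K" "\<And>v. v \<in> V \<Longrightarrow> aV v v \<le> K * ipV v v"
    using onb_on_form_bounded[OF V_subspace ip_star_psd E a_star_psd] by blast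
  let ?P = "enn2real (norm_P_h \<Gamma> \<nu> M V)"
  have Ks: "?P * sqrt (aV v v) \<le> ?P * sqrt K * sqrt (ipV v v)" if "v \<in> V" for v
    using real_sqrt_le_mono[OF K(2)[OF that]] by (simp add: real_sqrt_mult mult.assoc mult_left_mono)
  show ?thesis
  proof (rule time_L2_map[OF u, where \<Phi> = "\<lambda>x. L2_to_Hm1 \<Gamma> (Laplace_h \<Gamma> \<nu> M V x)" and C = "?P * sqrt K"])
    show "L2_to_Hm1 \<Gamma> (Laplace_h \<Gamma> \<nu> M V x) \<in> Hm1_surf \<Gamma> \<nu>" if "x \<in> V" for x
      by (rule L2_to_Hm1_mem[OF V_L2[OF Laplace_h_Riesz(1)[OF that]]])
    show "dual_norm (\<lambda>v. L2_to_Hm1 \<Gamma> (Laplace_h \<Gamma> \<nu> M V x) v - L2_to_Hm1 \<Gamma> (Laplace_h \<Gamma> \<nu> M V y) v)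
      \<le> ?P * sqrt K * sqrt (ipV (\<lambda>z. x z - y z) (\<lambda>z. x z - y z))" if "x \<in> V" "y \<in> V" for x y
      by (rule order_trans[OF Laplace_h_dual_lipschitz[OF fin that] Ks[OF fun_subspace_diff[OF V_subspace that]]])
    show "dual_norm (L2_to_Hm1 \<Gamma> (Laplace_h \<Gamma> \<nu> M V x)) \<le> ?P * sqrt K * sqrt (ipV x x)" if "x \<in> V" for x
      by (rule order_trans[OF Laplace_h_dual_norm[OF fin that] Ks[OF that]])
  qed (rule norm_Hm1_triangle norm_Hm1_nonneg; assumption)+
qed

lemma norm_Hm1_L2_to_Hm1_le:
  assumes x: "x \<in> V"
  shows "dual_norm (L2_to_Hm1 \<Gamma> x) \<le> 1 * sqrt (ipV x x)"
proof -
  have "dual_norm (L2_to_Hm1 \<Gamma> x) \<le> norm_L2_surf \<Gamma> x"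
  proof (rule norm_Hm1_le)
    show "0 \<le> norm_L2_surf \<Gamma> x"
      using psd_form_nonneg[OF psd_form_ip_surf V_L2[OF x]] by (simp add: norm_L2_surf_def)
  qed (rule L2_to_Hm1_bound[OF V_L2[OF x]])
  then show ?thesis using norm_L2_le_star[OF x] by (simp add: norm_star_def)
qed

lemma L2_to_Hm1_time_L2:
  assumes g: "g \<in> time_L2 T V (\<lambda>v. sqrt (ipV v v))"
  shows "(\<lambda>t. L2_to_Hm1 \<Gamma> (g t)) \<in> time_L2 T (Hm1_surf \<Gamma> \<nu>) dual_norm"
proof (rule time_L2_map[OF g, where C = 1 and \<Phi> = "L2_to_Hm1 \<Gamma>"])
  show "L2_to_Hm1 \<Gamma> x \<in> Hm1_surf \<Gamma> \<nu>" if "x \<in> V" for x by (rule L2_to_Hm1_mem[OF V_L2[OF that]])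
  show "dual_norm (\<lambda>v. L2_to_Hm1 \<Gamma> x v - L2_to_Hm1 \<Gamma> y v)
    \<le> 1 * sqrt (ipV (\<lambda>z. x z - y z) (\<lambda>z. x z - y z))" if x: "x \<in> V" and y: "y \<in> V" for x y
  proof -
    have d: "(\<lambda>z. x z - y z) \<in> V" by (rule fun_subspace_diff[OF V_subspace x y])
    have "dual_norm (\<lambda>v. L2_to_Hm1 \<Gamma> x v - L2_to_Hm1 \<Gamma> y v) \<le> norm_L2_surf \<Gamma> (\<lambda>z. x z - y z)"
    proof (rule norm_Hm1_le)
      show "0 \<le> norm_L2_surf \<Gamma> (\<lambda>z. x z - y z)"
        using psd_form_nonneg[OF psd_form_ip_surf V_L2[OF d]] by (simp add: norm_L2_surf_def)
      fix v assume v: "v \<in> H1_surf \<Gamma> \<nu>"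
      then have "v \<in> L2_surf \<Gamma>" using H1_surf_subset_L2 by blast
      then have "L2_to_Hm1 \<Gamma> x v - L2_to_Hm1 \<Gamma> y v = L2_to_Hm1 \<Gamma> (\<lambda>z. x z - y z) v"
        unfolding L2_to_Hm1_def using psd_form_diff[OF psd_form_ip_surf V_L2[OF x] V_L2[OF y]] by simp
      then show "\<bar>L2_to_Hm1 \<Gamma> x v - L2_to_Hm1 \<Gamma> y v\<bar> \<le> norm_L2_surf \<Gamma> (\<lambda>z. x z - y z) * normH1 v"
        using L2_to_Hm1_bound[OF V_L2[OF d] v] by simp
    qed
    then show ?thesis using norm_L2_le_star[OF d] by (simp add: norm_star_def)
  qed
qed (rule norm_Hm1_triangle norm_Hm1_nonneg norm_Hm1_L2_to_Hm1_le; assumption)+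

text \<open>The variational equation holds at almost every time, simultaneously for all test functions.\<close>

lemma semidiscrete_equation:
  assumes f: "f \<in> time_L2 T (Hm1_surf \<Gamma> \<nu>) dual_norm"
    and u: "u \<in> time_L2 T V (\<lambda>v. sqrt (ipV v v))"
    and g: "g \<in> time_L2 T V (\<lambda>v. sqrt (ipV v v))"
    and eq: "\<And>v1. v1 \<in> time_L2 T V (\<lambda>v. sqrt (ipV v v)) \<Longrightarrow>
      (LINT t:{0<..<T}|lebesgue. ipV (g t) (v1 t) + aV (u t) (v1 t))
      = (LINT t:{0<..<T}|lebesgue. f t (v1 t))"
  shows "AE t in lebesgue_on {0<..<T}. \<forall>w\<in>V. ipV (g t) w + aV (u t) w = f t w"
proof -
  let ?L = "lebesgue_on {0<..<T}"
  obtain E where E: "onb_on V ipV E" using onb_exists by blast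
  have sub: "\<And>e. e \<in> E \<Longrightarrow> e \<in> V" and fin: "finite E" and ES: "E \<subseteq> V" using E by (auto simp: onb_on_def)
  have uV: "u t \<in> V" and gV: "g t \<in> V" and fH: "f t \<in> Hm1_surf \<Gamma> \<nu>" if "t \<in> {0<..<T}" for t
    using time_L2_mem[OF u that] time_L2_mem[OF g that] time_L2_mem[OF f that] by auto
  have flin: "f t (\<lambda>x. a * v x + b * w x) = a * f t v + b * f t w" if "t \<in> {0<..<T}" "v \<in> V" "w \<in> V" for t v w a b
    using fH[OF that(1)] V_H1[OF that(2)] V_H1[OF that(3)] unfolding Hm1_surf_def by blast
  have z: "(\<lambda>x. 0) \<in> V" by (rule fun_subspace_zero[OF V_subspace])
  have one: "AE t in ?L. ipV (g t) w + aV (u t) w = f t w" if w: "w \<in> V" for w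
  proof -
    have gi: "integrable ?L (\<lambda>t. ipV (g t) w)"
      by (rule integrable_if_square_integrable[OF time_L2_form_measurable[OF V_subspace ip_star_psd g w]
            time_L2_form_square_integrable[OF V_subspace ip_star_psd g w]])
    have ui: "integrable ?L (\<lambda>t. aV (u t) w)"
    proof -
      have ci: "integrable ?L (\<lambda>t. ipV (u t) e)" if "e \<in> E" for e
        by (rule integrable_if_square_integrable[OF time_L2_form_measurable[OF V_subspace ip_star_psd u sub[OF that]]
              time_L2_form_square_integrable[OF V_subspace ip_star_psd u sub[OF that]]])
      have "integrable ?L (\<lambda>t. \<Sum>e\<in>E. ipV (u t) e * aV e w)"
        by (intro Bochner_Integration.integrable_sum integrable_mult_left ci)
      moreover have "integrable ?L (\<lambda>t. aV (u t) w)
        = integrable ?L (\<lambda>t. \<Sum>e\<in>E. ipV (u t) e * aV e w)"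
      proof (rule Bochner_Integration.integrable_cong[OF refl])
        fix t assume "t \<in> space ?L"
        then have "t \<in> {0<..<T}" by simp
        then show "aV (u t) w = (\<Sum>e\<in>E. ipV (u t) e * aV e w)"
          by (intro onb_on_form_expand[OF V_subspace a_star_psd E _ w] uV)
      qed
      ultimately show ?thesis by simp
    qed
    have fi: "integrable ?L (\<lambda>t. f t w)"
    proof (rule integrable_if_square_integrable)
      show m: "(\<lambda>t. f t w) \<in> borel_measurable ?L"
      proof (rule time_L2_measurable[OF f, where g = "\<lambda>F. F w" and C = "normH1 w"])
        fix F G assume "F \<in> Hm1_surf \<Gamma> \<nu>" "G \<in> Hm1_surf \<Gamma> \<nu>"
        from Hm1_bound[OF fun_subspace_diff[OF fun_subspace_Hm1 this] V_H1[OF w]]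
        show "\<bar>F w - G w\<bar> \<le> normH1 w * dual_norm (\<lambda>z. F z - G z)"
          by (simp add: mult.commute)
      qed
      show "integrable ?L (\<lambda>t. (f t w)\<^sup>2)"
      proof (rule Bochner_Integration.integrable_bound)
        show "integrable ?L (\<lambda>t. (dual_norm (f t))\<^sup>2 * (normH1 w)\<^sup>2)"
          by (intro integrable_mult_left time_L2_integrable[OF f])
        show "(\<lambda>t. (f t w)\<^sup>2) \<in> borel_measurable ?L" using m by simp
        show "AE t in ?L. norm ((f t w)\<^sup>2) \<le> norm ((dual_norm (f t))\<^sup>2 * (normH1 w)\<^sup>2)"
          using AE_space
        proof eventually_elim
          case (elim t)
          then have "\<bar>f t w\<bar>\<^sup>2 \<le> (dual_norm (f t) * normH1 w)\<^sup>2"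
            by (intro power_mono Hm1_bound fH V_H1[OF w]) auto
          then show ?case by (simp add: power_mult_distrib)
        qed
      qed
    qed
    let ?h = "\<lambda>t. ipV (g t) w + aV (u t) w - f t w"
    have hi: "integrable ?L ?h"
      by (intro Bochner_Integration.integrable_diff Bochner_Integration.integrable_add gi ui fi)
    have "AE t in ?L. ?h t = 0"
    proof (rule AE_zero_if_set_integrals_zero[OF hi])
      fix A assume A: "A \<in> sets ?L"
      let ?v = "\<lambda>t. if t \<in> A then w else (\<lambda>x. 0)"
      have "(LINT t|?L. ipV (g t) (?v t) + aV (u t) (?v t)) = (LINT t|?L. f t (?v t))"
        using eq[OF time_L2_const_on[OF V_subspace ip_star_psd w A]] by (simp add: set_integral_lebesgue_on(1))
      moreover have "(LINT t|?L. ipV (g t) (?v t) + aV (u t) (?v t))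
        = (LINT t|?L. indicator A t * (ipV (g t) w + aV (u t) w))"
      proof (rule Bochner_Integration.integral_cong[OF refl])
        fix t assume "t \<in> space ?L"
        then have t: "t \<in> {0<..<T}" by simp
        have "ipV (g t) (\<lambda>x. 0) = 0" "aV (u t) (\<lambda>x. 0) = 0"
          using psd_form_zero[OF V_subspace ip_star_psd gV[OF t]] psd_form_sym[OF ip_star_psd z gV[OF t]]
            psd_form_zero[OF V_subspace a_star_psd uV[OF t]] psd_form_sym[OF a_star_psd z uV[OF t]] by auto
        then show "ipV (g t) (?v t) + aV (u t) (?v t)
          = indicator A t * (ipV (g t) w + aV (u t) w)" by simp
      qed
      moreover have "(LINT t|?L. f t (?v t)) = (LINT t|?L. indicator A t * f t w)"
      proof (rule Bochner_Integration.integral_cong[OF refl])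
        fix t assume "t \<in> space ?L"
        then have "f t (\<lambda>x. 0) = 0" using flin[OF _ z z, of t 0 0] by simp
        then show "f t (?v t) = indicator A t * f t w" by simp
      qed
      moreover have "integrable ?L (\<lambda>t. indicator A t * (ipV (g t) w + aV (u t) w))"
        "integrable ?L (\<lambda>t. indicator A t * f t w)"
        using integrable_mult_indicator[OF A Bochner_Integration.integrable_add[OF gi ui]]
          integrable_mult_indicator[OF A fi] by simp_all
      ultimately show "(LINT t|?L. indicator A t * ?h t) = 0"
        by (simp add: right_diff_distrib)
    qed
    then show ?thesis by eventually_elim simp
  qed
  have "AE t in ?L. \<forall>e\<in>E. ipV (g t) e + aV (u t) e = f t e"
    by (rule AE_finite_allI[OF fin]) (rule one[OF sub])
  then show ?thesis
    using AE_space
  proof eventually_elim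
    case (elim t)
    then have t: "t \<in> {0<..<T}" by simp
    show ?case
    proof
      fix w assume w: "w \<in> V"
      let ?c = "ipV w"
      have w_eq: "w = (\<lambda>x. \<Sum>e\<in>E. ?c e * e x)" by (rule onb_on_expand[OF E w])
      have "ipV (g t) w = (\<Sum>e\<in>E. ?c e * ipV (g t) e)"
        using onb_on_parseval[OF V_subspace ip_star_psd E w gV[OF t]] psd_form_sym[OF ip_star_psd w gV[OF t]] by simp
      moreover have "aV (u t) w = (\<Sum>e\<in>E. ?c e * aV (u t) e)"
      proof -
        have "aV (u t) w = (\<Sum>e\<in>E. ?c e * aV e (u t))"
          using onb_on_form_expand[OF V_subspace a_star_psd E w uV[OF t]] psd_form_sym[OF a_star_psd w uV[OF t]] by simp
        also have "\<dots> = (\<Sum>e\<in>E. ?c e * aV (u t) e)"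
          by (intro sum.cong refl arg_cong2[where f = "(*)"] psd_form_sym[OF a_star_psd sub uV[OF t]])
        finally show ?thesis .
      qed
      moreover have "f t w = (\<Sum>e\<in>E. ?c e * f t e)"
      proof -
        have "f t (\<lambda>x. \<Sum>e\<in>E. ?c e * e x) = (\<Sum>e\<in>E. ?c e * f t e)"
          by (rule functional_sum[where F = "f t" and V = V and c = "?c" and E = E, OF V_subspace _ fin ES])
            (rule flin[OF t])
        then show ?thesis using arg_cong[OF w_eq, of "f t"] by simp
      qed
      ultimately show "ipV (g t) w + aV (u t) w = f t w"
        using elim(1) by (simp add: sum.distrib[symmetric] distrib_left[symmetric])
    qed
  qed
qed

text \<open>The discrete initial value is the projection \<open>P\<^sub>h u\<^sub>0\<close>, which does not increase the norm.\<close>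

lemma initial_value_bound:
  assumes u0: "u0 \<in> L2_surf \<Gamma>" and x: "x \<in> V"
    and eq: "\<And>w. w \<in> V \<Longrightarrow> ipV x w = ip_surf \<Gamma> u0 w"
  shows "ipV x x \<le> (norm_L2_surf \<Gamma> u0)\<^sup>2"
proof (cases "ipV x x = 0")
  case False
  let ?s = "sqrt (ipV x x)"
  have nn: "0 \<le> ipV x x" by (rule psd_form_nonneg[OF ip_star_psd x])
  have U: "0 \<le> norm_L2_surf \<Gamma> u0"
    using psd_form_nonneg[OF psd_form_ip_surf u0] by (simp add: norm_L2_surf_def)
  have "?s * ?s = ip_surf \<Gamma> u0 x" using eq[OF x] nn by simp
  also have "\<dots> \<le> norm_L2_surf \<Gamma> u0 * norm_L2_surf \<Gamma> x"
    using psd_form_Cauchy_Schwarz[OF fun_subspace_L2_surf psd_form_ip_surf u0 V_L2[OF x]]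
    by (simp add: norm_L2_surf_def)
  also have "\<dots> \<le> norm_L2_surf \<Gamma> u0 * ?s"
    using norm_L2_le_star[OF x] by (intro mult_left_mono U) (simp add: norm_star_def)
  finally have "?s \<le> norm_L2_surf \<Gamma> u0"
    by (rule mult_right_le_imp_le) (use False nn in simp)
  then have "?s\<^sup>2 \<le> (norm_L2_surf \<Gamma> u0)\<^sup>2" using nn by (intro power_mono) auto
  then show ?thesis using nn by simp
qed simp

lemma parabolic_stability:
  assumes T: "0 < T" and fin: "norm_P_h \<Gamma> \<nu> M V < top" and u0: "u0 \<in> L2_surf \<Gamma>"
    and f: "f \<in> time_L2 T (Hm1_surf \<Gamma> \<nu>) dual_norm"
    and u: "u \<in> U_space \<Gamma> \<nu> M V T"
    and eq: "\<forall>v\<in>V_space \<Gamma> \<nu> M V T. b_h \<Gamma> \<nu> M V T u v = ell \<Gamma> T u0 f v"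
  shows "(\<lambda>t. L2_to_Hm1 \<Gamma> (Laplace_h \<Gamma> \<nu> M V (u t))) \<in> time_L2 T (Hm1_surf \<Gamma> \<nu>) dual_norm"
    and "(\<lambda>t. L2_to_Hm1 \<Gamma> (dt_h \<Gamma> \<nu> M V T u t)) \<in> time_L2 T (Hm1_surf \<Gamma> \<nu>) dual_norm"
    and "norm_time_L2 T dual_norm (\<lambda>t. L2_to_Hm1 \<Gamma> (Laplace_h \<Gamma> \<nu> M V (u t))) +
         norm_time_L2 T dual_norm (\<lambda>t. L2_to_Hm1 \<Gamma> (dt_h \<Gamma> \<nu> M V T u t))
           \<le> C_MPR \<Gamma> \<nu> M V T * (norm_time_L2 T dual_norm f + norm_L2_surf \<Gamma> u0)"
proof -
  let ?L = "lebesgue_on {0<..<T}"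
  let ?P = "enn2real (norm_P_h \<Gamma> \<nu> M V)"
  obtain E where E: "onb_on V ipV E" using onb_exists by blast
  have star: "norm_star \<Gamma> \<nu> M = (\<lambda>v. sqrt (ipV v v))" by (auto simp: norm_star_def)
  have uH: "u \<in> time_H1 T V ipV" using u by (simp add: U_space_def)
  define g where "g = dt_h \<Gamma> \<nu> M V T u"
  have "\<exists>g. has_weak_tderiv T V ipV u g" using uH unfolding time_H1_def by blast
  then have gd: "has_weak_tderiv T V ipV u g"
    unfolding g_def dt_h_def tderiv_def by (rule someI_ex)
  have uL: "u \<in> time_L2 T V (\<lambda>v. sqrt (ipV v v))" using uH unfolding time_H1_def by blast
  have gL: "g \<in> time_L2 T V (\<lambda>v. sqrt (ipV v v))" using gd unfolding has_weak_tderiv_def by blast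
  have uV0: "u t \<in> V" if "t \<in> {0..T}" for t using uH that unfolding time_H1_def by blast
  have uV: "u t \<in> V" if "t \<in> {0<..<T}" for t using time_L2_mem[OF uL that] .
  have gV: "g t \<in> V" if "t \<in> {0<..<T}" for t using time_L2_mem[OF gL that] .
  have fH: "f t \<in> Hm1_surf \<Gamma> \<nu>" if "t \<in> {0<..<T}" for t using time_L2_mem[OF f that] .
  show LL: "(\<lambda>t. L2_to_Hm1 \<Gamma> (Laplace_h \<Gamma> \<nu> M V (u t))) \<in> time_L2 T (Hm1_surf \<Gamma> \<nu>) dual_norm"
    by (rule Laplace_h_time_L2[OF fin uL])
  have GL: "(\<lambda>t. L2_to_Hm1 \<Gamma> (g t)) \<in> time_L2 T (Hm1_surf \<Gamma> \<nu>) dual_norm"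
    by (rule L2_to_Hm1_time_L2[OF gL])
  then show "(\<lambda>t. L2_to_Hm1 \<Gamma> (dt_h \<Gamma> \<nu> M V T u t)) \<in> time_L2 T (Hm1_surf \<Gamma> \<nu>) dual_norm"
    unfolding g_def .
  have z: "(\<lambda>x. 0) \<in> V" by (rule fun_subspace_zero[OF V_subspace])
  have z0: "ipV v (\<lambda>x. 0) = 0" "aV v (\<lambda>x. 0) = 0" if "v \<in> V" for v
    using psd_form_zero[OF V_subspace ip_star_psd that] psd_form_sym[OF ip_star_psd z that]
      psd_form_zero[OF V_subspace a_star_psd that] psd_form_sym[OF a_star_psd z that] by auto
  have f0: "f t (\<lambda>x. 0) = 0" if "t \<in> {0<..<T}" for t
  proof -
    have "\<bar>f t (\<lambda>x. 0)\<bar> \<le> dual_norm (f t) * normH1 (\<lambda>x. 0)" by (rule Hm1_bound[OF fH[OF that] V_H1[OF z]])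
    also have "normH1 (\<lambda>x. 0) \<le> 0"
      using norm_H1_le[OF z] z0[OF z] by simp
    finally show ?thesis using norm_Hm1_nonneg[of \<Gamma> \<nu> "f t"]
      by (simp add: mult_left_mono)
  qed
  have u00: "ip_surf \<Gamma> u0 (\<lambda>x. 0) = 0" by (simp add: ip_surf_def)
  have eq': "ipV (u 0) v0 + (LINT t:{0<..<T}|lebesgue. ipV (g t) (v1 t) + aV (u t) (v1 t))
      = ip_surf \<Gamma> u0 v0 + (LINT t:{0<..<T}|lebesgue. f t (v1 t))"
    if "v0 \<in> V" "v1 \<in> time_L2 T V (\<lambda>v. sqrt (ipV v v))" for v0 v1
    using bspec[OF eq, of "(v0, v1)"] that by (simp add: V_space_def star b_h_def ell_def g_def)
  have eqt: "AE t in ?L. \<forall>w\<in>V. ipV (g t) w + aV (u t) w = f t w"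
  proof (rule semidiscrete_equation[OF f uL gL])
    fix v1 assume "v1 \<in> time_L2 T V (\<lambda>v. sqrt (ipV v v))"
    from eq'[OF z this]
    show "(LINT t:{0<..<T}|lebesgue. ipV (g t) (v1 t) + aV (u t) (v1 t)) = (LINT t:{0<..<T}|lebesgue. f t (v1 t))"
      using z0[OF uV0[of 0]] T u00 by simp
  qed
  have init: "ipV (u 0) w = ip_surf \<Gamma> u0 w" if w: "w \<in> V" for w
  proof -
    \<comment> \<open>Test with \<open>(w, 0)\<close>.\<close>
    have v1: "(\<lambda>t. (\<lambda>x. 0)) \<in> time_L2 T V (\<lambda>v. sqrt (ipV v v))"
      using time_L2_const_on[OF V_subspace ip_star_psd z, of "{}" T] by simp
    have "(LINT t:{0<..<T}|lebesgue. ipV (g t) (\<lambda>x. 0) + aV (u t) (\<lambda>x. 0)) = (LINT t:{0<..<T}|lebesgue. 0)"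
      by (rule set_lebesgue_integral_cong) (use z0 uV gV in auto)
    moreover have "(LINT t:{0<..<T}|lebesgue. f t (\<lambda>x. 0)) = (LINT t:{0<..<T}|lebesgue. 0)"
      by (rule set_lebesgue_integral_cong) (use f0 in auto)
    ultimately show ?thesis using eq'[OF w v1] by simp
  qed
  define U where "U = norm_L2_surf \<Gamma> u0"
  define n where "n t = dual_norm (f t)" for t
  define \<Phi> where "\<Phi> = (LINT t:{0<..<T}|lebesgue. (n t)\<^sup>2)"
  define A where "A = (LINT t:{0<..<T}|lebesgue. aV (u t) (u t))"
  have n0: "0 \<le> n t" for t by (simp add: n_def norm_Hm1_nonneg)
  have U0: "0 \<le> U" using psd_form_nonneg[OF psd_form_ip_surf u0] by (simp add: U_def norm_L2_surf_def)
  have ni: "integrable ?L (\<lambda>t. (n t)\<^sup>2)" unfolding n_def by (rule time_L2_integrable[OF f])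
  have ai: "integrable ?L (\<lambda>t. aV (u t) (u t))" by (rule time_L2_form_integrable[OF V_subspace ip_star_psd E a_star_psd uL uL])
  have A_L: "A = (LINT t|?L. aV (u t) (u t))" and \<Phi>_L: "\<Phi> = (LINT t|?L. (n t)\<^sup>2)"
    by (simp_all add: A_def \<Phi>_def set_integral_lebesgue_on(1))
  have \<Phi>0: "0 \<le> \<Phi>" unfolding \<Phi>_L by (rule integral_nonneg_AE) simp
  have "A \<le> 2 * (ipV (u 0) (u 0) + (1 + 2 * T) * \<Phi>)"
    unfolding A_def \<Phi>_def
  proof (rule energy_estimate[OF V_subspace ip E T a_star_psd uH gd _ n0])
    show "set_integrable lebesgue {0<..<T} (\<lambda>t. (n t)\<^sup>2)" using ni by (simp add: set_integral_lebesgue_on(2))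
    show "AE t in ?L. ipV (g t) (u t) + aV (u t) (u t) \<le> n t * (sqrt (ipV (u t) (u t)) + sqrt (aV (u t) (u t)))"
      using eqt AE_space
    proof eventually_elim
      case (elim t)
      then have t: "t \<in> {0<..<T}" by simp
      have "ipV (g t) (u t) + aV (u t) (u t) = f t (u t)" using elim(1) uV[OF t] by blast
      also have "\<dots> \<le> n t * normH1 (u t)"
        using Hm1_bound[OF fH[OF t] V_H1[OF uV[OF t]]] by (simp add: n_def)
      also have "\<dots> \<le> n t * (sqrt (ipV (u t) (u t)) + sqrt (aV (u t) (u t)))"
        by (rule mult_left_mono[OF norm_H1_le[OF uV[OF t]] n0])
      finally show ?case .
    qed
  qed
  also have "\<dots> \<le> 2 * (U\<^sup>2 + (1 + 2 * T) * \<Phi>)"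
    using initial_value_bound[OF u0 uV0[of 0] init] T by (simp add: U_def)
  finally have A: "A \<le> 2 * (U\<^sup>2 + (1 + 2 * T) * \<Phi>)" .
  \<comment> \<open>\<open>S\<close> collects the data and the factor \<open>1 + 2 T\<close>: the two norms to be estimated are at most
    \<open>2 \<parallel>P\<^sub>h\<parallel> S\<close> and \<open>3 \<parallel>P\<^sub>h\<parallel> S\<close>, and \<open>5 \<le> 2 \<surd>8\<close>.\<close>
  define S where "S = (1 + 2 * T) * (sqrt \<Phi> + U)"
  have S0: "0 \<le> S" using T U0 \<Phi>0 by (simp add: S_def)
  have US: "U\<^sup>2 + (1 + 2 * T) * \<Phi> \<le> S\<^sup>2"
  proof -
    have m: "1 \<le> (1 + 2 * T)\<^sup>2" "1 + 2 * T \<le> (1 + 2 * T)\<^sup>2"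
      using T by (auto simp: power2_eq_square algebra_simps)
    have "U\<^sup>2 + (1 + 2 * T) * \<Phi> \<le> (1 + 2 * T)\<^sup>2 * U\<^sup>2 + (1 + 2 * T)\<^sup>2 * \<Phi>"
      using mult_right_mono[OF m(1), of "U\<^sup>2"] mult_right_mono[OF m(2) \<Phi>0] by simp
    also have "\<dots> \<le> (1 + 2 * T)\<^sup>2 * (sqrt \<Phi> + U)\<^sup>2"
    proof -
      have "U\<^sup>2 + \<Phi> \<le> (sqrt \<Phi> + U)\<^sup>2" using \<Phi>0 U0 by (simp add: power2_sum)
      then show ?thesis unfolding distrib_left[symmetric] by (rule mult_left_mono) simp
    qed
    finally show ?thesis by (simp add: S_def power_mult_distrib)
  qed
  have "1 * \<Phi> \<le> (1 + 2 * T) * \<Phi>" using T by (intro mult_right_mono \<Phi>0) simp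
  then have \<Phi>S: "\<Phi> \<le> S\<^sup>2" using US zero_le_power2[of U] by linarith
  have AS: "A \<le> 4 * S\<^sup>2" "2 * \<Phi> + 2 * A \<le> 9 * S\<^sup>2"
  proof -
    have "A \<le> 2 * S\<^sup>2" using A mult_left_mono[OF US, of 2] by simp
    then show "A \<le> 4 * S\<^sup>2" "2 * \<Phi> + 2 * A \<le> 9 * S\<^sup>2"
      using \<Phi>S zero_le_power2[of S] by - linarith+
  qed
  have nt: "norm_time_L2 T dual_norm F = sqrt (LINT t|?L. (dual_norm (F t))\<^sup>2)" for F
    by (simp add: norm_time_L2_def set_integral_lebesgue_on(1))
  have 1: "norm_time_L2 T dual_norm (\<lambda>t. L2_to_Hm1 \<Gamma> (Laplace_h \<Gamma> \<nu> M V (u t))) \<le> ?P * (2 * S)"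
    unfolding nt
  proof (rule real_le_lsqrt)
    show "0 \<le> ?P * (2 * S)" using S0 by simp
    have "(LINT t|?L. (dual_norm (L2_to_Hm1 \<Gamma> (Laplace_h \<Gamma> \<nu> M V (u t))))\<^sup>2) \<le> (LINT t|?L. ?P\<^sup>2 * aV (u t) (u t))"
    proof (rule Bochner_Integration.integral_mono[OF time_L2_integrable[OF LL]])
      show "integrable ?L (\<lambda>t. ?P\<^sup>2 * aV (u t) (u t))" using ai by simp
      fix t assume "t \<in> space ?L"
      then have t: "u t \<in> V" using uV by simp
      have "(dual_norm (L2_to_Hm1 \<Gamma> (Laplace_h \<Gamma> \<nu> M V (u t))))\<^sup>2 \<le> (?P * sqrt (aV (u t) (u t)))\<^sup>2"
        by (rule power_mono[OF Laplace_h_dual_norm[OF fin t] norm_Hm1_nonneg])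
      then show "(dual_norm (L2_to_Hm1 \<Gamma> (Laplace_h \<Gamma> \<nu> M V (u t))))\<^sup>2 \<le> ?P\<^sup>2 * aV (u t) (u t)"
        using psd_form_nonneg[OF a_star_psd t] by (simp add: power_mult_distrib)
    qed
    also have "\<dots> = ?P\<^sup>2 * A" by (simp add: A_L)
    also have "\<dots> \<le> ?P\<^sup>2 * (4 * S\<^sup>2)" by (rule mult_left_mono[OF AS(1)]) simp
    finally show "(LINT t|?L. (dual_norm (L2_to_Hm1 \<Gamma> (Laplace_h \<Gamma> \<nu> M V (u t))))\<^sup>2) \<le> (?P * (2 * S))\<^sup>2"
      by (simp add: power_mult_distrib)
  qed
  have 2: "norm_time_L2 T dual_norm (\<lambda>t. L2_to_Hm1 \<Gamma> (g t)) \<le> ?P * (3 * S)"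
    unfolding nt
  proof (rule real_le_lsqrt)
    show "0 \<le> ?P * (3 * S)" using S0 by simp
    have "(LINT t|?L. (dual_norm (L2_to_Hm1 \<Gamma> (g t)))\<^sup>2) \<le> (LINT t|?L. ?P\<^sup>2 * (2 * (n t)\<^sup>2 + 2 * aV (u t) (u t)))"
    proof (rule integral_mono_AE[OF time_L2_integrable[OF GL]])
      show "integrable ?L (\<lambda>t. ?P\<^sup>2 * (2 * (n t)\<^sup>2 + 2 * aV (u t) (u t)))" using ai ni by simp
      show "AE t in ?L. (dual_norm (L2_to_Hm1 \<Gamma> (g t)))\<^sup>2 \<le> ?P\<^sup>2 * (2 * (n t)\<^sup>2 + 2 * aV (u t) (u t))"
        using eqt AE_space
      proof eventually_elim
        case (elim t)
        then have t: "t \<in> {0<..<T}" by simp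
        note ut = uV[OF t] and gt = gV[OF t]
        have "dual_norm (L2_to_Hm1 \<Gamma> (g t)) \<le> ?P * (n t + sqrt (aV (u t) (u t)))"
        proof (rule norm_Hm1_le_by_duality[OF fin, where G = "ipV (g t)"])
          show "0 \<le> n t + sqrt (aV (u t) (u t))" using n0[of t] psd_form_nonneg[OF a_star_psd ut] by simp
          fix q assume q: "q \<in> V"
          have "\<bar>f t q\<bar> \<le> n t * normH1 q"
            unfolding n_def by (rule Hm1_bound[OF fH[OF t] V_H1[OF q]])
          also have "\<dots> \<le> n t * normH1V q"
            by (rule mult_left_mono[OF norm_H1_le_H1_star[OF q] n0])
          finally have "\<bar>f t q\<bar> \<le> n t * normH1V q" .
          moreover have "ipV (g t) q = f t q - aV (u t) q" using bspec[OF elim(1) q] by simp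
          ultimately show "\<bar>ipV (g t) q\<bar> \<le> (n t + sqrt (aV (u t) (u t))) * normH1V q"
            using a_star_dual_bound[OF ut q] by (simp add: distrib_right)
        qed (rule pairing_P_h[OF gt])
        then have "(dual_norm (L2_to_Hm1 \<Gamma> (g t)))\<^sup>2 \<le> (?P * (n t + sqrt (aV (u t) (u t))))\<^sup>2"
          by (rule power_mono) (rule norm_Hm1_nonneg)
        also have "\<dots> \<le> ?P\<^sup>2 * (2 * (n t)\<^sup>2 + 2 * aV (u t) (u t))"
        proof -
          have "0 \<le> (n t - sqrt (aV (u t) (u t)))\<^sup>2" by simp
          then have "(n t + sqrt (aV (u t) (u t)))\<^sup>2 \<le> 2 * (n t)\<^sup>2 + 2 * aV (u t) (u t)"
            using psd_form_nonneg[OF a_star_psd ut] by (simp add: power2_sum power2_diff)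
          then show ?thesis unfolding power_mult_distrib by (rule mult_left_mono) simp
        qed
        finally show ?case .
      qed
    qed
    also have "\<dots> = ?P\<^sup>2 * (2 * \<Phi> + 2 * A)" using ai ni by (simp add: A_L \<Phi>_L)
    also have "\<dots> \<le> ?P\<^sup>2 * (9 * S\<^sup>2)"
      by (rule mult_left_mono[OF AS(2)]) simp
    finally show "(LINT t|?L. (dual_norm (L2_to_Hm1 \<Gamma> (g t)))\<^sup>2) \<le> (?P * (3 * S))\<^sup>2"
      by (simp add: power_mult_distrib)
  qed
  have s8: "5 \<le> 2 * sqrt 8"
  proof -
    have "5 / 2 \<le> sqrt 8" by (rule real_le_rsqrt) (simp add: power2_eq_square)
    then show ?thesis by simp
  qed
  have "?P * (2 * S) + ?P * (3 * S) = 5 * (?P * S)" by simp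
  also have "\<dots> \<le> 2 * sqrt 8 * ((?P + enn2real (C_inv \<Gamma> \<nu> M V)) * S)"
    using s8 S0 by (intro mult_mono mult_right_mono) auto
  also have "\<dots> = C_MPR \<Gamma> \<nu> M V T * (sqrt \<Phi> + U)"
    by (simp add: C_MPR_def c_minus_def S_def)
  finally have total: "?P * (2 * S) + ?P * (3 * S) \<le> C_MPR \<Gamma> \<nu> M V T * (sqrt \<Phi> + U)" .
  have nf: "norm_time_L2 T dual_norm f = sqrt \<Phi>" by (simp add: nt \<Phi>_L n_def)
  show "norm_time_L2 T dual_norm (\<lambda>t. L2_to_Hm1 \<Gamma> (Laplace_h \<Gamma> \<nu> M V (u t))) +
         norm_time_L2 T dual_norm (\<lambda>t. L2_to_Hm1 \<Gamma> (dt_h \<Gamma> \<nu> M V T u t))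
           \<le> C_MPR \<Gamma> \<nu> M V T * (norm_time_L2 T dual_norm f + norm_L2_surf \<Gamma> u0)"
    using order_trans[OF add_mono[OF 1 2] total] unfolding g_def U_def nf .
qed

end

theorem proposition4p7:
  fixes \<Gamma> :: "'a::euclidean_space set" and \<nu> :: "'a \<Rightarrow> 'a"
    and M :: "nat \<Rightarrow> 'a set set" and V :: "nat \<Rightarrow> ('a \<Rightarrow> real) set"
    and C T :: real and u\<^sub>0 :: "'a \<Rightarrow> real" and f :: "real \<Rightarrow> ('a \<Rightarrow> real) \<Rightarrow> real"
    and k :: nat and u :: "real \<Rightarrow> 'a \<Rightarrow> real"
  assumes "closed_C2_hypersurface \<Gamma> \<nu>"
    and "0 < C" and "0 < T"
    and "\<And>k. mesh_around \<Gamma> (M k)"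
    and "\<And>k. resolves_geometry \<Gamma> \<nu> C (M k)"
    and "\<And>k. fe_space \<Gamma> \<nu> (M k) (V k)"
    and "\<And>k. inner_product_on (V k) (ip_star \<Gamma> \<nu> (M k))"
    and "\<exists>B::real. \<forall>k. norm_P_h \<Gamma> \<nu> (M k) (V k) \<le> ennreal B \<and> C_inv \<Gamma> \<nu> (M k) (V k) \<le> ennreal B"
    and "u\<^sub>0 \<in> L2_surf \<Gamma>"
    and "f \<in> time_L2 T (Hm1_surf \<Gamma> \<nu>) (norm_Hm1_surf \<Gamma> \<nu>)"
    and "u \<in> U_space \<Gamma> \<nu> (M k) (V k) T"
    and "\<forall>v\<in>V_space \<Gamma> \<nu> (M k) (V k) T. b_h \<Gamma> \<nu> (M k) (V k) T u v = ell \<Gamma> T u\<^sub>0 f v"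
  shows "(\<lambda>t. L2_to_Hm1 \<Gamma> (Laplace_h \<Gamma> \<nu> (M k) (V k) (u t)))
           \<in> time_L2 T (Hm1_surf \<Gamma> \<nu>) (norm_Hm1_surf \<Gamma> \<nu>) \<and>
         (\<lambda>t. L2_to_Hm1 \<Gamma> (dt_h \<Gamma> \<nu> (M k) (V k) T u t))
           \<in> time_L2 T (Hm1_surf \<Gamma> \<nu>) (norm_Hm1_surf \<Gamma> \<nu>) \<and>
         norm_time_L2 T (norm_Hm1_surf \<Gamma> \<nu>) (\<lambda>t. L2_to_Hm1 \<Gamma> (Laplace_h \<Gamma> \<nu> (M k) (V k) (u t))) +
         norm_time_L2 T (norm_Hm1_surf \<Gamma> \<nu>) (\<lambda>t. L2_to_Hm1 \<Gamma> (dt_h \<Gamma> \<nu> (M k) (V k) T u t))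
           \<le> C_MPR \<Gamma> \<nu> (M k) (V k) T *
               (norm_time_L2 T (norm_Hm1_surf \<Gamma> \<nu>) f + norm_L2_surf \<Gamma> u\<^sub>0)"
proof -
  interpret cut_discretisation \<Gamma> \<nu> "M k" "V k" C
    by unfold_locales (fact assms)+
  obtain B :: real where "norm_P_h \<Gamma> \<nu> (M k) (V k) \<le> ennreal B" using assms(8) by blast
  then have fin: "norm_P_h \<Gamma> \<nu> (M k) (V k) < top" by (rule le_less_trans) (rule ennreal_less_top)
  show ?thesis
    by (intro conjI parabolic_stability[OF assms(3) fin assms(9,10,11,12)])
qed

end
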